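(* Let $H=\mathfrak{H}+h\circ\pi$ and $\hat H=\hat{\mathfrak{H}}+\hat h\circ\pi$ be simple functions on $T^{\ast}Q$ and let $V\subset T^{\ast}Q$ be a linear subbundle. The following conditions are equivalent. 1. $\{\hat H,H\}(\sigma)=0$ for all $\sigma\in V$. 2. Given a torsion-free connection, for all $q\in Q$ and $\sigma\in V_q$, $\langle\mathbb{B}\hat{\mathfrak{H}}(\sigma),\mathbb{F}\mathfrak{H}(\sigma)\rangle-\langle\mathbb{B}\mathfrak{H}(\sigma),\mathbb{F}\hat{\mathfrak{H}}(\sigma)\rangle=0$ and $\langle d\hat h(q),\mathbb{F}\mathfrak{H}(\sigma)\rangle-\langle dh(q),\mathbb{F}\hat{\mathfrak{H}}(\sigma)\rangle=0$. 3. Given a local chart $(U,\varphi)$ of $Q$, for all $q\in U$ with coordinates $\mathbf{q}$ and all $\mathbf{p}=(p_1,\dots,p_n)$ that are the components of a covector in $V_q$, $$\left(\frac{\partial\hat{\mathbb{H}}^{ij}(\mathbf{q})}{\partial q^k}\mathbb{H}^{kl}(\mathbf{q})-\frac{\partial\mathbb{H}^{ij}(\mathbf{q})}{\partial q^k}\hat{\mathbb{H}}^{kl}(\mathbf{q})\right)p_ip_jp_l=0\quad\text{and}\quad\left(\frac{\partial\hat h(\mathbf{q})}{\partial q^k}\mathbb{H}^{kl}(\mathbf{q})-\frac{\partial h(\mathbf{q})}{\partial q^k}\hat{\mathbb{H}}^{kl}(\mathbf{q})\right)p_l=0.$$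
   Context: All manifolds are smooth and finite dimensional and all maps are smooth; $n=\dim Q$; sum over repeated indices. $\pi:T^{\ast}Q\to Q$ is the projection. A function on $T^{\ast}Q$ is simple if it has the form $\mathfrak{H}+h\circ\pi$ with $h\in C^\infty(Q)$ and $\mathfrak{H}(\alpha)=\frac12\langle\alpha,\rho^\sharp(\alpha)\rangle$ for a Riemannian metric $\rho$ on $Q$ (for $\hat H$ the metric is $\hat\rho$). In canonical coordinates $H(\mathbf{q},\mathbf{p})=\frac12p_i\mathbb{H}^{ij}(\mathbf{q})p_j+h(\mathbf{q})$ and $\hat H(\mathbf{q},\mathbf{p})=\frac12p_i\hat{\mathbb{H}}^{ij}(\mathbf{q})p_j+\hat h(\mathbf{q})$, with $\mathbb{H}^{ij}$, $\hat{\mathbb{H}}^{ij}$ symmetric. $\{F,G\}=\frac{\partial F}{\partial q^i}\frac{\partial G}{\partial p_i}-\frac{\partial G}{\partial q^i}\frac{\partial F}{\partial p_i}$. Fiber derivative of $F:T^{\ast}Q\to\mathbb{R}$: $\mathbb{F}F:T^{\ast}Q\to TQ$, $\langle\sigma,\mathbb{F}F(\alpha)\rangle=\frac{d}{ds}|_{0}F(\alpha+s\sigma)$. Base derivative, given a connection on $TQ$ and its dual on $T^{\ast}Q$: $\mathbb{B}F:T^{\ast}Q\to T^{\ast}Q$, $\langle\mathbb{B}F(\alpha),v\rangle=\frac{d}{ds}|_0F(u(s))$ where $u$ is a horizontal (parallel) curve in $T^{\ast}Q$ with $u(0)=\alpha$ whose projection to $Q$ has velocity $v$ at $s=0$. In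 item 2 the connection is an arbitrary torsion-free one; in item 3 the chart is arbitrary. *)

theory Defs
  imports "HOL-Analysis.Analysis" "HOL-Library.Function_Algebras"
begin

text \<open>Functions into a real vector space form a real vector space, so that \<^term>\<open>subspace\<close>,
  \<^term>\<open>span\<close> and \<^term>\<open>independent\<close> apply to tangent vectors and covectors as
  represented below.\<close>

instantiation "fun" :: (type, real_vector) real_vector
begin

definition scaleR_fun :: "real \<Rightarrow> ('a \<Rightarrow> 'b) \<Rightarrow> 'a \<Rightarrow> 'b"
  where "scaleR_fun r f = (\<lambda>x. r *\<^sub>R f x)"

instance
  by standard (simp_all add: scaleR_fun_def fun_eq_iff algebra_simps)

end


section \<open>Calculus in coordinates\<close>

primrec k_smooth_on :: "nat \<Rightarrow> 'a::real_normed_vector set \<Rightarrow> ('a \<Rightarrow> 'b::real_normed_vector) \<Rightarrow> bool"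
  where
    "k_smooth_on 0 S f \<longleftrightarrow> continuous_on S f"
  | "k_smooth_on (Suc k) S f \<longleftrightarrow>
      (\<forall>x\<in>S. f differentiable at x) \<and> (\<forall>v. k_smooth_on k S (\<lambda>x. frechet_derivative f (at x) v))"

text \<open>Only used for open \<^term>\<open>S\<close>.\<close>

definition smooth_on :: "'a::real_normed_vector set \<Rightarrow> ('a \<Rightarrow> 'b::real_normed_vector) \<Rightarrow> bool"
  where "smooth_on S f \<longleftrightarrow> (\<forall>k. k_smooth_on k S f)"

definition partial :: "'n::finite \<Rightarrow> (real^'n \<Rightarrow> real) \<Rightarrow> real^'n \<Rightarrow> real"
  where "partial i f x = deriv (\<lambda>t. f (x + t *\<^sub>R axis i 1)) 0"


section \<open>Smooth manifolds\<close>

text \<open>A chart is a domain together with a coordinate map; the values of the map outside the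
  domain are irrelevant.\<close>

type_synonym ('q, 'n) chart = "'q set \<times> ('q \<Rightarrow> (real, 'n) vec)"

abbreviation chart_dom :: "('q, 'n::finite) chart \<Rightarrow> 'q set"
  where "chart_dom c \<equiv> fst c"

abbreviation chart_map :: "('q, 'n::finite) chart \<Rightarrow> 'q \<Rightarrow> real^'n"
  where "chart_map c \<equiv> snd c"

definition chart_inv :: "('q, 'n::finite) chart \<Rightarrow> real^'n \<Rightarrow> 'q"
  where "chart_inv c = inv_into (chart_dom c) (chart_map c)"

definition transition :: "('q, 'n::finite) chart \<Rightarrow> ('q, 'n) chart \<Rightarrow> real^'n \<Rightarrow> real^'n"
  where "transition c d = chart_map d \<circ> chart_inv c"

definition topological_chart :: "('q::topological_space, 'n::finite) chart \<Rightarrow> bool"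
  where "topological_chart c \<longleftrightarrow>
    open (chart_dom c) \<and> open (chart_map c ` chart_dom c) \<and>
    homeomorphism (chart_dom c) (chart_map c ` chart_dom c) (chart_map c) (chart_inv c)"

definition compatible :: "('q, 'n::finite) chart \<Rightarrow> ('q, 'n) chart \<Rightarrow> bool"
  where "compatible c d \<longleftrightarrow>
    smooth_on (chart_map c ` (chart_dom c \<inter> chart_dom d)) (transition c d) \<and>
    smooth_on (chart_map d ` (chart_dom c \<inter> chart_dom d)) (transition d c)"

text \<open>A smooth structure is a maximal atlas, so its elements are all the charts of the manifold.
  The manifold is the whole (Hausdorff, second countable) type, its dimension is the cardinality of
  the index type.\<close>

definition smooth_structure ::
    "('q::{t2_space,second_countable_topology}, 'n::finite) chart set \<Rightarrow> bool"
  where "smooth_structure A \<longleftrightarrow>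
    (\<forall>c\<in>A. topological_chart c) \<and>
    (\<Union>c\<in>A. chart_dom c) = UNIV \<and>
    (\<forall>c\<in>A. \<forall>d\<in>A. compatible c d) \<and>
    (\<forall>c. topological_chart c \<and> (\<forall>d\<in>A. compatible c d) \<longrightarrow> c \<in> A)"

definition charts_at :: "('q, 'n::finite) chart set \<Rightarrow> 'q \<Rightarrow> ('q, 'n) chart set"
  where "charts_at A q = {c \<in> A. q \<in> chart_dom c}"

definition chart_at :: "('q, 'n::finite) chart set \<Rightarrow> 'q \<Rightarrow> ('q, 'n) chart"
  where "chart_at A q = (SOME c. c \<in> charts_at A q)"

definition smooth_function :: "('q, 'n::finite) chart set \<Rightarrow> 'q set \<Rightarrow> ('q \<Rightarrow> real) \<Rightarrow> bool"
  where "smooth_function A W f \<longleftrightarrow>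
    (\<forall>c\<in>A. smooth_on (chart_map c ` (chart_dom c \<inter> W)) (f \<circ> chart_inv c))"


section \<open>Tangent and cotangent bundles\<close>

text \<open>A tangent vector at \<^term>\<open>q\<close> is the family of its component vectors in the charts
  around \<^term>\<open>q\<close>, subject to the transformation law. Being \<^term>\<open>0\<close> elsewhere makes
  the representation unique.\<close>

type_synonym ('q, 'n) tvec = "('q, 'n) chart \<Rightarrow> (real, 'n) vec"

definition tangent_space :: "('q, 'n::finite) chart set \<Rightarrow> 'q \<Rightarrow> ('q, 'n) tvec set"
  where "tangent_space A q = {v.
    (\<forall>c\<in>charts_at A q. \<forall>d\<in>charts_at A q.
       v d = frechet_derivative (transition c d) (at (chart_map c q)) (v c)) \<and>
    (\<forall>c. c \<notin> charts_at A q \<longrightarrow> v c = 0)}"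

text \<open>The tangent vector at \<^term>\<open>q\<close> with component vector \<^term>\<open>x\<close> in the chart
  \<^term>\<open>c\<close>.\<close>

definition coord_tvec ::
    "('q, 'n::finite) chart set \<Rightarrow> ('q, 'n) chart \<Rightarrow> 'q \<Rightarrow> real^'n \<Rightarrow> ('q, 'n) tvec"
  where "coord_tvec A c q x =
    (\<lambda>d. if d \<in> charts_at A q
         then frechet_derivative (transition c d) (at (chart_map c q)) x else 0)"

text \<open>Covectors are linear functionals on a tangent space, extended by \<^term>\<open>0::real\<close> outside
  of it. The pairing of a covector with a tangent vector is thus function application.\<close>

type_synonym ('q, 'n) covec = "('q, 'n) tvec \<Rightarrow> real"

definition cotangent_space :: "('q, 'n::finite) chart set \<Rightarrow> 'q \<Rightarrow> ('q, 'n) covec set"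
  where "cotangent_space A q = {\<alpha>.
    (\<forall>v\<in>tangent_space A q. \<forall>w\<in>tangent_space A q. \<forall>a b.
       \<alpha> (a *\<^sub>R v + b *\<^sub>R w) = a * \<alpha> v + b * \<alpha> w) \<and>
    (\<forall>v. v \<notin> tangent_space A q \<longrightarrow> \<alpha> v = 0)}"

definition cotangent_bundle :: "('q, 'n::finite) chart set \<Rightarrow> ('q \<times> ('q, 'n) covec) set"
  where "cotangent_bundle A = (SIGMA q:UNIV. cotangent_space A q)"

definition coord_covec ::
    "('q, 'n::finite) chart set \<Rightarrow> ('q, 'n) chart \<Rightarrow> 'q \<Rightarrow> real^'n \<Rightarrow> ('q, 'n) covec"
  where "coord_covec A c q p = (\<lambda>v. if v \<in> tangent_space A q then p \<bullet> v c else 0)"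

definition covec_components ::
    "('q, 'n::finite) chart set \<Rightarrow> ('q, 'n) chart \<Rightarrow> 'q \<Rightarrow> ('q, 'n) covec \<Rightarrow> real^'n"
  where "covec_components A c q \<alpha> = (\<chi> i. \<alpha> (coord_tvec A c q (axis i 1)))"

text \<open>The inverse of the chart of the cotangent bundle given by the canonical coordinates
  $(\mathbf q, \mathbf p)$ of a chart.\<close>

definition canonical_inv ::
    "('q, 'n::finite) chart set \<Rightarrow> ('q, 'n) chart \<Rightarrow> (real^'n) \<times> (real^'n) \<Rightarrow> 'q \<times> ('q, 'n) covec"
  where "canonical_inv A c = (\<lambda>(x, p). (chart_inv c x, coord_covec A c (chart_inv c x) p))"

definition smooth_vector_field ::
    "('q, 'n::finite) chart set \<Rightarrow> 'q set \<Rightarrow> ('q \<Rightarrow> ('q, 'n) tvec) \<Rightarrow> bool"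
  where "smooth_vector_field A W X \<longleftrightarrow>
    (\<forall>q\<in>W. X q \<in> tangent_space A q) \<and>
    (\<forall>c\<in>A. smooth_on (chart_map c ` (chart_dom c \<inter> W)) (\<lambda>x. X (chart_inv c x) c))"

definition smooth_covector_field ::
    "('q, 'n::finite) chart set \<Rightarrow> 'q set \<Rightarrow> ('q \<Rightarrow> ('q, 'n) covec) \<Rightarrow> bool"
  where "smooth_covector_field A W \<omega> \<longleftrightarrow>
    (\<forall>q\<in>W. \<omega> q \<in> cotangent_space A q) \<and>
    (\<forall>c\<in>A. smooth_on (chart_map c ` (chart_dom c \<inter> W))
              (\<lambda>x. covec_components A c (chart_inv c x) (\<omega> (chart_inv c x))))"

text \<open>The differential of a function; by the chain rule the choice of chart does not matter.\<close>

definition differential ::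
    "('q, 'n::finite) chart set \<Rightarrow> ('q \<Rightarrow> real) \<Rightarrow> 'q \<Rightarrow> ('q, 'n) covec"
  where "differential A f q =
    (\<lambda>v. if v \<in> tangent_space A q
         then let c = chart_at A q
              in frechet_derivative (f \<circ> chart_inv c) (at (chart_map c q)) (v c)
         else 0)"

text \<open>A linear subbundle is a family of subspaces admitting smooth local frames. Its rank is
  locally constant.\<close>

definition linear_subbundle ::
    "('q::topological_space, 'n::finite) chart set \<Rightarrow> ('q \<times> ('q, 'n) covec) set \<Rightarrow> bool"
  where "linear_subbundle A V \<longleftrightarrow>
    V \<subseteq> cotangent_bundle A \<and>
    (\<forall>q. subspace {\<alpha>. (q, \<alpha>) \<in> V}) \<and>
    (\<forall>q. \<exists>W. open W \<and> q \<in> W \<and>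
      (\<exists>(k::nat) (e :: nat \<Rightarrow> 'q \<Rightarrow> ('q, 'n) covec).
         (\<forall>i<k. smooth_covector_field A W (e i)) \<and>
         (\<forall>x\<in>W. inj_on (\<lambda>i. e i x) {..<k} \<and>
                independent ((\<lambda>i. e i x) ` {..<k}) \<and>
                span ((\<lambda>i. e i x) ` {..<k}) = {\<alpha>. (x, \<alpha>) \<in> V})))"


section \<open>Riemannian metrics and simple functions\<close>

type_synonym ('q, 'n) metric = "'q \<Rightarrow> ('q, 'n) tvec \<Rightarrow> ('q, 'n) tvec \<Rightarrow> real"

definition riemannian_metric :: "('q, 'n::finite) chart set \<Rightarrow> ('q, 'n) metric \<Rightarrow> bool"
  where "riemannian_metric A \<rho> \<longleftrightarrow>
    (\<forall>q. \<forall>u\<in>tangent_space A q. \<forall>v\<in>tangent_space A q.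
       \<rho> q u v = \<rho> q v u \<and>
       (\<forall>w\<in>tangent_space A q. \<forall>a b.
          \<rho> q (a *\<^sub>R u + b *\<^sub>R v) w = a * \<rho> q u w + b * \<rho> q v w) \<and>
       (u \<noteq> 0 \<longrightarrow> \<rho> q u u > 0)) \<and>
    (\<forall>c\<in>A. \<forall>i j. smooth_on (chart_map c ` chart_dom c)
       (\<lambda>x. let q = chart_inv c x
            in \<rho> q (coord_tvec A c q (axis i 1)) (coord_tvec A c q (axis j 1))))"

definition flat :: "('q, 'n::finite) chart set \<Rightarrow> ('q, 'n) metric \<Rightarrow> 'q \<Rightarrow> ('q, 'n) tvec \<Rightarrow> ('q, 'n) covec"
  where "flat A \<rho> q v = (\<lambda>w. if w \<in> tangent_space A q then \<rho> q v w else 0)"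

definition sharp :: "('q, 'n::finite) chart set \<Rightarrow> ('q, 'n) metric \<Rightarrow> 'q \<Rightarrow> ('q, 'n) covec \<Rightarrow> ('q, 'n) tvec"
  where "sharp A \<rho> q \<alpha> = (THE v. v \<in> tangent_space A q \<and> flat A \<rho> q v = \<alpha>)"

definition kinetic :: "('q, 'n::finite) chart set \<Rightarrow> ('q, 'n) metric \<Rightarrow> 'q \<times> ('q, 'n) covec \<Rightarrow> real"
  where "kinetic A \<rho> = (\<lambda>(q, \<alpha>). 1/2 * \<alpha> (sharp A \<rho> q \<alpha>))"

definition simple_hamiltonian ::
    "('q, 'n::finite) chart set \<Rightarrow> ('q, 'n) metric \<Rightarrow> ('q \<Rightarrow> real) \<Rightarrow> 'q \<times> ('q, 'n) covec \<Rightarrow> real"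
  where "simple_hamiltonian A \<rho> h = (\<lambda>\<sigma>. kinetic A \<rho> \<sigma> + (h \<circ> fst) \<sigma>)"

text \<open>The symmetric matrix of the kinetic term in canonical coordinates, as a function of
  $\mathbf q$.\<close>

definition kinetic_matrix ::
    "('q, 'n::finite) chart set \<Rightarrow> ('q, 'n) metric \<Rightarrow> ('q, 'n) chart \<Rightarrow> real^'n \<Rightarrow> real^'n^'n"
  where "kinetic_matrix A \<rho> c x = (THE M. transpose M = M \<and>
    (\<forall>p. kinetic A \<rho> (canonical_inv A c (x, p)) =
          1/2 * (\<Sum>i\<in>UNIV. \<Sum>j\<in>UNIV. p $ i * M $ i $ j * p $ j)))"


section \<open>The canonical Poisson bracket\<close>

definition poisson_in_coordinates ::
    "((real^'n) \<times> (real^'n) \<Rightarrow> real) \<Rightarrow> ((real^'n) \<times> (real^'n) \<Rightarrow> real) \<Rightarrow>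
     (real^'n) \<times> (real^'n) \<Rightarrow> real"
  where "poisson_in_coordinates f g = (\<lambda>(x, p). \<Sum>i\<in>UNIV.
    partial i (\<lambda>y. f (y, p)) x * partial i (\<lambda>r. g (x, r)) p -
    partial i (\<lambda>y. g (y, p)) x * partial i (\<lambda>r. f (x, r)) p)"

text \<open>The bracket at a covector is computed in the canonical coordinates of some chart around its
  base point; for smooth functions the choice does not matter.\<close>

definition poisson ::
    "('q, 'n::finite) chart set \<Rightarrow> ('q \<times> ('q, 'n) covec \<Rightarrow> real) \<Rightarrow>
     ('q \<times> ('q, 'n) covec \<Rightarrow> real) \<Rightarrow> 'q \<times> ('q, 'n) covec \<Rightarrow> real"
  where "poisson A F G = (\<lambda>(q, \<alpha>).
    let c = chart_at A q
    in poisson_in_coordinates (F \<circ> canonical_inv A c) (G \<circ> canonical_inv A c)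
         (chart_map c q, covec_components A c q \<alpha>))"


section \<open>Torsion-free connections\<close>

text \<open>A connection on the tangent bundle: \<^term>\<open>D q v X\<close> is the covariant derivative at
  \<^term>\<open>q\<close>, in the direction of the tangent vector \<^term>\<open>v\<close> at \<^term>\<open>q\<close>, of a vector
  field \<^term>\<open>X\<close> that is defined and smooth on a neighbourhood \<^term>\<open>W\<close> of
  \<^term>\<open>q\<close>. As it acts on locally defined vector fields, locality is part of the
  definition.\<close>

type_synonym ('q, 'n) connection =
  "'q \<Rightarrow> ('q, 'n) tvec \<Rightarrow> ('q \<Rightarrow> ('q, 'n) tvec) \<Rightarrow> ('q, 'n) tvec"

definition connection :: "('q::topological_space, 'n::finite) chart set \<Rightarrow> ('q, 'n) connection \<Rightarrow> bool"
  where "connection A D \<longleftrightarrow> (\<forall>W X Y.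
    open W \<and> smooth_vector_field A W X \<and> smooth_vector_field A W Y \<longrightarrow>
      (\<forall>q\<in>W. \<forall>v\<in>tangent_space A q.
         D q v X \<in> tangent_space A q \<and>
         ((\<forall>x\<in>W. X x = Y x) \<longrightarrow> D q v X = D q v Y) \<and>
         (\<forall>w\<in>tangent_space A q. \<forall>a b.
            D q (a *\<^sub>R v + b *\<^sub>R w) X = a *\<^sub>R D q v X + b *\<^sub>R D q w X) \<and>
         D q v (X + Y) = D q v X + D q v Y \<and>
         (\<forall>f. smooth_function A W f \<longrightarrow>
            D q v (\<lambda>x. f x *\<^sub>R X x) = differential A f q v *\<^sub>R X q + f q *\<^sub>R D q v X)) \<and>
      smooth_vector_field A W (\<lambda>q. D q (Y q) X))"

definition lie_bracket ::
    "('q, 'n::finite) chart set \<Rightarrow> ('q \<Rightarrow> ('q, 'n) tvec) \<Rightarrow> ('q \<Rightarrow> ('q, 'n) tvec) \<Rightarrow>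
     'q \<Rightarrow> ('q, 'n) tvec"
  where "lie_bracket A X Y q = (\<lambda>c. if c \<in> charts_at A q
    then frechet_derivative (\<lambda>x. Y (chart_inv c x) c) (at (chart_map c q)) (X q c) -
         frechet_derivative (\<lambda>x. X (chart_inv c x) c) (at (chart_map c q)) (Y q c)
    else 0)"

definition torsion_free :: "('q::topological_space, 'n::finite) chart set \<Rightarrow> ('q, 'n) connection \<Rightarrow> bool"
  where "torsion_free A D \<longleftrightarrow> (\<forall>W X Y.
    open W \<and> smooth_vector_field A W X \<and> smooth_vector_field A W Y \<longrightarrow>
      (\<forall>q\<in>W. D q (X q) Y - D q (Y q) X = lie_bracket A X Y q))"


section \<open>Fiber and base derivatives\<close>

definition fiber_derivative ::
    "('q, 'n::finite) chart set \<Rightarrow> ('q \<times> ('q, 'n) covec \<Rightarrow> real) \<Rightarrow>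
     'q \<times> ('q, 'n) covec \<Rightarrow> ('q, 'n) tvec"
  where "fiber_derivative A F = (\<lambda>(q, \<alpha>). THE v. v \<in> tangent_space A q \<and>
    (\<forall>\<sigma>\<in>cotangent_space A q. \<sigma> v = deriv (\<lambda>s. F (q, \<alpha> + s *\<^sub>R \<sigma>)) 0))"

definition velocity :: "('q, 'n::finite) chart set \<Rightarrow> (real \<Rightarrow> 'q) \<Rightarrow> real \<Rightarrow> ('q, 'n) tvec"
  where "velocity A \<gamma> s = (\<lambda>c. if c \<in> charts_at A (\<gamma> s)
    then vector_derivative (chart_map c \<circ> \<gamma>) (at s) else 0)"

definition smooth_cotangent_curve ::
    "('q::topological_space, 'n::finite) chart set \<Rightarrow> real set \<Rightarrow> (real \<Rightarrow> 'q \<times> ('q, 'n) covec) \<Rightarrow> bool"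
  where "smooth_cotangent_curve A I u \<longleftrightarrow>
    u ` I \<subseteq> cotangent_bundle A \<and> continuous_on I (fst \<circ> u) \<and>
    (\<forall>c\<in>A. let J = {s\<in>I. fst (u s) \<in> chart_dom c}
            in smooth_on J (\<lambda>s. chart_map c (fst (u s))) \<and>
               smooth_on J (\<lambda>s. covec_components A c (fst (u s)) (snd (u s))))"

text \<open>Curves $u$ of covectors that are parallel for the dual connection $D^*$ on the cotangent
  bundle. Let $\gamma$ be the projection of $u$. Since
  $\frac{d}{ds} \langle u, X \circ \gamma\rangle =
    \langle D^*_{\dot\gamma} u, X \circ \gamma\rangle + \langle u, D_{\dot\gamma} X\rangle$,
  the curve is parallel iff the first term on the right vanishes for all local vector
  fields $X$.\<close>

definition horizontal_curve ::
    "('q::topological_space, 'n::finite) chart set \<Rightarrow> ('q, 'n) connection \<Rightarrow> real set \<Rightarrow>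
     (real \<Rightarrow> 'q \<times> ('q, 'n) covec) \<Rightarrow> bool"
  where "horizontal_curve A D I u \<longleftrightarrow>
    smooth_cotangent_curve A I u \<and>
    (let \<gamma> = fst \<circ> u; \<alpha> = snd \<circ> u
     in \<forall>s\<in>I. \<forall>W X. open W \<and> \<gamma> s \<in> W \<and> smooth_vector_field A W X \<longrightarrow>
          ((\<lambda>t. \<alpha> t (X (\<gamma> t))) has_real_derivative \<alpha> s (D (\<gamma> s) (velocity A \<gamma> s) X)) (at s))"

definition base_derivative ::
    "('q::topological_space, 'n::finite) chart set \<Rightarrow> ('q, 'n) connection \<Rightarrow>
     ('q \<times> ('q, 'n) covec \<Rightarrow> real) \<Rightarrow> 'q \<times> ('q, 'n) covec \<Rightarrow> ('q, 'n) covec"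
  where "base_derivative A D F = (\<lambda>(q, \<alpha>). THE \<beta>. \<beta> \<in> cotangent_space A q \<and>
    (\<forall>v\<in>tangent_space A q. \<forall>\<epsilon>>0. \<forall>u.
       horizontal_curve A D {-\<epsilon><..<\<epsilon>} u \<and> u 0 = (q, \<alpha>) \<and> velocity A (fst \<circ> u) 0 = v \<longrightarrow>
       \<beta> v = deriv (\<lambda>s. F (u s)) 0))"

end

theory Submission
  imports Defs
begin

text \<open>In the canonical coordinates of a chart, the bracket of two simple functions splits into a part
  that is cubic in the momenta, coming from the metrics, and a linear part, coming from the
  potentials. As the fibers of the subbundle are closed under scaling, the bracket vanishes on it
  iff both parts do. The cubic part does not depend on the chart, because the second derivative of
  a transition map is symmetric. Written with base derivatives instead of partial derivatives, it
  changes by terms in the Christoffel symbols which are symmetric for a torsion-free connection and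
  cancel. As the base derivative is defined through horizontal curves, it exists only once
  parallel transport along a straight line of a chart is available, which amounts to solving a
  linear differential equation.\<close>

section \<open>Smooth maps and the symmetry of second derivatives\<close>

text \<open>A change of charts and a connection disturb the cubic part in the same way:
  \<open>base_part\<close> for one metric, evaluated at the vector raised by the other, gains a
  bilinear term in the two raised vectors. Exchanging the metrics exchanges the arguments of this
  term, so that its symmetry is exactly what the difference requires. The linear part needs no such
  care, as it is written with differentials and \<open>sharp\<close>. Invariance matters because
  \<open>poisson\<close> computes in the single chart \<open>chart_at A q\<close>, whereas item 3
  speaks of every chart.

  The \<open>THE\<close> in \<open>sharp\<close>, \<open>kinetic_matrix\<close>,
  \<open>fiber_derivative\<close> and \<open>base_derivative\<close> calls for existence and
  uniqueness each time. The first three are settled by an invertible matrix, by polarization and by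
  separating covectors. For \<open>base_derivative\<close> uniqueness is the hard half: in a
  direction without a horizontal curve the defining condition would be vacuous and would not
  determine the value. As horizontality is tested against arbitrary local vector fields,
  constructing such a curve requires the full coordinate form of a connection.\<close>

text \<open>Derivatives are taken at points of an open set and only see a neighbourhood inside it.
  Coordinate formulas that are valid on the range of a chart alone can therefore be
  substituted.\<close>

lemma k_smooth_on_cong:
  assumes "open S" "\<And>x. x \<in> S \<Longrightarrow> f x = g x"
  shows "k_smooth_on k S f \<longleftrightarrow> k_smooth_on k S g"
  using assms(2)
proof (induction k arbitrary: f g)
  case 0
  then show ?case by (simp cong: continuous_on_cong)
next
  case (Suc k)
  have *: "(f has_derivative D) (at x) \<longleftrightarrow> (g has_derivative D) (at x)" if "x \<in> S" for x D
    using Suc.prems assms(1) that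
    by (metis has_derivative_transform_within_open)
  have "frechet_derivative f (at x) = frechet_derivative g (at x)" if "x \<in> S" for x
    using *[OF that] by (simp add: frechet_derivative_def)
  then have "k_smooth_on k S (\<lambda>x. frechet_derivative f (at x) v) \<longleftrightarrow>
      k_smooth_on k S (\<lambda>x. frechet_derivative g (at x) v)" for v
    by (intro Suc.IH) auto
  with * show ?case by (auto simp: differentiable_def)
qed

lemma k_smooth_on_subset: "k_smooth_on k T f \<Longrightarrow> S \<subseteq> T \<Longrightarrow> k_smooth_on k S f"
  by (induction k arbitrary: f) (auto intro: continuous_on_subset)

lemma k_smooth_on_SucD: "k_smooth_on (Suc k) S f \<Longrightarrow> k_smooth_on k S f"
proof (induction k arbitrary: f)
  case 0
  then show ?case
    by (auto intro!: continuous_at_imp_continuous_on dest: differentiable_imp_continuous_within)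
qed auto

text \<open>The inductive step of the closure properties: a differentiation rule supplies an
  explicit \<open>D\<close>, and the induction hypothesis is applied to this formula in place of
  \<open>frechet_derivative f\<close>.\<close>

lemma k_smooth_on_SucI:
  assumes "open S" "\<And>x. x \<in> S \<Longrightarrow> (f has_derivative D x) (at x)"
    and "\<And>v. k_smooth_on k S (\<lambda>x. D x v)"
  shows "k_smooth_on (Suc k) S f"
proof -
  have "frechet_derivative f (at x) = D x" if "x \<in> S" for x
    using frechet_derivative_at[OF assms(2)[OF that]] by simp
  then have "k_smooth_on k S (\<lambda>x. frechet_derivative f (at x) v) \<longleftrightarrow> k_smooth_on k S (\<lambda>x. D x v)" for v
    by (intro k_smooth_on_cong assms(1)) auto
  then show ?thesis
    using assms by (auto simp: differentiable_def)
qed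

lemma k_smooth_on_const: "open S \<Longrightarrow> k_smooth_on k S (\<lambda>x. c)"
proof (induction k arbitrary: c)
  case (Suc k)
  then show ?case
    by (intro k_smooth_on_SucI[where D = "\<lambda>_ _. 0"]) auto
qed simp

lemma k_smooth_on_linear:
  assumes "open S" "bounded_linear L"
  shows "k_smooth_on k S L"
proof (cases k)
  case 0
  then show ?thesis using assms by (simp add: linear_continuous_on)
next
  case (Suc k')
  have "k_smooth_on (Suc k') S L"
    using assms
    by (intro k_smooth_on_SucI[where D = "\<lambda>_. L"])
      (auto intro: k_smooth_on_const bounded_linear_imp_has_derivative)
  with Suc show ?thesis by simp
qed

lemma k_smooth_on_linear_compose:
  assumes "open S" "bounded_linear L" "k_smooth_on k S f"
  shows "k_smooth_on k S (\<lambda>x. L (f x))"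
  using assms(3)
proof (induction k arbitrary: f)
  case 0
  then show ?case using assms by (simp add: bounded_linear.continuous_on)
next
  case (Suc k)
  then show ?case using assms(1)
    by (intro k_smooth_on_SucI[where D = "\<lambda>x v. L (frechet_derivative f (at x) v)"])
      (auto intro!: bounded_linear.has_derivative[OF assms(2)]
        simp: frechet_derivative_works[symmetric])
qed

lemma k_smooth_on_add:
  assumes "open S" "k_smooth_on k S f" "k_smooth_on k S g"
  shows "k_smooth_on k S (\<lambda>x. f x + g x)"
  using assms(2,3)
proof (induction k arbitrary: f g)
  case 0
  then show ?case by (auto intro: continuous_intros)
next
  case (Suc k)
  then show ?case using assms(1)
    by (intro k_smooth_on_SucI[where
          D = "\<lambda>x v. frechet_derivative f (at x) v + frechet_derivative g (at x) v"])
      (auto intro!: has_derivative_add simp: frechet_derivative_works[symmetric])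
qed

lemma k_smooth_on_sum:
  assumes "open S" "\<And>i. i \<in> I \<Longrightarrow> k_smooth_on k S (f i)"
  shows "k_smooth_on k S (\<lambda>x. \<Sum>i\<in>I. f i x)"
  using assms(2)
  by (induction I rule: infinite_finite_induct)
    (auto intro!: k_smooth_on_const k_smooth_on_add assms(1))

text \<open>In the product rule each summand pairs a derivative, of order \<open>k\<close>, with an
  undifferentiated factor, of order \<open>Suc k\<close>; \<open>k_smooth_on_SucD\<close> lowers the
  latter so that the induction hypothesis fits.\<close>

lemma (in bounded_bilinear) k_smooth_on:
  assumes "open S" "k_smooth_on k S f" "k_smooth_on k S g"
  shows "k_smooth_on k S (\<lambda>x. prod (f x) (g x))"
  using assms(2,3)
proof (induction k arbitrary: f g)
  case 0
  then show ?case by (auto intro: continuous_on)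
next
  case (Suc k)
  show ?case
  proof (rule k_smooth_on_SucI[OF assms(1)])
    show "((\<lambda>x. prod (f x) (g x)) has_derivative
        (\<lambda>v. prod (f x) (frechet_derivative g (at x) v) + prod (frechet_derivative f (at x) v) (g x)))
        (at x)" if "x \<in> S" for x
      using Suc.prems that by (intro FDERIV) (auto simp: frechet_derivative_works[symmetric])
    show "k_smooth_on k S
        (\<lambda>x. prod (f x) (frechet_derivative g (at x) v) + prod (frechet_derivative f (at x) v) (g x))" for v
      using Suc.prems Suc.prems[THEN k_smooth_on_SucD]
      by (intro k_smooth_on_add assms(1) Suc.IH) auto
  qed
qed

text \<open>In the chain rule the derivative of \<open>g\<close> is applied to a direction that
  varies with the point, while \<open>k_smooth_on\<close> controls it in fixed directions only.
  Expanding the direction along \<open>Basis\<close> reduces to products, which is why the middle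
  space is Euclidean.\<close>

lemma k_smooth_on_compose:
  fixes f :: "'a::real_normed_vector \<Rightarrow> 'b::euclidean_space"
    and g :: "'b \<Rightarrow> 'c::real_normed_vector"
  assumes "open S" "f ` S \<subseteq> T" "k_smooth_on k T g" "k_smooth_on k S f"
  shows "k_smooth_on k S (g \<circ> f)"
  using assms(3,4)
proof (induction k arbitrary: g)
  case 0
  then show ?case using assms(2)
    by (simp add: continuous_on_compose continuous_on_subset del: comp_apply)
next
  case (Suc k)
  define Df where "Df x = frechet_derivative f (at x)" for x
  define Dg where "Dg x = frechet_derivative g (at x)" for x
  show ?case
  proof (rule k_smooth_on_SucI[OF assms(1)])
    fix x assume x: "x \<in> S"
    have f: "(f has_derivative Df x) (at x)" and g: "(g has_derivative Dg (f x)) (at (f x))"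
      using Suc.prems assms(2) x by (auto simp: Df_def Dg_def frechet_derivative_works[symmetric])
    have "Dg (f x) (Df x v) = (\<Sum>b\<in>Basis. (Df x v \<bullet> b) *\<^sub>R Dg (f x) b)" for v
    proof -
      interpret linear "Dg (f x)" using g by (rule has_derivative_linear)
      have "Dg (f x) (Df x v) = Dg (f x) (\<Sum>b\<in>Basis. (Df x v \<bullet> b) *\<^sub>R b)"
        by (simp only: euclidean_representation)
      then show ?thesis by (simp only: sum scaleR)
    qed
    moreover have "(g \<circ> f has_derivative (\<lambda>v. Dg (f x) (Df x v))) (at x)"
      using diff_chain_at[OF f g] by (simp add: o_def)
    ultimately show "(g \<circ> f has_derivative (\<lambda>v. \<Sum>b\<in>Basis. (Df x v \<bullet> b) *\<^sub>R (Dg \<circ> f) x b)) (at x)"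
      by simp
  next
    fix v
    show "k_smooth_on k S (\<lambda>x. \<Sum>b\<in>Basis. (Df x v \<bullet> b) *\<^sub>R (Dg \<circ> f) x b)"
    proof (intro k_smooth_on_sum assms(1) bounded_bilinear.k_smooth_on[OF bounded_bilinear_scaleR])
      fix b :: 'b
      show "k_smooth_on k S (\<lambda>x. Df x v \<bullet> b)"
        using Suc.prems(2)
        by (intro k_smooth_on_linear_compose[OF assms(1) bounded_linear_inner_left]) (simp add: Df_def)
      have "k_smooth_on k S ((\<lambda>y. Dg y b) \<circ> f)"
        using Suc.prems k_smooth_on_SucD[OF Suc.prems(2)] by (intro Suc.IH) (auto simp: Dg_def)
      then show "k_smooth_on k S (\<lambda>x. (Dg \<circ> f) x b)" by (simp add: o_def)
    qed
  qed
qed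

lemma k_smooth_on_vecI:
  fixes f :: "'a::real_normed_vector \<Rightarrow> real^'n"
  assumes "open S" "\<And>i. k_smooth_on k S (\<lambda>x. f x $ i)"
  shows "k_smooth_on k S f"
proof -
  have "k_smooth_on k S (\<lambda>x. \<Sum>i\<in>UNIV. f x $ i *\<^sub>R (axis i 1 :: real^'n))"
    by (intro k_smooth_on_sum assms(1) bounded_bilinear.k_smooth_on[OF bounded_bilinear_scaleR]
        assms(2) k_smooth_on_const)
  moreover have "(\<lambda>x. \<Sum>i\<in>UNIV. f x $ i *\<^sub>R axis i 1) = f"
    using basis_expansion[of "f _"] by (simp add: scalar_mult_eq_scaleR fun_eq_iff)
  ultimately show ?thesis by simp
qed

lemma smooth_on_cong:
  assumes "open S" "\<And>x. x \<in> S \<Longrightarrow> f x = g x"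
  shows "smooth_on S f \<longleftrightarrow> smooth_on S g"
  using k_smooth_on_cong[OF assms] by (simp add: smooth_on_def)

lemma smooth_on_transform:
  "smooth_on S f \<Longrightarrow> open S \<Longrightarrow> (\<And>x. x \<in> S \<Longrightarrow> f x = g x) \<Longrightarrow> smooth_on S g"
  by (simp add: smooth_on_cong[of S f g])

lemma smooth_on_subset: "smooth_on T f \<Longrightarrow> S \<subseteq> T \<Longrightarrow> smooth_on S f"
  using k_smooth_on_subset unfolding smooth_on_def by blast

lemma smooth_on_const: "open S \<Longrightarrow> smooth_on S (\<lambda>x. c)"
  by (simp add: smooth_on_def k_smooth_on_const)

lemma smooth_on_linear: "open S \<Longrightarrow> bounded_linear L \<Longrightarrow> smooth_on S L"
  by (simp add: smooth_on_def k_smooth_on_linear)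

lemma smooth_on_linear_compose:
  "open S \<Longrightarrow> bounded_linear L \<Longrightarrow> smooth_on S f \<Longrightarrow> smooth_on S (\<lambda>x. L (f x))"
  by (simp add: smooth_on_def k_smooth_on_linear_compose)

lemma smooth_on_add:
  "open S \<Longrightarrow> smooth_on S f \<Longrightarrow> smooth_on S g \<Longrightarrow> smooth_on S (\<lambda>x. f x + g x)"
  by (simp add: smooth_on_def k_smooth_on_add)

lemma smooth_on_sum:
  "open S \<Longrightarrow> (\<And>i. i \<in> I \<Longrightarrow> smooth_on S (f i)) \<Longrightarrow> smooth_on S (\<lambda>x. \<Sum>i\<in>I. f i x)"
  by (simp add: smooth_on_def k_smooth_on_sum)

lemma (in bounded_bilinear) smooth_on:
  "open S \<Longrightarrow> smooth_on S f \<Longrightarrow> smooth_on S g \<Longrightarrow> smooth_on S (\<lambda>x. prod (f x) (g x))"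
  by (simp add: smooth_on_def k_smooth_on)

lemma smooth_on_compose:
  fixes f :: "'a::real_normed_vector \<Rightarrow> 'b::euclidean_space"
  shows "open S \<Longrightarrow> f ` S \<subseteq> T \<Longrightarrow> smooth_on T g \<Longrightarrow> smooth_on S f \<Longrightarrow> smooth_on S (\<lambda>x. g (f x))"
  using k_smooth_on_compose[of S f T _ g] by (simp add: smooth_on_def o_def)

lemma smooth_on_differentiable: "smooth_on S f \<Longrightarrow> x \<in> S \<Longrightarrow> f differentiable at x"
  unfolding smooth_on_def by (drule spec[of _ "Suc 0"]) simp

lemma smooth_on_frechet_derivative:
  "smooth_on S f \<Longrightarrow> smooth_on S (\<lambda>x. frechet_derivative f (at x) v)"
  unfolding smooth_on_def by (metis k_smooth_on.simps(2))

lemma smooth_on_continuous_on: "smooth_on S f \<Longrightarrow> continuous_on S f"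
  unfolding smooth_on_def using k_smooth_on.simps(1) by blast

lemma smooth_on_has_derivative:
  "smooth_on S f \<Longrightarrow> x \<in> S \<Longrightarrow> (f has_derivative frechet_derivative f (at x)) (at x)"
  using smooth_on_differentiable frechet_derivative_works by blast

lemma smooth_on_vecI:
  fixes f :: "'a::real_normed_vector \<Rightarrow> real^'n"
  shows "open S \<Longrightarrow> (\<And>i. smooth_on S (\<lambda>x. f x $ i)) \<Longrightarrow> smooth_on S f"
  by (simp add: smooth_on_def k_smooth_on_vecI)

lemma smooth_on_vec_nth:
  "open S \<Longrightarrow> smooth_on S f \<Longrightarrow> smooth_on S (\<lambda>x. f x $ i)"
  by (rule smooth_on_linear_compose[OF _ bounded_linear_vec_nth])

section \<open>Symmetry of second derivatives\<close>

text \<open>Apply the mean value theorem twice.\<close>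

lemma second_difference_mvt:
  fixes f :: "'a::real_normed_vector \<Rightarrow> real"
  assumes f: "\<And>y. y \<in> S \<Longrightarrow> (f has_derivative Df y) (at y)"
    and Df: "\<And>y. y \<in> S \<Longrightarrow> ((\<lambda>z. Df z u) has_derivative D2f y) (at y)"
    and sub: "\<And>r s. 0 \<le> r \<Longrightarrow> r \<le> t \<Longrightarrow> 0 \<le> s \<Longrightarrow> s \<le> t \<Longrightarrow> x + r *\<^sub>R u + s *\<^sub>R v \<in> S"
    and t: "t > 0"
  shows "\<exists>r s. 0 < r \<and> r < t \<and> 0 < s \<and> s < t \<and>
    f (x + t *\<^sub>R u + t *\<^sub>R v) - f (x + t *\<^sub>R u) - f (x + t *\<^sub>R v) + f x =
      t * t * D2f (x + r *\<^sub>R u + s *\<^sub>R v) v"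
proof -
  \<comment> \<open>The difference across \<open>t *\<^sub>R v\<close> as a function of the position
    along \<open>u\<close>. The second application of the theorem, to \<open>k\<close>, runs along
    \<open>v\<close> from the intermediate position \<open>r\<close>.\<close>
  define g where "g r = f (x + r *\<^sub>R u + t *\<^sub>R v) - f (x + r *\<^sub>R u)" for r
  have dg: "(g has_real_derivative Df (x + r *\<^sub>R u + t *\<^sub>R v) u - Df (x + r *\<^sub>R u) u) (at r)"
    if "0 \<le> r" "r \<le> t" for r
  proof -
    have 1: "x + r *\<^sub>R u + t *\<^sub>R v \<in> S" "x + r *\<^sub>R u \<in> S"
      using sub[of r t] sub[of r 0] that t by auto
    have 2: "((\<lambda>r. x + r *\<^sub>R u + t *\<^sub>R v) has_derivative (\<lambda>h. h *\<^sub>R u)) (at r)"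
      "((\<lambda>r. x + r *\<^sub>R u) has_derivative (\<lambda>h. h *\<^sub>R u)) (at r)"
      by (auto intro!: derivative_eq_intros)
    have "(g has_derivative (\<lambda>h. Df (x + r *\<^sub>R u + t *\<^sub>R v) (h *\<^sub>R u) - Df (x + r *\<^sub>R u) (h *\<^sub>R u))) (at r)"
      unfolding g_def
      by (rule has_derivative_diff[OF has_derivative_compose[OF 2(1) f[OF 1(1)]]
            has_derivative_compose[OF 2(2) f[OF 1(2)]]])
    moreover have "Df y (h *\<^sub>R u) = h * Df y u" if "y \<in> S" for y h
      using linear_scale[OF has_derivative_linear[OF f[OF that]]] by simp
    ultimately show ?thesis
      using 1 by (simp add: has_field_derivative_def right_diff_distrib[symmetric] mult_commute_abs)
  qed
  obtain r where r: "0 < r" "r < t" "g t - g 0 = (t - 0) * (Df (x + r *\<^sub>R u + t *\<^sub>R v) u - Df (x + r *\<^sub>R u) u)"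
    using MVT2[of 0 t g "\<lambda>r. Df (x + r *\<^sub>R u + t *\<^sub>R v) u - Df (x + r *\<^sub>R u) u"] t dg by auto
  define k where "k s = Df (x + r *\<^sub>R u + s *\<^sub>R v) u" for s
  have dk: "(k has_real_derivative D2f (x + r *\<^sub>R u + s *\<^sub>R v) v) (at s)" if "0 \<le> s" "s \<le> t" for s
  proof -
    have 1: "x + r *\<^sub>R u + s *\<^sub>R v \<in> S" using sub[of r s] that r by auto
    have "((\<lambda>s. x + r *\<^sub>R u + s *\<^sub>R v) has_derivative (\<lambda>h. h *\<^sub>R v)) (at s)"
      by (auto intro!: derivative_eq_intros)
    from has_derivative_compose[OF this Df[OF 1]]
    have "(k has_derivative (\<lambda>h. D2f (x + r *\<^sub>R u + s *\<^sub>R v) (h *\<^sub>R v))) (at s)"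
      unfolding k_def .
    moreover have "D2f (x + r *\<^sub>R u + s *\<^sub>R v) (h *\<^sub>R v) = h * D2f (x + r *\<^sub>R u + s *\<^sub>R v) v" for h
      using linear_scale[OF has_derivative_linear[OF Df[OF 1]]] by simp
    ultimately show ?thesis
      by (simp add: has_field_derivative_def mult_commute_abs)
  qed
  obtain s where s: "0 < s" "s < t" "k t - k 0 = (t - 0) * D2f (x + r *\<^sub>R u + s *\<^sub>R v) v"
    using MVT2[of 0 t k "\<lambda>s. D2f (x + r *\<^sub>R u + s *\<^sub>R v) v"] t dk by auto
  have "f (x + t *\<^sub>R u + t *\<^sub>R v) - f (x + t *\<^sub>R u) - f (x + t *\<^sub>R v) + f x = g t - g 0"
    by (simp add: g_def)
  also have "\<dots> = t * (k t - k 0)" using r by (simp add: k_def)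
  also have "\<dots> = t * t * D2f (x + r *\<^sub>R u + s *\<^sub>R v) v" using s by simp
  finally show ?thesis using r s by blast
qed

text \<open>The second difference along \<open>u\<close> and \<open>v\<close> does not depend on
  their order. Hence the two mixed derivatives take a common value at two points arbitrarily close
  to \<open>x\<close>, and continuity does the rest.\<close>

lemma symmetric_second_derivative_real:
  fixes f :: "'a::real_normed_vector \<Rightarrow> real"
  assumes "open S" "x \<in> S" and f: "smooth_on S f"
  shows "frechet_derivative (\<lambda>y. frechet_derivative f (at y) u) (at x) v =
    frechet_derivative (\<lambda>y. frechet_derivative f (at y) v) (at x) u"
proof -
  define Df where "Df y = frechet_derivative f (at y)" for y
  define D2f where "D2f u y = frechet_derivative (\<lambda>z. Df z u) (at y)" for u y
  have Df: "(f has_derivative Df y) (at y)" if "y \<in> S" for y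
    unfolding Df_def using f that by (rule smooth_on_has_derivative)
  have D2f: "((\<lambda>z. Df z w) has_derivative D2f w y) (at y)" if "y \<in> S" for y w
    unfolding Df_def D2f_def
    using smooth_on_frechet_derivative[OF f] that by (rule smooth_on_has_derivative)
  have cont: "isCont (\<lambda>y. D2f w y w') x" for w w'
    using smooth_on_continuous_on[OF smooth_on_frechet_derivative[OF smooth_on_frechet_derivative[OF f]]]
      assms(1,2)
    unfolding Df_def D2f_def by (simp add: continuous_on_eq_continuous_at)
  obtain e where e: "e > 0" "ball x e \<subseteq> S" using assms(1,2) openE by blast
  \<comment> \<open>All points \<open>x + r *\<^sub>R u + s *\<^sub>R v\<close> with
    \<open>r\<close> and \<open>s\<close> in \<open>{0..t}\<close> lie within \<open>t * K\<close>
    of \<open>x\<close>. The added 1 keeps this strict even if both vectors vanish.\<close>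
  define K where "K = norm u + norm v + 1"
  have K: "K > 0" by (simp add: K_def add_nonneg_pos)
  have near: "norm (r *\<^sub>R u + s *\<^sub>R v) < t * K" if "0 \<le> r" "r \<le> t" "0 \<le> s" "s \<le> t" "0 < t" for r s t
  proof -
    have "norm (r *\<^sub>R u + s *\<^sub>R v) \<le> r * norm u + s * norm v"
      using norm_triangle_ineq[of "r *\<^sub>R u" "s *\<^sub>R v"] that by simp
    also have "\<dots> \<le> t * norm u + t * norm v"
      using that by (intro add_mono mult_right_mono) auto
    finally show ?thesis using that by (simp add: K_def algebra_simps)
  qed
  have eq: "\<exists>a b. dist a x < t * K \<and> dist b x < t * K \<and> D2f u a v = D2f v b u" if t: "0 < t" "t * K \<le> e" for t
  proof -
    have sub: "x + r *\<^sub>R u + s *\<^sub>R v \<in> S" if "0 \<le> r" "r \<le> t" "0 \<le> s" "s \<le> t" for r s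
    proof (rule subsetD[OF e(2)])
      have "dist x (x + r *\<^sub>R u + s *\<^sub>R v) = norm (r *\<^sub>R u + s *\<^sub>R v)"
        by (simp only: dist_commute[of x]) (simp add: dist_norm add.assoc)
      then show "x + r *\<^sub>R u + s *\<^sub>R v \<in> ball x e"
        using near[OF that t(1)] t(2) by simp
    qed
    have sub': "x + r *\<^sub>R v + s *\<^sub>R u \<in> S" if "0 \<le> r" "r \<le> t" "0 \<le> s" "s \<le> t" for r s
      using sub[of s r] that by (simp add: add_ac)
    obtain r s where 1: "0 < r" "r < t" "0 < s" "s < t"
      "f (x + t *\<^sub>R u + t *\<^sub>R v) - f (x + t *\<^sub>R u) - f (x + t *\<^sub>R v) + f x =
        t * t * D2f u (x + r *\<^sub>R u + s *\<^sub>R v) v"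
      using second_difference_mvt[of S f Df u "D2f u" t x v] Df D2f sub t(1) by blast
    obtain r' s' where 2: "0 < r'" "r' < t" "0 < s'" "s' < t"
      "f (x + t *\<^sub>R v + t *\<^sub>R u) - f (x + t *\<^sub>R v) - f (x + t *\<^sub>R u) + f x =
        t * t * D2f v (x + r' *\<^sub>R v + s' *\<^sub>R u) u"
      using second_difference_mvt[of S f Df v "D2f v" t x u] Df D2f sub' t(1) by blast
    have "f (x + t *\<^sub>R u + t *\<^sub>R v) - f (x + t *\<^sub>R u) - f (x + t *\<^sub>R v) + f x =
        f (x + t *\<^sub>R v + t *\<^sub>R u) - f (x + t *\<^sub>R v) - f (x + t *\<^sub>R u) + f x"
      by (simp add: add_ac)
    then have "t * t * D2f u (x + r *\<^sub>R u + s *\<^sub>R v) v = t * t * D2f v (x + r' *\<^sub>R v + s' *\<^sub>R u) u"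
      using 1(5) 2(5) by metis
    then have "D2f u (x + r *\<^sub>R u + s *\<^sub>R v) v = D2f v (x + r' *\<^sub>R v + s' *\<^sub>R u) u"
      using t(1) by simp
    moreover have "dist (x + r *\<^sub>R u + s *\<^sub>R v) x < t * K" "dist (x + r' *\<^sub>R v + s' *\<^sub>R u) x < t * K"
      using near[of r t s] near[of s' t r'] 1 2 by (auto simp: dist_norm add_ac)
    ultimately show ?thesis by blast
  qed
  have "D2f u x v = D2f v x u"
  proof (rule ccontr)
    assume neq: "D2f u x v \<noteq> D2f v x u"
    \<comment> \<open>Two numbers at distance \<open>2 * d\<close> cannot both be closer than
      \<open>d\<close> to the common value found at \<open>a\<close> and \<open>b\<close>.\<close>
    define d where "d = \<bar>D2f u x v - D2f v x u\<bar> / 2"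
    have d: "d > 0" using neq by (simp add: d_def)
    obtain e1 where e1: "e1 > 0" "\<And>y. dist y x < e1 \<Longrightarrow> dist (D2f u y v) (D2f u x v) < d"
      using cont[of u v] d unfolding continuous_at_eps_delta dist_real_def by (metis dist_commute)
    obtain e2 where e2: "e2 > 0" "\<And>y. dist y x < e2 \<Longrightarrow> dist (D2f v y u) (D2f v x u) < d"
      using cont[of v u] d unfolding continuous_at_eps_delta dist_real_def by (metis dist_commute)
    define t where "t = min e (min e1 e2) / K"
    have t: "t > 0" "t * K \<le> e" "t * K \<le> e1" "t * K \<le> e2" using K e e1 e2 by (auto simp: t_def)
    obtain a b where "dist a x < t * K" "dist b x < t * K" "D2f u a v = D2f v b u"
      using eq[OF t(1,2)] by blast
    then show False
      using e1(2)[of a] e2(2)[of b] t(3,4) unfolding d_def dist_real_def by (auto simp: abs_if split: if_splits)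
  qed
  then show ?thesis by (simp add: D2f_def Df_def)
qed

text \<open>Pairing with a basis vector is linear and commutes with both differentiations, which
  reduces to the real case.\<close>

lemma symmetric_second_derivative:
  fixes f :: "'a::real_normed_vector \<Rightarrow> 'b::euclidean_space"
  assumes "open S" "x \<in> S" and f: "smooth_on S f"
  shows "frechet_derivative (\<lambda>y. frechet_derivative f (at y) u) (at x) v =
    frechet_derivative (\<lambda>y. frechet_derivative f (at y) v) (at x) u"
proof (rule euclidean_eqI)
  fix b :: 'b
  have g: "smooth_on S (\<lambda>y. f y \<bullet> b)"
    by (rule smooth_on_linear_compose[OF assms(1) bounded_linear_inner_left f])
  have D: "frechet_derivative (\<lambda>y. g y \<bullet> b) (at y) = (\<lambda>w. frechet_derivative g (at y) w \<bullet> b)"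
    if "smooth_on S g" "y \<in> S" for g :: "'a \<Rightarrow> 'b" and y
    by (rule frechet_derivative_at[symmetric])
      (rule bounded_linear.has_derivative[OF bounded_linear_inner_left smooth_on_has_derivative[OF that]])
  have D2: "frechet_derivative (\<lambda>y. frechet_derivative (\<lambda>y. f y \<bullet> b) (at y) w) (at x) w' =
      frechet_derivative (\<lambda>y. frechet_derivative f (at y) w) (at x) w' \<bullet> b" for w w'
  proof -
    note * = D[OF smooth_on_frechet_derivative[OF f, of w] assms(2)]
    have "((\<lambda>y. frechet_derivative f (at y) w \<bullet> b) has_derivative
        (\<lambda>w'. frechet_derivative (\<lambda>y. frechet_derivative f (at y) w) (at x) w' \<bullet> b)) (at x)"
      by (intro bounded_linear.has_derivative[OF bounded_linear_inner_left]
          smooth_on_has_derivative[OF smooth_on_frechet_derivative[OF f]] assms)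
    then have "((\<lambda>y. frechet_derivative (\<lambda>y. f y \<bullet> b) (at y) w) has_derivative
        (\<lambda>w'. frechet_derivative (\<lambda>y. frechet_derivative f (at y) w) (at x) w' \<bullet> b)) (at x)"
      by (rule has_derivative_transform_within_open[OF _ assms(1,2)]) (simp add: D[OF f])
    from frechet_derivative_at[OF this] show ?thesis by metis
  qed
  show "frechet_derivative (\<lambda>y. frechet_derivative f (at y) u) (at x) v \<bullet> b =
    frechet_derivative (\<lambda>y. frechet_derivative f (at y) v) (at x) u \<bullet> b"
    using symmetric_second_derivative_real[OF assms(1,2) g, of u v] by (simp add: D2)
qed

lemma has_vector_derivative_vecI:
  fixes f :: "real \<Rightarrow> real^'n"
  assumes "\<And>i. ((\<lambda>t. f t $ i) has_real_derivative f' $ i) (at t)"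
  shows "(f has_vector_derivative f') (at t)"
  unfolding has_vector_derivative_def
proof (subst has_derivative_componentwise_within, intro ballI)
  fix b :: "real^'n" assume "b \<in> Basis"
  then obtain i where b: "b = axis i 1" by (auto simp: Basis_vec_def)
  show "((\<lambda>x. f x \<bullet> b) has_derivative (\<lambda>x. x *\<^sub>R f' \<bullet> b)) (at t)"
    using assms[of i] by (simp add: b inner_axis has_field_derivative_def mult_commute_abs)
qed

section \<open>Tangent vectors and covectors in charts\<close>

lemma scaleR_fun_apply: "(r *\<^sub>R f) x = r *\<^sub>R f x"
  by (simp add: scaleR_fun_def)

locale smooth_manifold =
  fixes A :: "('q::{t2_space,second_countable_topology}, 'n::finite) chart set"
  assumes smooth_structure: "smooth_structure A"
begin

section \<open>Charts and transition maps\<close>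

lemma charts_atI: "c \<in> A \<Longrightarrow> q \<in> chart_dom c \<Longrightarrow> c \<in> charts_at A q"
  and charts_atD: "c \<in> charts_at A q \<Longrightarrow> c \<in> A" "c \<in> charts_at A q \<Longrightarrow> q \<in> chart_dom c"
  by (auto simp: charts_at_def)

lemma chart_at_charts_at: "chart_at A q \<in> charts_at A q"
proof -
  have "\<exists>c. c \<in> charts_at A q"
    using smooth_structure unfolding smooth_structure_def charts_at_def by blast
  then show ?thesis unfolding chart_at_def by (rule someI_ex)
qed

lemma topological_chart: "c \<in> A \<Longrightarrow> topological_chart c"
  using smooth_structure by (simp add: smooth_structure_def)

lemma open_chart_dom: "c \<in> A \<Longrightarrow> open (chart_dom c)"
  using topological_chart by (auto simp: topological_chart_def)

lemma chart_homeomorphism: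
  "c \<in> A \<Longrightarrow> homeomorphism (chart_dom c) (chart_map c ` chart_dom c) (chart_map c) (chart_inv c)"
  using topological_chart by (auto simp: topological_chart_def)

lemma chart_inv_map: "c \<in> A \<Longrightarrow> q \<in> chart_dom c \<Longrightarrow> chart_inv c (chart_map c q) = q"
  using chart_homeomorphism by (auto simp: homeomorphism_def)

lemma chart_map_inv: "c \<in> A \<Longrightarrow> x \<in> chart_map c ` chart_dom c \<Longrightarrow> chart_map c (chart_inv c x) = x"
  using chart_inv_map by fastforce

lemma chart_inv_dom: "c \<in> A \<Longrightarrow> x \<in> chart_map c ` chart_dom c \<Longrightarrow> chart_inv c x \<in> chart_dom c"
  using chart_inv_map by fastforce

lemma open_chart_image:
  assumes "c \<in> A" "open W"
  shows "open (chart_map c ` (chart_dom c \<inter> W))"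
proof -
  have "chart_map c ` (chart_dom c \<inter> W) = chart_map c ` chart_dom c \<inter> chart_inv c -` W"
    using chart_inv_map[OF assms(1)] by force
  moreover have "open (chart_map c ` chart_dom c)" "continuous_on (chart_map c ` chart_dom c) (chart_inv c)"
    using topological_chart[OF assms(1)] unfolding topological_chart_def homeomorphism_def by blast+
  then have "open (chart_map c ` chart_dom c \<inter> chart_inv c -` W)"
    using assms(2) continuous_open_preimage by blast
  ultimately show ?thesis by simp
qed

lemma open_chart_range: "c \<in> A \<Longrightarrow> open (chart_map c ` chart_dom c)"
  using open_chart_image[of c UNIV] by simp

lemma smooth_on_transition:
  "c \<in> A \<Longrightarrow> d \<in> A \<Longrightarrow> smooth_on (chart_map c ` (chart_dom c \<inter> chart_dom d)) (transition c d)"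
  using smooth_structure by (auto simp: smooth_structure_def compatible_def)

lemma transition_chart_map:
  "c \<in> A \<Longrightarrow> q \<in> chart_dom c \<Longrightarrow> transition c d (chart_map c q) = chart_map d q"
  by (simp add: transition_def chart_inv_map)

definition jacobian :: "('q, 'n) chart \<Rightarrow> ('q, 'n) chart \<Rightarrow> 'q \<Rightarrow> real^'n \<Rightarrow> real^'n"
  where "jacobian c d q = frechet_derivative (transition c d) (at (chart_map c q))"

lemma has_derivative_transition:
  "c \<in> charts_at A q \<Longrightarrow> d \<in> charts_at A q \<Longrightarrow>
    (transition c d has_derivative jacobian c d q) (at (chart_map c q))"
  unfolding jacobian_def
  by (rule smooth_on_has_derivative[OF smooth_on_transition]) (auto simp: charts_at_def)

lemma linear_jacobian: "c \<in> charts_at A q \<Longrightarrow> d \<in> charts_at A q \<Longrightarrow> linear (jacobian c d q)"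
  using has_derivative_transition has_derivative_linear by blast

lemma jacobian_self: "c \<in> charts_at A q \<Longrightarrow> jacobian c c q v = v"
proof -
  assume c: "c \<in> charts_at A q"
  have "(transition c c has_derivative (\<lambda>x. x)) (at (chart_map c q))"
    by (rule has_derivative_transform_within_open[OF has_derivative_ident
          open_chart_range[OF charts_atD(1)[OF c]]])
      (use charts_atD[OF c] in \<open>auto simp: transition_chart_map\<close>)
  then show ?thesis
    using has_derivative_unique[OF has_derivative_transition[OF c c]] by metis
qed

text \<open>The cocycle identity, from the chain rule. It makes the transformation law of tangent
  vectors consistent, so that \<open>coord_tvec\<close> does produce tangent vectors.\<close>

lemma jacobian_compose:
  assumes "c \<in> charts_at A q" "d \<in> charts_at A q" "e \<in> charts_at A q"
  shows "jacobian d e q (jacobian c d q v) = jacobian c e q v"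
proof -
  note cA = charts_atD[OF assms(1)] and dA = charts_atD[OF assms(2)] and eA = charts_atD[OF assms(3)]
  have "(transition d e has_derivative jacobian d e q) (at (transition c d (chart_map c q)))"
    using has_derivative_transition[OF assms(2,3)] by (simp add: transition_chart_map cA)
  from has_derivative_compose[OF has_derivative_transition[OF assms(1,2)] this]
  have "((\<lambda>x. transition d e (transition c d x)) has_derivative
      (\<lambda>v. jacobian d e q (jacobian c d q v))) (at (chart_map c q))" .
  then have "(transition c e has_derivative (\<lambda>v. jacobian d e q (jacobian c d q v))) (at (chart_map c q))"
    by (rule has_derivative_transform_within_open[OF _
          open_chart_image[OF cA(1) open_chart_dom[OF dA(1)]]])
      (use cA dA in \<open>auto simp: transition_chart_map\<close>)
  then show ?thesis
    using has_derivative_unique[OF has_derivative_transition[OF assms(1,3)]] by metis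
qed

section \<open>Tangent vectors and their components\<close>

lemma tangent_space_iff:
  "v \<in> tangent_space A q \<longleftrightarrow>
    (\<forall>c\<in>charts_at A q. \<forall>d\<in>charts_at A q. v d = jacobian c d q (v c)) \<and>
    (\<forall>c. c \<notin> charts_at A q \<longrightarrow> v c = 0)"
  by (simp add: tangent_space_def jacobian_def)

lemma tangent_space_jacobian:
  "v \<in> tangent_space A q \<Longrightarrow> c \<in> charts_at A q \<Longrightarrow> d \<in> charts_at A q \<Longrightarrow> v d = jacobian c d q (v c)"
  unfolding tangent_space_iff by blast

lemma tangent_space_outside: "v \<in> tangent_space A q \<Longrightarrow> c \<notin> charts_at A q \<Longrightarrow> v c = 0"
  unfolding tangent_space_iff by blast

lemma tangent_space_eqI:
  assumes "v \<in> tangent_space A q" "w \<in> tangent_space A q" "c \<in> charts_at A q" "v c = w c"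
  shows "v = w"
proof
  fix d
  show "v d = w d"
  proof (cases "d \<in> charts_at A q")
    case True
    then show ?thesis using tangent_space_jacobian[OF assms(1,3) True]
        tangent_space_jacobian[OF assms(2,3) True] assms(4) by simp
  next
    case False
    then show ?thesis using tangent_space_outside assms(1,2) by metis
  qed
qed

lemma coord_tvec_eq:
  "coord_tvec A c q x = (\<lambda>d. if d \<in> charts_at A q then jacobian c d q x else 0)"
  unfolding coord_tvec_def jacobian_def ..

lemma coord_tvec_tangent: "c \<in> charts_at A q \<Longrightarrow> coord_tvec A c q x \<in> tangent_space A q"
  by (simp add: tangent_space_iff coord_tvec_eq jacobian_compose)

lemma coord_tvec_component: "c \<in> charts_at A q \<Longrightarrow> coord_tvec A c q x c = x"
  by (simp add: coord_tvec_eq jacobian_self)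

lemma coord_tvec_collapse:
  "c \<in> charts_at A q \<Longrightarrow> v \<in> tangent_space A q \<Longrightarrow> coord_tvec A c q (v c) = v"
  by (rule tangent_space_eqI) (auto simp: coord_tvec_tangent coord_tvec_component)

lemma subspace_tangent_space: "subspace (tangent_space A q)"
proof (rule subspaceI)
  show "0 \<in> tangent_space A q"
    unfolding tangent_space_iff by (simp add: linear_0[OF linear_jacobian])
  show "v + w \<in> tangent_space A q" if v: "v \<in> tangent_space A q" "w \<in> tangent_space A q" for v w
    unfolding tangent_space_iff
  proof (intro conjI ballI allI impI)
    fix c d assume cd: "c \<in> charts_at A q" "d \<in> charts_at A q"
    show "(v + w) d = jacobian c d q ((v + w) c)"
      using tangent_space_jacobian[OF v(1) cd] tangent_space_jacobian[OF v(2) cd]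
      by (simp add: linear_add[OF linear_jacobian[OF cd]])
  qed (simp add: v[THEN tangent_space_outside])
  show "a *\<^sub>R v \<in> tangent_space A q" if v: "v \<in> tangent_space A q" for v a
    unfolding tangent_space_iff
  proof (intro conjI ballI allI impI)
    fix c d assume cd: "c \<in> charts_at A q" "d \<in> charts_at A q"
    show "(a *\<^sub>R v) d = jacobian c d q ((a *\<^sub>R v) c)"
      using tangent_space_jacobian[OF v cd]
      by (simp add: scaleR_fun_apply linear_scale[OF linear_jacobian[OF cd]])
  qed (simp add: scaleR_fun_apply tangent_space_outside[OF v])
qed

lemma tangent_space_lincomb:
  "v \<in> tangent_space A q \<Longrightarrow> w \<in> tangent_space A q \<Longrightarrow> a *\<^sub>R v + b *\<^sub>R w \<in> tangent_space A q"
  using subspace_tangent_space by (simp add: subspace_add subspace_scale)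

lemma coord_tvec_lincomb:
  "c \<in> charts_at A q \<Longrightarrow>
    coord_tvec A c q (a *\<^sub>R x + b *\<^sub>R y) = a *\<^sub>R coord_tvec A c q x + b *\<^sub>R coord_tvec A c q y"
  by (rule tangent_space_eqI)
    (auto simp: coord_tvec_tangent coord_tvec_component tangent_space_lincomb scaleR_fun_apply)

lemma linear_coord_tvec:
  assumes "c \<in> charts_at A q"
  shows "linear (coord_tvec A c q)"
proof (rule linearI)
  show "coord_tvec A c q (x + y) = coord_tvec A c q x + coord_tvec A c q y" for x y
    using coord_tvec_lincomb[OF assms, of 1 x 1 y] by (simp only: scaleR_one)
  show "coord_tvec A c q (r *\<^sub>R x) = r *\<^sub>R coord_tvec A c q x" for r x
    using coord_tvec_lincomb[OF assms, of r x 0 0] by (simp only: scaleR_zero_left add_0_right)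
qed

section \<open>Covectors and their components\<close>

lemma cotangent_lincomb:
  "\<alpha> \<in> cotangent_space A q \<Longrightarrow> v \<in> tangent_space A q \<Longrightarrow> w \<in> tangent_space A q \<Longrightarrow>
    \<alpha> (a *\<^sub>R v + b *\<^sub>R w) = a * \<alpha> v + b * \<alpha> w"
  by (simp add: cotangent_space_def)

lemma cotangent_outside: "\<alpha> \<in> cotangent_space A q \<Longrightarrow> v \<notin> tangent_space A q \<Longrightarrow> \<alpha> v = 0"
  by (simp add: cotangent_space_def)

lemma subspace_cotangent_space: "subspace (cotangent_space A q)"
  unfolding subspace_def by (auto simp: cotangent_space_def scaleR_fun_apply algebra_simps)

lemma cotangent_add:
  "\<alpha> \<in> cotangent_space A q \<Longrightarrow> v \<in> tangent_space A q \<Longrightarrow> w \<in> tangent_space A q \<Longrightarrow>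
    \<alpha> (v + w) = \<alpha> v + \<alpha> w"
  using cotangent_lincomb[of \<alpha> q v w 1 1] by (simp only: scaleR_one mult_1_left)

lemma cotangent_scale:
  "\<alpha> \<in> cotangent_space A q \<Longrightarrow> v \<in> tangent_space A q \<Longrightarrow> \<alpha> (a *\<^sub>R v) = a * \<alpha> v"
  using cotangent_lincomb[of \<alpha> q v v a 0]
  by (simp only: scaleR_zero_left add_0_right mult_zero_left)

text \<open>A covector is linear only on the tangent space. Composed with \<open>coord_tvec\<close>
  it becomes a \<open>linear\<close> map on all of \<open>real^'n\<close>, which is then determined
  by its values at the unit vectors.\<close>

lemma linear_covec_coord:
  assumes "\<alpha> \<in> cotangent_space A q" "c \<in> charts_at A q"
  shows "linear (\<lambda>x. \<alpha> (coord_tvec A c q x))"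
proof (rule linearI)
  note t = coord_tvec_tangent[OF assms(2)]
  show "\<alpha> (coord_tvec A c q (x + y)) = \<alpha> (coord_tvec A c q x) + \<alpha> (coord_tvec A c q y)" for x y
    by (simp only: linear_add[OF linear_coord_tvec[OF assms(2)]] cotangent_add[OF assms(1) t t])
  show "\<alpha> (coord_tvec A c q (r *\<^sub>R x)) = r *\<^sub>R \<alpha> (coord_tvec A c q x)" for r x
    by (simp only: linear_scale[OF linear_coord_tvec[OF assms(2)]] cotangent_scale[OF assms(1) t]
        real_scaleR_def)
qed

lemma linear_eq_inner_axis:
  fixes f :: "real^'m \<Rightarrow> real"
  assumes "linear f"
  shows "f x = (\<chi> i. f (axis i 1)) \<bullet> x"
proof -
  have "f x = f (\<Sum>i\<in>UNIV. x $ i *\<^sub>R axis i 1)"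
    using basis_expansion[of x] by (simp only: scalar_mult_eq_scaleR)
  also have "\<dots> = (\<Sum>i\<in>UNIV. x $ i * f (axis i 1))"
    by (simp add: linear_sum[OF assms] linear_scale[OF assms])
  finally show ?thesis by (simp add: inner_vec_def mult.commute)
qed

lemma covec_coord_tvec:
  "\<alpha> \<in> cotangent_space A q \<Longrightarrow> c \<in> charts_at A q \<Longrightarrow>
    \<alpha> (coord_tvec A c q x) = covec_components A c q \<alpha> \<bullet> x"
  using linear_eq_inner_axis[OF linear_covec_coord] by (simp add: covec_components_def)

lemma covec_apply:
  "\<alpha> \<in> cotangent_space A q \<Longrightarrow> c \<in> charts_at A q \<Longrightarrow> v \<in> tangent_space A q \<Longrightarrow>
    \<alpha> v = covec_components A c q \<alpha> \<bullet> v c"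
  using covec_coord_tvec[of \<alpha> q c "v c"] by (simp add: coord_tvec_collapse)

lemma coord_covec_cotangent: "coord_covec A c q p \<in> cotangent_space A q"
  by (auto simp: cotangent_space_def coord_covec_def tangent_space_lincomb scaleR_fun_apply
      inner_right_distrib)

lemma cotangent_space_eqI:
  assumes "\<alpha> \<in> cotangent_space A q" "\<beta> \<in> cotangent_space A q" "c \<in> charts_at A q"
    and "covec_components A c q \<alpha> = covec_components A c q \<beta>"
  shows "\<alpha> = \<beta>"
proof
  fix v
  show "\<alpha> v = \<beta> v"
  proof (cases "v \<in> tangent_space A q")
    case True
    from covec_apply[OF assms(1,3) this] covec_apply[OF assms(2,3) this] show ?thesis
      by (simp only: assms(4))
  next
    case False
    from cotangent_outside[OF assms(1) this] cotangent_outside[OF assms(2) this] show ?thesis by simp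
  qed
qed

lemma covec_components_coord_covec:
  "c \<in> charts_at A q \<Longrightarrow> covec_components A c q (coord_covec A c q p) = p"
  by (simp add: covec_components_def coord_covec_def coord_tvec_tangent coord_tvec_component
      vec_eq_iff inner_axis)

lemma coord_covec_components:
  "c \<in> charts_at A q \<Longrightarrow> \<alpha> \<in> cotangent_space A q \<Longrightarrow> coord_covec A c q (covec_components A c q \<alpha>) = \<alpha>"
  by (rule cotangent_space_eqI) (auto simp: coord_covec_cotangent covec_components_coord_covec)

text \<open>The \<open>i\<close>-th coordinate vector of \<open>c\<close> has the components
  \<open>jacobian c d q (axis i 1)\<close> in \<open>d\<close>. Pairing there produces the
  transposed Jacobian, which is why the direction is opposite to that for vectors.\<close>

lemma covec_components_change:
  "c \<in> charts_at A q \<Longrightarrow> d \<in> charts_at A q \<Longrightarrow> \<alpha> \<in> cotangent_space A q \<Longrightarrow>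
    covec_components A c q \<alpha> = (\<chi> i. covec_components A d q \<alpha> \<bullet> jacobian c d q (axis i 1))"
  using covec_apply[OF _ _ coord_tvec_tangent, of \<alpha> q d c "axis _ 1"]
  by (simp add: covec_components_def vec_eq_iff coord_tvec_eq)

lemma covec_components_lincomb:
  "covec_components A c q (a *\<^sub>R \<alpha> + b *\<^sub>R \<beta>) =
    a *\<^sub>R covec_components A c q \<alpha> + b *\<^sub>R covec_components A c q \<beta>"
  by (simp add: covec_components_def vec_eq_iff scaleR_fun_apply)

end

section \<open>Quadratic forms and kinetic energies\<close>

lemma bounded_bilinear_matrix_vector_mult:
  "bounded_bilinear ((*v) :: real^'n^'m \<Rightarrow> real^'n \<Rightarrow> real^'m)"
  by (subst bilinear_conv_bounded_bilinear[symmetric])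
    (auto simp: bilinear_def matrix_vector_mult_add_rdistrib matrix_vector_right_distrib
      scaleR_matrix_vector_assoc matrix_vector_mult_scaleR intro!: linearI)

lemma differentiable_vecI:
  fixes f :: "'a::real_normed_vector \<Rightarrow> 'b::euclidean_space^'n"
  assumes "\<And>i. (\<lambda>x. f x $ i) differentiable at x"
  shows "f differentiable at x"
  using assms
  by (auto simp: differentiable_componentwise_within[of f] Basis_vec_def inner_axis
      intro!: differentiable_inner)

lemma differentiable_prod:
  fixes f :: "'i \<Rightarrow> 'a::real_normed_vector \<Rightarrow> real"
  assumes "\<And>i. f i differentiable at x"
  shows "(\<lambda>x. \<Prod>i\<in>I. f i x) differentiable at x"
  by (induction I rule: infinite_finite_induct) (simp_all add: assms)

lemma differentiable_det:
  fixes G :: "'a::real_normed_vector \<Rightarrow> real^'n^'n"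
  assumes "\<And>i j. (\<lambda>y. G y $ i $ j) differentiable at x"
  shows "(\<lambda>y. det (G y)) differentiable at x"
  unfolding det_def
  by (intro differentiable_sum ballI differentiable_mult differentiable_const differentiable_prod assms)
    (simp add: finite_permutations)

lemma matrix_inv_mult:
  assumes "invertible A"
  shows "A ** matrix_inv A = mat 1" "matrix_inv A ** A = mat 1"
proof -
  have "A ** matrix_inv A = mat 1 \<and> matrix_inv A ** A = mat 1"
    using assms unfolding invertible_def matrix_inv_def by (rule someI_ex)
  then show "A ** matrix_inv A = mat 1" "matrix_inv A ** A = mat 1" by auto
qed

text \<open>By Cramer's rule.\<close>

lemma differentiable_matrix_inv:
  fixes G :: "'a::real_normed_vector \<Rightarrow> real^'n^'n"
  assumes "\<And>i j. (\<lambda>y. G y $ i $ j) differentiable at x"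
    and "open S" "x \<in> S" "\<And>y. y \<in> S \<Longrightarrow> invertible (G y)"
  shows "(\<lambda>y. matrix_inv (G y)) differentiable at x"
proof (intro differentiable_vecI)
  fix i j :: 'n
  \<comment> \<open>The matrix \<open>G y\<close> with column \<open>i\<close> replaced by the unit
    vector \<open>axis j 1\<close>. Its determinant is Cramer's numerator for entry \<open>i\<close>
    of the solution of \<open>G y *v z = axis j 1\<close>, which is column \<open>j\<close> of the
    inverse.\<close>
  define N where "N y = (\<chi> a b. if b = i then axis j 1 $ a else G y $ a $ b)" for y
  have eq: "det (N y) / det (G y) = matrix_inv (G y) $ i $ j" if "y \<in> S" for y
  proof -
    have "G y *v (matrix_inv (G y) *v axis j 1) = axis j 1"
      using matrix_inv_mult(1)[OF assms(4)[OF that]] by (simp add: matrix_vector_mul_assoc)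
    then have "matrix_inv (G y) *v axis j 1 =
        (\<chi> k. det (\<chi> a b. if b = k then axis j 1 $ a else G y $ a $ b) / det (G y))"
      using cramer[of "G y"] assms(4)[OF that] by (simp add: invertible_det_nz)
    then have "(matrix_inv (G y) *v axis j 1) $ i = det (N y) / det (G y)"
      by (simp add: N_def)
    then show ?thesis by (simp add: matrix_vector_mult_basis column_def)
  qed
  have "(\<lambda>y. N y $ a $ b) differentiable at x" for a b
    using assms(1) by (cases "b = i") (simp_all add: N_def)
  then have "(\<lambda>y. det (N y) / det (G y)) differentiable at x"
    using assms(3) assms(4)[OF assms(3)]
    by (intro differentiable_divide differentiable_det assms(1)) (simp_all add: invertible_det_nz)
  then obtain D where "((\<lambda>y. det (N y) / det (G y)) has_derivative D) (at x)"
    by (auto simp: differentiable_def)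
  then have "((\<lambda>y. matrix_inv (G y) $ i $ j) has_derivative D) (at x)"
    by (rule has_derivative_transform_within_open[OF _ assms(2,3) eq])
  then show "(\<lambda>y. matrix_inv (G y) $ i $ j) differentiable at x"
    by (auto simp: differentiable_def)
qed

lemma quadratic_form_sum:
  fixes M :: "real^'n^'n"
  shows "(\<Sum>i\<in>UNIV. \<Sum>j\<in>UNIV. p $ i * M $ i $ j * p $ j) = p \<bullet> (M *v p)"
  by (simp add: inner_vec_def matrix_vector_mult_def sum_distrib_left mult.assoc)

lemma symmetric_matrix_inner:
  fixes M :: "real^'n^'n"
  assumes "transpose M = M"
  shows "x \<bullet> (M *v y) = y \<bullet> (M *v x)"
  by (metis assms dot_lmul_matrix inner_commute transpose_matrix_vector)

text \<open>Polarization. It gives the uniqueness behind the description in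
  \<open>kinetic_matrix\<close>.\<close>

lemma symmetric_matrix_eqI:
  fixes M N :: "real^'n^'n"
  assumes "transpose M = M" "transpose N = N" "\<And>p. p \<bullet> (M *v p) = p \<bullet> (N *v p)"
  shows "M = N"
proof -
  have "x \<bullet> (M *v y) = x \<bullet> (N *v y)" for x y
    using assms(3)[of "x + y"] assms(3)[of x] assms(3)[of y]
      symmetric_matrix_inner[OF assms(1), of x y] symmetric_matrix_inner[OF assms(2), of x y]
    by (simp add: matrix_vector_right_distrib inner_add_left inner_add_right)
  from this[of "axis _ 1" "axis _ 1"] show ?thesis
    by (simp add: vec_eq_iff inner_axis' matrix_vector_mult_basis column_def)
qed

text \<open>The derivative of the kinetic term in the base variables of canonical coordinates.\<close>

definition base_part :: "(real^'n \<Rightarrow> real^'n^'n) \<Rightarrow> real^'n \<Rightarrow> real^'n \<Rightarrow> real^'n \<Rightarrow> real"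
  where "base_part M x p v = 1/2 * (p \<bullet> (frechet_derivative M (at x) v *v p))"

lemma linear_base_part:
  assumes "M differentiable at x"
  shows "linear (base_part M x p)"
proof -
  interpret D: linear "frechet_derivative M (at x)"
    using assms by (rule linear_frechet_derivative)
  show ?thesis
    by (rule linearI) (simp_all add: base_part_def D.add D.scale matrix_vector_mult_add_rdistrib
        inner_add_right distrib_left scaleR_matrix_vector_assoc[symmetric])
qed

text \<open>The product rule for a kinetic energy whose base point and momentum both vary. The
  symmetry of the matrix merges the two momentum terms and thereby cancels the 1/2. A constant
  \<open>P\<close> yields base partial derivatives, a constant \<open>X\<close> yields fiber
  derivatives, and a moving pair occurs along curves and under a change of charts.\<close>

lemma has_derivative_quadratic_form:
  fixes X :: "'a::real_normed_vector \<Rightarrow> real^'n"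
  assumes X: "(X has_derivative X') (at z)" and P: "(P has_derivative P') (at z)"
    and M: "M differentiable at (X z)" and sym: "transpose (M (X z)) = M (X z)"
  shows "((\<lambda>z. 1/2 * (P z \<bullet> (M (X z) *v P z))) has_derivative
    (\<lambda>h. base_part M (X z) (P z) (X' h) + (M (X z) *v P z) \<bullet> P' h)) (at z)"
proof -
  have "(M has_derivative frechet_derivative M (at (X z))) (at (X z))"
    using M frechet_derivative_works by blast
  from has_derivative_compose[OF X this]
  have "((\<lambda>z. M (X z)) has_derivative (\<lambda>h. frechet_derivative M (at (X z)) (X' h))) (at z)" .
  from bounded_bilinear.FDERIV[OF bounded_bilinear_matrix_vector_mult this P]
  have "((\<lambda>z. 1/2 * (P z \<bullet> (M (X z) *v P z))) has_derivative
    (\<lambda>h. 1/2 * (P z \<bullet> (M (X z) *v P' h + frechet_derivative M (at (X z)) (X' h) *v P z) +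
       P' h \<bullet> (M (X z) *v P z)))) (at z)"
    by (intro has_derivative_mult_right has_derivative_inner P)
  moreover have "1/2 * (P z \<bullet> (M (X z) *v P' h + frechet_derivative M (at (X z)) (X' h) *v P z) +
       P' h \<bullet> (M (X z) *v P z)) = base_part M (X z) (P z) (X' h) + (M (X z) *v P z) \<bullet> P' h" for h
    using symmetric_matrix_inner[OF sym, of "P z" "P' h"]
    by (simp add: base_part_def inner_add_right inner_commute[of "M (X z) *v P z"])
  ultimately show ?thesis by (simp only:)
qed

lemma partial_eq:
  fixes f :: "real^'n \<Rightarrow> real"
  assumes "(f has_derivative D) (at x)"
  shows "partial i f x = D (axis i 1)"
proof -
  have "((\<lambda>t. x + t *\<^sub>R axis i 1) has_derivative (\<lambda>h. h *\<^sub>R axis i 1)) (at 0)"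
    by (auto intro!: derivative_eq_intros)
  moreover have "(f has_derivative D) (at (x + 0 *\<^sub>R axis i 1))" using assms by simp
  ultimately have "((\<lambda>t. f (x + t *\<^sub>R axis i 1)) has_derivative (\<lambda>h. D (h *\<^sub>R axis i 1))) (at 0)"
    by (rule has_derivative_compose)
  moreover have "D (h *\<^sub>R axis i 1) = h * D (axis i 1)" for h
    using linear_scale[OF has_derivative_linear[OF assms]] by simp
  ultimately have "((\<lambda>t. f (x + t *\<^sub>R axis i 1)) has_real_derivative D (axis i 1)) (at 0)"
    by (simp add: has_field_derivative_def mult_commute_abs)
  then show ?thesis unfolding partial_def by (rule DERIV_imp_deriv)
qed

context smooth_manifold
begin

section \<open>The matrix of a kinetic energy\<close>

definition metric_matrix :: "('q, 'n) metric \<Rightarrow> ('q, 'n) chart \<Rightarrow> real^'n \<Rightarrow> real^'n^'n"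
  where "metric_matrix \<rho> c x = (\<chi> i j. let q = chart_inv c x
    in \<rho> q (coord_tvec A c q (axis i 1)) (coord_tvec A c q (axis j 1)))"

context
  fixes \<rho>
  assumes metric: "riemannian_metric A \<rho>"
begin

lemma metric_sym: "u \<in> tangent_space A q \<Longrightarrow> v \<in> tangent_space A q \<Longrightarrow> \<rho> q u v = \<rho> q v u"
  and metric_lincomb: "u \<in> tangent_space A q \<Longrightarrow> v \<in> tangent_space A q \<Longrightarrow> w \<in> tangent_space A q \<Longrightarrow>
    \<rho> q (a *\<^sub>R u + b *\<^sub>R v) w = a * \<rho> q u w + b * \<rho> q v w"
  and metric_pos: "u \<in> tangent_space A q \<Longrightarrow> u \<noteq> 0 \<Longrightarrow> \<rho> q u u > 0"
  using metric unfolding riemannian_metric_def by blast+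

lemma linear_metric:
  assumes "c \<in> charts_at A q" "w \<in> tangent_space A q"
  shows "linear (\<lambda>x. \<rho> q (coord_tvec A c q x) w)"
proof (rule linearI)
  note t = coord_tvec_tangent[OF assms(1)]
  show "\<rho> q (coord_tvec A c q (x + y)) w = \<rho> q (coord_tvec A c q x) w + \<rho> q (coord_tvec A c q y) w" for x y
    using metric_lincomb[OF t t assms(2), of 1 x 1 y]
    by (simp only: linear_add[OF linear_coord_tvec[OF assms(1)]] scaleR_one mult_1_left)
  show "\<rho> q (coord_tvec A c q (r *\<^sub>R x)) w = r *\<^sub>R \<rho> q (coord_tvec A c q x) w" for r x
    using metric_lincomb[OF t t assms(2), of r x 0 x]
    by (simp only: linear_scale[OF linear_coord_tvec[OF assms(1)]] scaleR_zero_left add_0_right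
        mult_zero_left real_scaleR_def)
qed

lemma metric_coord:
  assumes c: "c \<in> charts_at A q"
  shows "\<rho> q (coord_tvec A c q x) (coord_tvec A c q y) = x \<bullet> (metric_matrix \<rho> c (chart_map c q) *v y)"
proof -
  note t = coord_tvec_tangent[OF c]
  have inv: "chart_inv c (chart_map c q) = q"
    using c by (simp add: chart_inv_map charts_at_def)
  have "\<rho> q (coord_tvec A c q (axis i 1)) (coord_tvec A c q y) =
      (metric_matrix \<rho> c (chart_map c q) *v y) $ i" for i
  proof -
    have "\<rho> q (coord_tvec A c q (axis i 1)) (coord_tvec A c q y) =
        \<rho> q (coord_tvec A c q y) (coord_tvec A c q (axis i 1))"
      by (rule metric_sym[OF t t])
    also have "\<dots> = (\<chi> j. \<rho> q (coord_tvec A c q (axis j 1)) (coord_tvec A c q (axis i 1))) \<bullet> y"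
      by (rule linear_eq_inner_axis[OF linear_metric[OF c t]])
    also have "\<dots> = (\<Sum>j\<in>UNIV. \<rho> q (coord_tvec A c q (axis i 1)) (coord_tvec A c q (axis j 1)) * y $ j)"
      unfolding inner_vec_def by (simp add: metric_sym[OF t t, of "axis i 1"])
    finally show ?thesis by (simp add: matrix_vector_mult_def metric_matrix_def inv)
  qed
  then have *: "(\<chi> i. \<rho> q (coord_tvec A c q (axis i 1)) (coord_tvec A c q y)) = metric_matrix \<rho> c (chart_map c q) *v y"
    by (simp add: vec_eq_iff)
  show ?thesis
    using linear_eq_inner_axis[OF linear_metric[OF c t], of x y] unfolding *
    by (simp add: inner_commute)
qed

lemma transpose_metric_matrix:
  assumes c: "c \<in> charts_at A q"
  shows "transpose (metric_matrix \<rho> c (chart_map c q)) = metric_matrix \<rho> c (chart_map c q)"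
proof -
  have inv: "chart_inv c (chart_map c q) = q"
    using c by (simp add: chart_inv_map charts_at_def)
  show ?thesis
    using metric_sym[OF coord_tvec_tangent[OF c] coord_tvec_tangent[OF c]]
    by (simp add: transpose_def vec_eq_iff metric_matrix_def inv)
qed

text \<open>A vector in the kernel would have length zero, which positive definiteness excludes
  unless it is 0.\<close>

lemma invertible_metric_matrix:
  assumes c: "c \<in> charts_at A q"
  shows "invertible (metric_matrix \<rho> c (chart_map c q))"
proof -
  have "x = 0" if "metric_matrix \<rho> c (chart_map c q) *v x = 0" for x
  proof (rule ccontr)
    assume "x \<noteq> 0"
    then have "coord_tvec A c q x \<noteq> 0"
      using coord_tvec_component[OF c, of x] by auto
    from metric_pos[OF coord_tvec_tangent[OF c] this] show False
      unfolding metric_coord[OF c] that by simp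
  qed
  then show ?thesis
    unfolding invertible_left_inverse matrix_left_invertible_ker by blast
qed

text \<open>The cometric in coordinates: an explicit candidate for \<open>kinetic_matrix\<close>,
  which is given by a description only.\<close>

definition inverse_metric :: "('q, 'n) chart \<Rightarrow> real^'n \<Rightarrow> real^'n^'n"
  where "inverse_metric c x = matrix_inv (metric_matrix \<rho> c x)"

lemma transpose_inverse_metric:
  assumes c: "c \<in> charts_at A q"
  shows "transpose (inverse_metric c (chart_map c q)) = inverse_metric c (chart_map c q)"
proof -
  let ?G = "metric_matrix \<rho> c (chart_map c q)"
  let ?M = "inverse_metric c (chart_map c q)"
  have 1: "?G ** ?M = mat 1" "?M ** ?G = mat 1"
    unfolding inverse_metric_def by (intro matrix_inv_mult invertible_metric_matrix[OF c])+
  have "transpose ?M ** ?G = transpose (?G ** ?M)"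
    by (simp add: matrix_transpose_mul transpose_metric_matrix[OF c])
  then have "transpose ?M ** ?G = mat 1" by (simp add: 1)
  then have "transpose ?M ** ?G ** ?M = ?M" by simp
  then show ?thesis unfolding matrix_mul_assoc[symmetric] 1 by simp
qed

text \<open>In a chart \<open>flat\<close> multiplies components by the Gram matrix of the
  coordinate vectors. As this matrix is invertible, the vector described by \<open>sharp\<close>
  exists, is unique and comes from the inverse matrix.\<close>

lemma sharp_eq:
  assumes c: "c \<in> charts_at A q" and \<alpha>: "\<alpha> \<in> cotangent_space A q"
  shows "sharp A \<rho> q \<alpha> =
    coord_tvec A c q (inverse_metric c (chart_map c q) *v covec_components A c q \<alpha>)"
proof -
  let ?G = "metric_matrix \<rho> c (chart_map c q)"
  let ?M = "inverse_metric c (chart_map c q)"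
  let ?p = "covec_components A c q \<alpha>"
  have GM: "?G ** ?M = mat 1" "?M ** ?G = mat 1"
    unfolding inverse_metric_def by (intro matrix_inv_mult invertible_metric_matrix[OF c])+
  have flat_eq: "flat A \<rho> q (coord_tvec A c q x) = \<alpha> \<longleftrightarrow> ?G *v x = ?p" for x
  proof -
    have fl: "flat A \<rho> q (coord_tvec A c q x) = coord_covec A c q (?G *v x)"
    proof
      fix w
      show "flat A \<rho> q (coord_tvec A c q x) w = coord_covec A c q (?G *v x) w"
      proof (cases "w \<in> tangent_space A q")
        case True
        have "\<rho> q (coord_tvec A c q x) w = \<rho> q (coord_tvec A c q x) (coord_tvec A c q (w c))"
          by (simp only: coord_tvec_collapse[OF c True])
        also have "\<dots> = x \<bullet> (?G *v w c)" by (rule metric_coord[OF c])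
        also have "\<dots> = (?G *v x) \<bullet> w c"
          using symmetric_matrix_inner[OF transpose_metric_matrix[OF c]] by (simp only: inner_commute)
        finally show ?thesis using True by (simp add: flat_def coord_covec_def)
      qed (simp add: flat_def coord_covec_def)
    qed
    show ?thesis
    proof
      assume "flat A \<rho> q (coord_tvec A c q x) = \<alpha>"
      then show "?G *v x = ?p"
        using covec_components_coord_covec[OF c, of "?G *v x"] unfolding fl by simp
    next
      assume "?G *v x = ?p"
      then show "flat A \<rho> q (coord_tvec A c q x) = \<alpha>"
        unfolding fl by (simp add: coord_covec_components[OF c \<alpha>])
    qed
  qed
  show ?thesis
    unfolding sharp_def
  proof (rule the_equality)
    have "?G *v (?M *v ?p) = ?p" by (simp add: matrix_vector_mul_assoc GM)
    then show "coord_tvec A c q (?M *v ?p) \<in> tangent_space A q \<and>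
        flat A \<rho> q (coord_tvec A c q (?M *v ?p)) = \<alpha>"
      by (simp add: flat_eq coord_tvec_tangent[OF c])
  next
    fix v assume v: "v \<in> tangent_space A q \<and> flat A \<rho> q v = \<alpha>"
    then have "?G *v v c = ?p"
      using flat_eq[of "v c"] by (simp add: coord_tvec_collapse[OF c])
    then have "?M *v ?p = v c"
      by (metis GM(2) matrix_vector_mul_assoc matrix_vector_mul_lid)
    then show "v = coord_tvec A c q (?M *v ?p)"
      using v by (simp add: coord_tvec_collapse[OF c])
  qed
qed

lemma kinetic_inverse_metric:
  assumes c: "c \<in> charts_at A q" and \<alpha>: "\<alpha> \<in> cotangent_space A q"
  shows "kinetic A \<rho> (q, \<alpha>) = 1/2 *
    (covec_components A c q \<alpha> \<bullet> (inverse_metric c (chart_map c q) *v covec_components A c q \<alpha>))"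
  by (simp add: kinetic_def sharp_eq[OF c \<alpha>] covec_coord_tvec[OF \<alpha> c])

text \<open>A quadratic form determines its matrix among the symmetric ones only, so existence
  includes the symmetry of the inverse, and uniqueness is polarization.\<close>

lemma kinetic_matrix_eq:
  assumes c: "c \<in> charts_at A q"
  shows "kinetic_matrix A \<rho> c (chart_map c q) = inverse_metric c (chart_map c q)"
proof -
  let ?M = "inverse_metric c (chart_map c q)"
  have inv: "chart_inv c (chart_map c q) = q"
    using c by (simp add: chart_inv_map charts_at_def)
  have kin: "kinetic A \<rho> (canonical_inv A c (chart_map c q, p)) = 1/2 * (p \<bullet> (?M *v p))" for p
    by (simp add: canonical_inv_def inv kinetic_inverse_metric[OF c coord_covec_cotangent]
        covec_components_coord_covec[OF c])
  show ?thesis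
    unfolding kinetic_matrix_def kin quadratic_form_sum
    by (rule the_equality)
      (auto simp: transpose_inverse_metric[OF c] intro: symmetric_matrix_eqI[OF _ transpose_inverse_metric[OF c]])
qed

lemma sharp_kinetic_matrix:
  "c \<in> charts_at A q \<Longrightarrow> \<alpha> \<in> cotangent_space A q \<Longrightarrow> sharp A \<rho> q \<alpha> =
    coord_tvec A c q (kinetic_matrix A \<rho> c (chart_map c q) *v covec_components A c q \<alpha>)"
  by (simp add: sharp_eq kinetic_matrix_eq)

lemma kinetic_eq:
  "c \<in> charts_at A q \<Longrightarrow> \<alpha> \<in> cotangent_space A q \<Longrightarrow> kinetic A \<rho> (q, \<alpha>) = 1/2 *
    (covec_components A c q \<alpha> \<bullet> (kinetic_matrix A \<rho> c (chart_map c q) *v covec_components A c q \<alpha>))"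
  by (simp add: kinetic_inverse_metric kinetic_matrix_eq)

lemma transpose_kinetic_matrix:
  "c \<in> charts_at A q \<Longrightarrow>
    transpose (kinetic_matrix A \<rho> c (chart_map c q)) = kinetic_matrix A \<rho> c (chart_map c q)"
  by (simp add: transpose_inverse_metric kinetic_matrix_eq)

text \<open>The definition of a metric makes its values on coordinate vectors smooth, whereas this
  matrix is the inverse of those. Cramer's formula carries differentiability over, as both functions
  agree on the open range of the chart.\<close>

lemma differentiable_kinetic_matrix:
  assumes c: "c \<in> charts_at A q"
  shows "kinetic_matrix A \<rho> c differentiable at (chart_map c q)"
proof -
  let ?U = "chart_map c ` chart_dom c"
  have cA: "c \<in> A" "q \<in> chart_dom c" using charts_atD[OF c] .
  have "(\<lambda>y. matrix_inv (metric_matrix \<rho> c y)) differentiable at (chart_map c q)"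
  proof (rule differentiable_matrix_inv[OF _ open_chart_range[OF cA(1)]])
    show "chart_map c q \<in> ?U" using cA by simp
    show "invertible (metric_matrix \<rho> c y)" if "y \<in> ?U" for y
      using that invertible_metric_matrix[OF charts_atI[OF cA(1)]] by auto
    have "smooth_on ?U (\<lambda>x. let q = chart_inv c x in
        \<rho> q (coord_tvec A c q (axis i 1)) (coord_tvec A c q (axis j 1)))" for i j
      using metric cA(1) unfolding riemannian_metric_def by blast
    then show "(\<lambda>y. metric_matrix \<rho> c y $ i $ j) differentiable at (chart_map c q)" for i j
      unfolding metric_matrix_def using cA(2) by (auto intro: smooth_on_differentiable)
  qed
  then obtain D where "((\<lambda>y. matrix_inv (metric_matrix \<rho> c y)) has_derivative D) (at (chart_map c q))"
    by (auto simp: differentiable_def)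
  then have "(kinetic_matrix A \<rho> c has_derivative D) (at (chart_map c q))"
  proof (rule has_derivative_transform_within_open[OF _ open_chart_range[OF cA(1)]])
    show "chart_map c q \<in> ?U" using cA by simp
    show "matrix_inv (metric_matrix \<rho> c y) = kinetic_matrix A \<rho> c y" if "y \<in> ?U" for y
      using that kinetic_matrix_eq[OF charts_atI[OF cA(1)]] by (auto simp: inverse_metric_def)
  qed
  then show ?thesis by (auto simp: differentiable_def)
qed

end

end

section \<open>The bracket of simple functions\<close>

context smooth_manifold
begin

section \<open>Differentials and fiber derivatives\<close>

lemma smooth_function_has_derivative:
  assumes f: "smooth_function A W f" and W: "open W" "q \<in> W" and c: "c \<in> charts_at A q"
  shows "(f \<circ> chart_inv c has_derivative frechet_derivative (f \<circ> chart_inv c) (at (chart_map c q)))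
    (at (chart_map c q))"
proof (rule smooth_on_has_derivative)
  show "smooth_on (chart_map c ` (chart_dom c \<inter> W)) (f \<circ> chart_inv c)"
    using f charts_atD[OF c] by (simp add: smooth_function_def)
  show "chart_map c q \<in> chart_map c ` (chart_dom c \<inter> W)"
    using W charts_atD[OF c] by simp
qed

lemma differential_eq:
  assumes f: "smooth_function A W f" and W: "open W" "q \<in> W" and c: "c \<in> charts_at A q"
    and v: "v \<in> tangent_space A q"
  shows "differential A f q v = frechet_derivative (f \<circ> chart_inv c) (at (chart_map c q)) (v c)"
proof -
  define d where "d = chart_at A q"
  have d: "d \<in> charts_at A q" by (simp add: d_def chart_at_charts_at)
  note cA = charts_atD[OF c] and dA = charts_atD[OF d]
  have "(f \<circ> chart_inv c has_derivative frechet_derivative (f \<circ> chart_inv c) (at (chart_map c q)))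
      (at (transition d c (chart_map d q)))"
    using smooth_function_has_derivative[OF f W c] by (simp only: transition_chart_map[OF dA])
  from has_derivative_compose[OF has_derivative_transition[OF d c] this]
  have "((\<lambda>x. (f \<circ> chart_inv c) (transition d c x)) has_derivative
      (\<lambda>w. frechet_derivative (f \<circ> chart_inv c) (at (chart_map c q)) (jacobian d c q w)))
      (at (chart_map d q))" .
  then have "(f \<circ> chart_inv d has_derivative
      (\<lambda>w. frechet_derivative (f \<circ> chart_inv c) (at (chart_map c q)) (jacobian d c q w)))
      (at (chart_map d q))"
  proof (rule has_derivative_transform_within_open[OF _
        open_chart_image[OF dA(1) open_chart_dom[OF cA(1)]]])
    show "chart_map d q \<in> chart_map d ` (chart_dom d \<inter> chart_dom c)" using cA dA by simp
    show "(f \<circ> chart_inv c) (transition d c x) = (f \<circ> chart_inv d) x"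
      if "x \<in> chart_map d ` (chart_dom d \<inter> chart_dom c)" for x
      using that cA dA by (auto simp: transition_chart_map chart_inv_map)
  qed
  from frechet_derivative_at[OF this, symmetric] show ?thesis
    using v tangent_space_jacobian[OF v d c]
    by (simp add: differential_def Let_def d_def[symmetric])
qed

text \<open>The coordinate covectors of one chart already separate tangent vectors. This is the
  uniqueness that the description in \<open>fiber_derivative\<close> asks for.\<close>

lemma tangent_space_eq_by_covectors:
  assumes "v \<in> tangent_space A q" "w \<in> tangent_space A q"
    and "\<And>\<sigma>. \<sigma> \<in> cotangent_space A q \<Longrightarrow> \<sigma> v = \<sigma> w"
  shows "v = w"
proof -
  define c where "c = chart_at A q"
  have c: "c \<in> charts_at A q" by (simp add: c_def chart_at_charts_at)
  have "v c $ i = w c $ i" for i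
    using assms(3)[OF coord_covec_cotangent[of c q "axis i 1"]] assms(1,2)
    by (simp add: coord_covec_def inner_axis')
  then show ?thesis
    by (intro tangent_space_eqI[OF assms(1,2) c]) (simp add: vec_eq_iff)
qed

lemma sharp_tangent:
  "riemannian_metric A \<rho> \<Longrightarrow> \<alpha> \<in> cotangent_space A q \<Longrightarrow> sharp A \<rho> q \<alpha> \<in> tangent_space A q"
  using sharp_kinetic_matrix[OF _ chart_at_charts_at] coord_tvec_tangent[OF chart_at_charts_at] by simp

text \<open>Differentiating half of a quadratic form gives back its symmetric bilinear form, so the
  Legendre transformation of a kinetic energy raises the index.\<close>

lemma fiber_derivative_kinetic:
  assumes metric: "riemannian_metric A \<rho>" and \<alpha>: "\<alpha> \<in> cotangent_space A q"
  shows "fiber_derivative A (kinetic A \<rho>) (q, \<alpha>) = sharp A \<rho> q \<alpha>"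
proof -
  define c where "c = chart_at A q"
  have c: "c \<in> charts_at A q" by (simp add: c_def chart_at_charts_at)
  define x where "x = chart_map c q"
  define M where "M = kinetic_matrix A \<rho> c"
  define p where "p = covec_components A c q \<alpha>"
  have sharp: "sharp A \<rho> q \<alpha> = coord_tvec A c q (M x *v p)"
    unfolding M_def x_def p_def by (rule sharp_kinetic_matrix[OF metric c \<alpha>])
  have deriv: "\<sigma> (sharp A \<rho> q \<alpha>) = deriv (\<lambda>s. kinetic A \<rho> (q, \<alpha> + s *\<^sub>R \<sigma>)) 0"
    if \<sigma>: "\<sigma> \<in> cotangent_space A q" for \<sigma>
  proof -
    define r where "r = covec_components A c q \<sigma>"
    have "\<alpha> + s *\<^sub>R \<sigma> \<in> cotangent_space A q" for s
      using subspace_cotangent_space \<alpha> \<sigma> by (simp add: subspace_add subspace_scale)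
    moreover have "covec_components A c q (\<alpha> + s *\<^sub>R \<sigma>) = p + s *\<^sub>R r" for s
      using covec_components_lincomb[of c q 1 \<alpha> s \<sigma>] by (simp add: p_def r_def)
    ultimately have kin: "kinetic A \<rho> (q, \<alpha> + s *\<^sub>R \<sigma>) = 1/2 * ((p + s *\<^sub>R r) \<bullet> (M x *v (p + s *\<^sub>R r)))" for s
      using kinetic_eq[OF metric c] by (simp add: M_def x_def)
    have M: "M differentiable at x" "transpose (M x) = M x"
      unfolding M_def x_def
      using differentiable_kinetic_matrix[OF metric c] transpose_kinetic_matrix[OF metric c] by auto
    have X: "((\<lambda>s. x) has_derivative (\<lambda>h. 0)) (at (0::real))"
      and P: "((\<lambda>s. p + s *\<^sub>R r) has_derivative (\<lambda>h. h *\<^sub>R r)) (at (0::real))"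
      by (auto intro!: derivative_eq_intros)
    have "((\<lambda>s. kinetic A \<rho> (q, \<alpha> + s *\<^sub>R \<sigma>)) has_derivative
        (\<lambda>h. base_part M x (p + 0 *\<^sub>R r) 0 + (M x *v (p + 0 *\<^sub>R r)) \<bullet> (h *\<^sub>R r))) (at 0)"
      unfolding kin by (rule has_derivative_quadratic_form[OF X P M])
    then have "((\<lambda>s. kinetic A \<rho> (q, \<alpha> + s *\<^sub>R \<sigma>)) has_real_derivative r \<bullet> (M x *v p)) (at 0)"
      by (simp add: has_field_derivative_def linear_0[OF linear_base_part[OF M(1)]] inner_commute
          mult_commute_abs)
    from DERIV_imp_deriv[OF this] show ?thesis
      unfolding sharp covec_coord_tvec[OF \<sigma> c] r_def by simp
  qed
  note T = sharp_tangent[OF metric \<alpha>]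
  show ?thesis
    unfolding fiber_derivative_def prod.case
  proof (rule the_equality)
    show "sharp A \<rho> q \<alpha> \<in> tangent_space A q \<and> (\<forall>\<sigma>\<in>cotangent_space A q.
        \<sigma> (sharp A \<rho> q \<alpha>) = deriv (\<lambda>s. kinetic A \<rho> (q, \<alpha> + s *\<^sub>R \<sigma>)) 0)"
      using T deriv by blast
    show "v = sharp A \<rho> q \<alpha>"
      if "v \<in> tangent_space A q \<and> (\<forall>\<sigma>\<in>cotangent_space A q.
        \<sigma> v = deriv (\<lambda>s. kinetic A \<rho> (q, \<alpha> + s *\<^sub>R \<sigma>)) 0)" for v
      using that T deriv tangent_space_eq_by_covectors[of v q "sharp A \<rho> q \<alpha>"] by metis
  qed
qed

text \<open>The homogeneous parts of the bracket, of degree three and one in the momenta.\<close>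

definition cubic_bracket ::
    "('q, 'n) metric \<Rightarrow> ('q, 'n) metric \<Rightarrow> ('q, 'n) chart \<Rightarrow> real^'n \<Rightarrow> real^'n \<Rightarrow> real"
  where "cubic_bracket \<rho>' \<rho> c x p =
    base_part (kinetic_matrix A \<rho>' c) x p (kinetic_matrix A \<rho> c x *v p) -
    base_part (kinetic_matrix A \<rho> c) x p (kinetic_matrix A \<rho>' c x *v p)"

definition linear_bracket ::
    "('q, 'n) metric \<Rightarrow> ('q \<Rightarrow> real) \<Rightarrow> ('q, 'n) metric \<Rightarrow> ('q \<Rightarrow> real) \<Rightarrow> 'q \<Rightarrow> ('q, 'n) covec \<Rightarrow> real"
  where "linear_bracket \<rho>' h' \<rho> h q \<alpha> =
    differential A h' q (sharp A \<rho> q \<alpha>) - differential A h q (sharp A \<rho>' q \<alpha>)"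

section \<open>Simple functions in canonical coordinates\<close>

context
  fixes \<rho> :: "('q, 'n) metric" and h :: "'q \<Rightarrow> real" and c q
  assumes metric: "riemannian_metric A \<rho>" and h: "smooth_function A UNIV h"
    and c: "c \<in> charts_at A q"
begin

lemma simple_hamiltonian_coordinates:
  assumes "y \<in> chart_map c ` chart_dom c"
  shows "(simple_hamiltonian A \<rho> h \<circ> canonical_inv A c) (y, r) =
    1/2 * (r \<bullet> (kinetic_matrix A \<rho> c y *v r)) + (h \<circ> chart_inv c) y"
proof -
  have c': "c \<in> charts_at A (chart_inv c y)"
    using assms charts_atD[OF c] by (auto simp: charts_at_def chart_inv_dom)
  have "chart_map c (chart_inv c y) = y" using assms charts_atD[OF c] by (simp add: chart_map_inv)
  then show ?thesis
    using kinetic_eq[OF metric c' coord_covec_cotangent, of c r]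
    by (simp add: simple_hamiltonian_def canonical_inv_def covec_components_coord_covec[OF c'])
qed

lemma partial_base_simple_hamiltonian:
  "partial i (\<lambda>y. (simple_hamiltonian A \<rho> h \<circ> canonical_inv A c) (y, p)) (chart_map c q) =
    base_part (kinetic_matrix A \<rho> c) (chart_map c q) p (axis i 1) +
    frechet_derivative (h \<circ> chart_inv c) (at (chart_map c q)) (axis i 1)"
proof (rule partial_eq)
  let ?x = "chart_map c q" and ?M = "kinetic_matrix A \<rho> c" and ?f = "h \<circ> chart_inv c"
  note cA = charts_atD[OF c]
  have "((\<lambda>y. 1/2 * (p \<bullet> (?M y *v p))) has_derivative
      (\<lambda>v. base_part ?M ?x p v + (?M ?x *v p) \<bullet> 0)) (at ?x)"
    by (rule has_derivative_quadratic_form[OF has_derivative_ident has_derivative_const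
          differentiable_kinetic_matrix[OF metric c] transpose_kinetic_matrix[OF metric c]])
  from has_derivative_add[OF this smooth_function_has_derivative[OF h open_UNIV UNIV_I c]]
  have "((\<lambda>y. 1/2 * (p \<bullet> (?M y *v p)) + ?f y) has_derivative
      (\<lambda>v. base_part ?M ?x p v + frechet_derivative ?f (at ?x) v)) (at ?x)"
    by (simp only: inner_zero_right add_0_right)
  \<comment> \<open>The coordinate expression of the function holds for \<open>y\<close> in the
    range of the chart; this range is open, so the derivative at \<open>?x\<close> is the
    same.\<close>
  then show "((\<lambda>y. (simple_hamiltonian A \<rho> h \<circ> canonical_inv A c) (y, p)) has_derivative
      (\<lambda>v. base_part ?M ?x p v + frechet_derivative ?f (at ?x) v)) (at ?x)"
    by (rule has_derivative_transform_within_open[OF _ open_chart_range[OF cA(1)]])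
      (use cA(2) in \<open>auto simp: simple_hamiltonian_coordinates simp del: comp_apply\<close>)
qed

lemma partial_fiber_simple_hamiltonian:
  "partial i (\<lambda>r. (simple_hamiltonian A \<rho> h \<circ> canonical_inv A c) (chart_map c q, r)) p =
    (kinetic_matrix A \<rho> c (chart_map c q) *v p) $ i"
proof -
  let ?x = "chart_map c q" and ?M = "kinetic_matrix A \<rho> c" and ?f = "h \<circ> chart_inv c"
  have eq: "(simple_hamiltonian A \<rho> h \<circ> canonical_inv A c) (?x, r) = 1/2 * (r \<bullet> (?M ?x *v r)) + ?f ?x" for r
    using charts_atD[OF c] by (simp add: simple_hamiltonian_coordinates del: comp_apply)
  have M: "?M differentiable at ?x"
    by (rule differentiable_kinetic_matrix[OF metric c])
  have "((\<lambda>r. 1/2 * (r \<bullet> (?M ?x *v r))) has_derivative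
      (\<lambda>v. base_part ?M ?x p 0 + (?M ?x *v p) \<bullet> v)) (at p)"
    by (rule has_derivative_quadratic_form[OF has_derivative_const has_derivative_ident M
          transpose_kinetic_matrix[OF metric c]])
  from has_derivative_add_const[OF this, of "?f ?x"]
  have "partial i (\<lambda>r. (simple_hamiltonian A \<rho> h \<circ> canonical_inv A c) (?x, r)) p =
      base_part ?M ?x p 0 + (?M ?x *v p) \<bullet> axis i 1"
    unfolding eq by (rule partial_eq)
  then show ?thesis by (simp add: linear_0[OF linear_base_part[OF M]] inner_axis)
qed

end

lemma linear_bracket_eq:
  assumes "riemannian_metric A \<rho>" "riemannian_metric A \<rho>'"
    and "smooth_function A UNIV h" "smooth_function A UNIV h'"
    and c: "c \<in> charts_at A q" and \<alpha>: "\<alpha> \<in> cotangent_space A q"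
  shows "linear_bracket \<rho>' h' \<rho> h q \<alpha> =
    frechet_derivative (h' \<circ> chart_inv c) (at (chart_map c q))
      (kinetic_matrix A \<rho> c (chart_map c q) *v covec_components A c q \<alpha>) -
    frechet_derivative (h \<circ> chart_inv c) (at (chart_map c q))
      (kinetic_matrix A \<rho>' c (chart_map c q) *v covec_components A c q \<alpha>)"
  using differential_eq[OF assms(3) open_UNIV UNIV_I c sharp_tangent[OF assms(2) \<alpha>]]
    differential_eq[OF assms(4) open_UNIV UNIV_I c sharp_tangent[OF assms(1) \<alpha>]]
  unfolding linear_bracket_def
  by (simp add: sharp_kinetic_matrix[OF assms(1) c \<alpha>] sharp_kinetic_matrix[OF assms(2) c \<alpha>]
      coord_tvec_component[OF c])

text \<open>The chart is the one selected inside \<open>poisson\<close>. It is left existential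
  here, and \<open>poisson_eq\<close> replaces it by an arbitrary one once the cubic part is known
  to be invariant.\<close>

lemma poisson_simple_hamiltonian:
  assumes m: "riemannian_metric A \<rho>" "riemannian_metric A \<rho>'"
    and h: "smooth_function A UNIV h" "smooth_function A UNIV h'"
    and \<alpha>: "\<alpha> \<in> cotangent_space A q"
  shows "\<exists>c\<in>charts_at A q. poisson A (simple_hamiltonian A \<rho>' h') (simple_hamiltonian A \<rho> h) (q, \<alpha>) =
    cubic_bracket \<rho>' \<rho> c (chart_map c q) (covec_components A c q \<alpha>) + linear_bracket \<rho>' h' \<rho> h q \<alpha>"
proof
  define c where "c = chart_at A q"
  show "chart_at A q \<in> charts_at A q" by (rule chart_at_charts_at)
  then have c: "c \<in> charts_at A q" by (simp add: c_def)
  let ?x = "chart_map c q" and ?p = "covec_components A c q \<alpha>"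
  let ?M = "kinetic_matrix A \<rho> c" and ?M' = "kinetic_matrix A \<rho>' c"
  let ?D = "frechet_derivative (h \<circ> chart_inv c) (at ?x)"
  let ?D' = "frechet_derivative (h' \<circ> chart_inv c) (at ?x)"
  \<comment> \<open>The base partial derivatives are values of linear forms at unit vectors;
    contracting them with a fiber derivative \<open>w\<close> evaluates the forms at
    \<open>w\<close>.\<close>
  have sum: "(\<Sum>i\<in>UNIV. (f (axis i 1) + g (axis i 1)) * w $ i) = f w + g w"
    if "linear f" "linear g" for f g :: "real^'n \<Rightarrow> real" and w
    unfolding linear_eq_inner_axis[OF that(1), of w] linear_eq_inner_axis[OF that(2), of w] inner_vec_def
    by (simp add: sum.distrib[symmetric] distrib_right)
  have lin: "linear (base_part ?M ?x ?p)" "linear (base_part ?M' ?x ?p)" "linear ?D" "linear ?D'"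
    using m[THEN differentiable_kinetic_matrix[OF _ c]] h[THEN smooth_function_has_derivative[OF _ open_UNIV UNIV_I c]]
    by (auto intro: linear_base_part has_derivative_linear)
  have "poisson A (simple_hamiltonian A \<rho>' h') (simple_hamiltonian A \<rho> h) (q, \<alpha>) =
      (base_part ?M' ?x ?p (?M ?x *v ?p) + ?D' (?M ?x *v ?p)) -
      (base_part ?M ?x ?p (?M' ?x *v ?p) + ?D (?M' ?x *v ?p))"
    unfolding poisson_def prod.case Let_def c_def[symmetric] poisson_in_coordinates_def
      partial_base_simple_hamiltonian[OF m(1) h(1) c] partial_base_simple_hamiltonian[OF m(2) h(2) c]
      partial_fiber_simple_hamiltonian[OF m(1) h(1) c] partial_fiber_simple_hamiltonian[OF m(2) h(2) c]
      sum_subtractf sum[OF lin(1,3)] sum[OF lin(2,4)] ..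
  then show "poisson A (simple_hamiltonian A \<rho>' h') (simple_hamiltonian A \<rho> h) (q, \<alpha>) =
    cubic_bracket \<rho>' \<rho> (chart_at A q) (chart_map (chart_at A q) q) (covec_components A (chart_at A q) q \<alpha>) +
    linear_bracket \<rho>' h' \<rho> h q \<alpha>"
    unfolding c_def[symmetric] linear_bracket_eq[OF m h c \<alpha>] cubic_bracket_def by simp
qed

section \<open>Independence of the chart\<close>

text \<open>Extend the covector to the field with constant components \<open>r\<close> in
  \<open>d\<close>, and differentiate its kinetic energy as computed in either chart. In
  \<open>c\<close> its components \<open>P\<close> vary through the Jacobian, which contributes the
  second derivative of the transition map.\<close>

lemma base_part_chart_change:
  assumes metric: "riemannian_metric A \<rho>"
    and c: "c \<in> charts_at A q" and d: "d \<in> charts_at A q" and \<alpha>: "\<alpha> \<in> cotangent_space A q"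
  shows "base_part (kinetic_matrix A \<rho> d) (chart_map d q) (covec_components A d q \<alpha>) (jacobian c d q v) =
    base_part (kinetic_matrix A \<rho> c) (chart_map c q) (covec_components A c q \<alpha>) v +
    covec_components A d q \<alpha> \<bullet> frechet_derivative (\<lambda>x. frechet_derivative (transition c d) (at x) v)
      (at (chart_map c q)) (kinetic_matrix A \<rho> c (chart_map c q) *v covec_components A c q \<alpha>)"
proof -
  note cA = charts_atD[OF c] and dA = charts_atD[OF d]
  define x where "x = chart_map c q"
  define U where "U = chart_map c ` (chart_dom c \<inter> chart_dom d)"
  have U: "open U" "x \<in> U"
    using open_chart_image[OF cA(1) open_chart_dom[OF dA(1)]] cA dA by (auto simp: U_def x_def)
  define J where "J y = frechet_derivative (transition c d) (at y)" for y
  define D2 where "D2 w = frechet_derivative (\<lambda>y. J y w) (at x)" for w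
  define p where "p = covec_components A c q \<alpha>"
  define r where "r = covec_components A d q \<alpha>"
  define M where "M = kinetic_matrix A \<rho> c"
  define N where "N = kinetic_matrix A \<rho> d"
  define P where "P y = (\<chi> i. r \<bullet> J y (axis i 1))" for y
  have trans: "smooth_on U (transition c d)"
    unfolding U_def by (rule smooth_on_transition[OF cA(1) dA(1)])
  have J: "((\<lambda>y. J y w) has_derivative D2 w) (at x)" for w
    unfolding J_def D2_def
    by (rule smooth_on_has_derivative[OF smooth_on_frechet_derivative[OF trans] U(2)])
  have D2_sym: "D2 v w = D2 w v" for v w
    unfolding J_def D2_def by (rule symmetric_second_derivative[OF U trans])
  have Px: "P x = p"
    unfolding P_def p_def r_def J_def x_def
    using covec_components_change[OF c d \<alpha>] by (simp add: jacobian_def)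
  have kin: "1/2 * (r \<bullet> (N (transition c d y) *v r)) = 1/2 * (P y \<bullet> (M y *v P y))" if y: "y \<in> U" for y
  proof -
    obtain q' where q': "q' \<in> chart_dom c" "q' \<in> chart_dom d" "y = chart_map c q'"
      using y by (auto simp: U_def)
    have c': "c \<in> charts_at A q'" and d': "d \<in> charts_at A q'"
      using q' cA dA by (auto intro: charts_atI)
    let ?\<beta> = "coord_covec A d q' r"
    have \<beta>: "?\<beta> \<in> cotangent_space A q'" by (rule coord_covec_cotangent)
    have "covec_components A c q' ?\<beta> = P y"
      using covec_components_change[OF c' d' \<beta>]
      by (simp add: covec_components_coord_covec[OF d'] P_def J_def q' jacobian_def)
    then show ?thesis
      using kinetic_eq[OF metric c' \<beta>] kinetic_eq[OF metric d' \<beta>]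
      by (simp add: M_def N_def q' transition_chart_map[OF cA(1)] covec_components_coord_covec[OF d'])
  qed
  have dP: "(P has_derivative (\<lambda>v. \<chi> i. r \<bullet> D2 (axis i 1) v)) (at x)"
  proof -
    have *: "((\<lambda>y. r \<bullet> J y w) has_derivative (\<lambda>v. r \<bullet> D2 w v)) (at x)" for w
      by (rule bounded_linear.has_derivative[OF bounded_linear_inner_right J])
    have "(\<lambda>y. P y \<bullet> b) = (\<lambda>y. r \<bullet> J y b) \<and> (\<lambda>v. (\<chi> i. r \<bullet> D2 (axis i 1) v) \<bullet> b) = (\<lambda>v. r \<bullet> D2 b v)"
      if "b \<in> Basis" for b
      using that by (auto simp: P_def Basis_vec_def inner_axis)
    with * show ?thesis
      by (subst has_derivative_componentwise_within) auto
  qed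
  have Mx: "M differentiable at x" "transpose (M x) = M x"
    unfolding M_def x_def
    using differentiable_kinetic_matrix[OF metric c] transpose_kinetic_matrix[OF metric c] by auto
  have tx: "transition c d x = chart_map d q"
    unfolding x_def by (rule transition_chart_map[OF cA])
  have Nx: "N differentiable at (transition c d x)" "transpose (N (transition c d x)) = N (transition c d x)"
    unfolding N_def tx
    using differentiable_kinetic_matrix[OF metric d] transpose_kinetic_matrix[OF metric d] by auto
  have tr: "(transition c d has_derivative J x) (at x)"
    unfolding J_def by (rule smooth_on_has_derivative[OF trans U(2)])
  have "((\<lambda>y. 1/2 * (P y \<bullet> (M y *v P y))) has_derivative
      (\<lambda>v. base_part M x (P x) v + (M x *v P x) \<bullet> (\<chi> i. r \<bullet> D2 (axis i 1) v))) (at x)"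
    by (rule has_derivative_quadratic_form[OF has_derivative_ident dP Mx])
  then have 1: "((\<lambda>y. 1/2 * (r \<bullet> (N (transition c d y) *v r))) has_derivative
      (\<lambda>v. base_part M x (P x) v + (M x *v P x) \<bullet> (\<chi> i. r \<bullet> D2 (axis i 1) v))) (at x)"
    by (rule has_derivative_transform_within_open[OF _ U]) (rule kin[symmetric])
  have 2: "((\<lambda>y. 1/2 * (r \<bullet> (N (transition c d y) *v r))) has_derivative
      (\<lambda>v. base_part N (transition c d x) r (J x v) + (N (transition c d x) *v r) \<bullet> 0)) (at x)"
    by (rule has_derivative_quadratic_form[OF tr has_derivative_const Nx])
  have "base_part N (transition c d x) r (J x v) = base_part M x p v + (M x *v p) \<bullet> (\<chi> i. r \<bullet> D2 (axis i 1) v)"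
    using fun_cong[OF has_derivative_unique[OF 1 2], of v] by (simp add: Px)
  \<comment> \<open>Being a derivative, \<open>D2\<close> is linear in its second argument; symmetry
    moves the contracted index there.\<close>
  also have "(M x *v p) \<bullet> (\<chi> i. r \<bullet> D2 (axis i 1) v) = r \<bullet> D2 v (M x *v p)"
  proof -
    have "linear (\<lambda>w. r \<bullet> D2 v w)"
      using bounded_linear.has_derivative[OF bounded_linear_inner_right J]
      by (rule has_derivative_linear)
    from linear_eq_inner_axis[OF this, of "M x *v p"] show ?thesis
      unfolding D2_sym[of v "axis _ 1"] by (simp add: inner_commute)
  qed
  finally show ?thesis
    unfolding tx unfolding N_def M_def J_def D2_def x_def p_def r_def jacobian_def .
qed

text \<open>By symmetry of the second derivative of the transition map, its contributions cancel.\<close>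

lemma cubic_bracket_chart_change:
  assumes m: "riemannian_metric A \<rho>" "riemannian_metric A \<rho>'"
    and c: "c \<in> charts_at A q" and d: "d \<in> charts_at A q" and \<alpha>: "\<alpha> \<in> cotangent_space A q"
  shows "cubic_bracket \<rho>' \<rho> c (chart_map c q) (covec_components A c q \<alpha>) =
    cubic_bracket \<rho>' \<rho> d (chart_map d q) (covec_components A d q \<alpha>)"
proof -
  note cA = charts_atD[OF c] and dA = charts_atD[OF d]
  let ?U = "chart_map c ` (chart_dom c \<inter> chart_dom d)"
  have U: "open ?U" "chart_map c q \<in> ?U"
    using open_chart_image[OF cA(1) open_chart_dom[OF dA(1)]] cA dA by auto
  \<comment> \<open>The tangent vector \<open>sharp A \<rho> q \<alpha>\<close> has a matrix
    expression in each chart; comparing its components in \<open>d\<close> brings in the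
    Jacobian.\<close>
  have jac: "kinetic_matrix A \<rho> d (chart_map d q) *v covec_components A d q \<alpha> =
      jacobian c d q (kinetic_matrix A \<rho> c (chart_map c q) *v covec_components A c q \<alpha>)"
    if "riemannian_metric A \<rho>" for \<rho>
    using fun_cong[OF trans[OF sharp_kinetic_matrix[OF that d \<alpha>, symmetric]
          sharp_kinetic_matrix[OF that c \<alpha>]], of d] d
    unfolding coord_tvec_component[OF d] by (simp add: coord_tvec_eq)
  show ?thesis
    unfolding cubic_bracket_def jac[OF m(1)] jac[OF m(2)] base_part_chart_change[OF m(1) c d \<alpha>]
      base_part_chart_change[OF m(2) c d \<alpha>]
    using symmetric_second_derivative[OF U smooth_on_transition[OF cA(1) dA(1)]] by simp
qed

section \<open>The index expressions of item 3\<close>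

text \<open>Contracting \<open>k\<close> and \<open>l\<close> first evaluates the derivative of one
  matrix at the vector raised by the other; the sum over \<open>i\<close> and \<open>j\<close> is
  then a quadratic form. The factor 2 makes up for the 1/2 contained in
  \<open>base_part\<close>.\<close>

lemma cubic_bracket_sum:
  assumes m: "riemannian_metric A \<rho>" "riemannian_metric A \<rho>'"
    and c: "c \<in> charts_at A q" and x: "x = chart_map c q"
  shows "(\<Sum>i\<in>UNIV. \<Sum>j\<in>UNIV. \<Sum>k\<in>UNIV. \<Sum>l\<in>UNIV.
      (partial k (\<lambda>y. kinetic_matrix A \<rho>' c y $ i $ j) x * kinetic_matrix A \<rho> c x $ k $ l -
       partial k (\<lambda>y. kinetic_matrix A \<rho> c y $ i $ j) x * kinetic_matrix A \<rho>' c x $ k $ l) *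
      p $ i * p $ j * p $ l) = 2 * cubic_bracket \<rho>' \<rho> c x p"
proof -
  have D: "(kinetic_matrix A \<rho> c has_derivative frechet_derivative (kinetic_matrix A \<rho> c) (at x)) (at x)"
    if "riemannian_metric A \<rho>" for \<rho>
    unfolding x using differentiable_kinetic_matrix[OF that c] frechet_derivative_works by blast
  have partial: "partial k (\<lambda>y. kinetic_matrix A \<rho> c y $ i $ j) x =
      frechet_derivative (kinetic_matrix A \<rho> c) (at x) (axis k 1) $ i $ j"
    if "riemannian_metric A \<rho>" for \<rho> i j k
    by (rule partial_eq, intro bounded_linear.has_derivative[OF bounded_linear_vec_nth] D[OF that])
  have half: "(\<Sum>i\<in>UNIV. \<Sum>j\<in>UNIV. \<Sum>k\<in>UNIV. \<Sum>l\<in>UNIV.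
      partial k (\<lambda>y. kinetic_matrix A \<rho> c y $ i $ j) x * N $ k $ l * p $ i * p $ j * p $ l) =
      2 * base_part (kinetic_matrix A \<rho> c) x p (N *v p)"
    if "riemannian_metric A \<rho>" for \<rho> and N :: "real^'n^'n"
  proof -
    let ?D = "frechet_derivative (kinetic_matrix A \<rho> c) (at x)"
    have "linear (\<lambda>v. ?D v $ i $ j)" for i j
      by (intro linear_compose[unfolded o_def, of ?D "\<lambda>M. M $ i $ j"] has_derivative_linear[OF D[OF that]]
          linearI) simp_all
    from linear_eq_inner_axis[OF this, where x = "N *v p"]
    have *: "(\<Sum>k\<in>UNIV. \<Sum>l\<in>UNIV. ?D (axis k 1) $ i $ j * N $ k $ l * p $ l) = ?D (N *v p) $ i $ j" for i j
      by (simp add: inner_vec_def matrix_vector_mult_def sum_distrib_left mult.assoc)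
    have "(\<Sum>k\<in>UNIV. \<Sum>l\<in>UNIV. ?D (axis k 1) $ i $ j * N $ k $ l * p $ i * p $ j * p $ l) =
        p $ i * ?D (N *v p) $ i $ j * p $ j" for i j
      unfolding *[symmetric] sum_distrib_left sum_distrib_right by (simp add: mult_ac)
    then show ?thesis
      unfolding partial[OF that] base_part_def by (simp add: quadratic_form_sum)
  qed
  show ?thesis
    unfolding left_diff_distrib sum_subtractf half[OF m(1)] half[OF m(2)] cubic_bracket_def
    by simp
qed

lemma linear_bracket_sum:
  assumes m: "riemannian_metric A \<rho>" "riemannian_metric A \<rho>'"
    and h: "smooth_function A UNIV h" "smooth_function A UNIV h'"
    and c: "c \<in> charts_at A q" and \<alpha>: "\<alpha> \<in> cotangent_space A q"
  shows "(\<Sum>k\<in>UNIV. \<Sum>l\<in>UNIV.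
      (partial k (h' \<circ> chart_inv c) (chart_map c q) * kinetic_matrix A \<rho> c (chart_map c q) $ k $ l -
       partial k (h \<circ> chart_inv c) (chart_map c q) * kinetic_matrix A \<rho>' c (chart_map c q) $ k $ l) *
      covec_components A c q \<alpha> $ l) = linear_bracket \<rho>' h' \<rho> h q \<alpha>"
proof -
  let ?x = "chart_map c q" and ?p = "covec_components A c q \<alpha>"
  have half: "(\<Sum>k\<in>UNIV. \<Sum>l\<in>UNIV. partial k (h \<circ> chart_inv c) ?x * N $ k $ l * ?p $ l) =
      frechet_derivative (h \<circ> chart_inv c) (at ?x) (N *v ?p)"
    if "smooth_function A UNIV h" for h and N :: "real^'n^'n"
  proof -
    note D = smooth_function_has_derivative[OF that open_UNIV UNIV_I c]
    show ?thesis
      unfolding partial_eq[OF D] linear_eq_inner_axis[OF has_derivative_linear[OF D], of "N *v ?p"]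
      by (simp add: inner_vec_def matrix_vector_mult_def sum_distrib_left mult.assoc)
  qed
  show ?thesis
    unfolding left_diff_distrib sum_subtractf half[OF h(1)] half[OF h(2)] linear_bracket_eq[OF m h c \<alpha>] ..
qed

end

section \<open>Linear differential equations\<close>

text \<open>The Picard operator is turned into a self-map of the bounded continuous functions on the
  whole line by freezing the integral outside of \<^term>\<open>{-\<epsilon>..\<epsilon>}\<close>.\<close>

lemma picard_lipschitz:
  fixes F :: "real \<Rightarrow> 'a::euclidean_space \<Rightarrow> 'a"
  assumes \<delta>: "\<delta> > 0" and K: "K \<ge> 0"
    and cont: "\<And>\<phi>. continuous_on {-\<delta>..\<delta>} \<phi> \<Longrightarrow> continuous_on {-\<delta>..\<delta>} (\<lambda>t. F t (\<phi> t))"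
    and lip: "\<And>t p q. t \<in> {-\<delta>..\<delta>} \<Longrightarrow> norm (F t p - F t q) \<le> K * norm (p - q)"
  shows "\<exists>\<epsilon>>0. \<epsilon> \<le> \<delta> \<and> (\<exists>p. p 0 = p0 \<and>
    (\<forall>t\<in>{-\<epsilon><..<\<epsilon>}. (p has_vector_derivative F t (p t)) (at t)))"
proof -
  \<comment> \<open>The integrals up to \<open>t\<close> and up to 0 both start at
    \<open>-\<epsilon>\<close> and have length at most \<open>2 * \<epsilon>\<close>, so the
    operator has Lipschitz constant \<open>4 * \<epsilon> * K\<close>. The 8 brings this below 1/2,
    and \<open>K + 1\<close> avoids division by zero.\<close>
  define \<epsilon> where "\<epsilon> = min \<delta> (1 / (8 * (K + 1)))"
  have \<epsilon>: "\<epsilon> > 0" "\<epsilon> \<le> \<delta>" using \<delta> K by (auto simp: \<epsilon>_def)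
  have "4 * \<epsilon> * K \<le> 4 * (1 / (8 * (K + 1))) * K"
    using K by (intro mult_right_mono mult_left_mono) (auto simp: \<epsilon>_def)
  also have "\<dots> \<le> 1 / 2" using K by (simp add: field_simps)
  finally have small: "4 * \<epsilon> * K \<le> 1 / 2" .
  \<comment> \<open>For negative \<open>t\<close> the interval \<open>{0..t}\<close> is empty.
    Integrating from \<open>-\<epsilon>\<close> and subtracting \<open>g \<phi> 0\<close> gives the
    oriented integral from 0.\<close>
  define g where "g \<phi> t = integral {-\<epsilon>..t} (\<lambda>s. F s (\<phi> s))" for \<phi> t
  define cl where "cl t = max (-\<epsilon>) (min \<epsilon> t)" for t :: real
  define G where "G \<phi> t = p0 + (g \<phi> (cl t) - g \<phi> 0)" for \<phi> t
  have cl: "cl t \<in> {-\<epsilon>..\<epsilon>}" for t using \<epsilon> by (auto simp: cl_def)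
  have cl_id: "cl t = t" if "t \<in> {-\<epsilon>..\<epsilon>}" for t using that by (auto simp: cl_def)
  have contF: "continuous_on {-\<epsilon>..\<epsilon>} (\<lambda>t. F t (\<phi> t))" if "continuous_on UNIV \<phi>" for \<phi>
    by (rule continuous_on_subset[OF cont[OF continuous_on_subset[OF that subset_UNIV]]])
      (use \<epsilon> in auto)
  have contg: "continuous_on {-\<epsilon>..\<epsilon>} (g \<phi>)" if "continuous_on UNIV \<phi>" for \<phi>
    unfolding g_def by (intro indefinite_integral_continuous_1 integrable_continuous_real contF that)
  have G: "G \<phi> \<in> bcontfun" if \<phi>: "continuous_on UNIV \<phi>" for \<phi>
  proof -
    have 1: "continuous_on UNIV cl" unfolding cl_def by (intro continuous_intros)
    have 2: "cl ` UNIV \<subseteq> {-\<epsilon>..\<epsilon>}" using cl by auto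
    have "continuous_on UNIV (\<lambda>t. g \<phi> (cl t))"
      by (rule continuous_on_compose2[OF contg[OF \<phi>] 1 2])
    then have "continuous_on UNIV (G \<phi>)" unfolding G_def by (intro continuous_intros)
    moreover have "bounded (range (G \<phi>))"
    proof (rule bounded_subset)
      show "bounded ((\<lambda>t. p0 + (g \<phi> t - g \<phi> 0)) ` {-\<epsilon>..\<epsilon>})"
        by (intro compact_imp_bounded compact_continuous_image continuous_intros contg[OF \<phi>] compact_Icc)
      show "range (G \<phi>) \<subseteq> (\<lambda>t. p0 + (g \<phi> t - g \<phi> 0)) ` {-\<epsilon>..\<epsilon>}"
        using cl by (auto simp: G_def)
    qed
    ultimately show ?thesis by (simp add: bcontfun_def)
  qed
  define T where "T \<phi> = Bcontfun (G (apply_bcontfun \<phi>))" for \<phi> :: "real \<Rightarrow>\<^sub>C 'a"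
  have T: "apply_bcontfun (T \<phi>) = G (apply_bcontfun \<phi>)" for \<phi>
    unfolding T_def by (rule Bcontfun_inverse[OF G]) simp
  have "dist (T \<phi>) (T \<psi>) \<le> 1/2 * dist \<phi> \<psi>" for \<phi> \<psi>
  proof (rule dist_bound)
    fix t
    have bound: "norm (g \<phi> t - g \<psi> t) \<le> K * dist \<phi> \<psi> * (2 * \<epsilon>)" if t: "t \<in> {-\<epsilon>..\<epsilon>}" for t
    proof -
      have c: "continuous_on {-\<epsilon>..t} (\<lambda>s. F s (apply_bcontfun \<phi> s))" for \<phi> :: "real \<Rightarrow>\<^sub>C 'a"
        using t by (intro continuous_on_subset[OF contF]) auto
      have "g \<phi> t - g \<psi> t = integral {-\<epsilon>..t} (\<lambda>s. F s (\<phi> s) - F s (\<psi> s))"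
        unfolding g_def by (intro Henstock_Kurzweil_Integration.integral_diff[symmetric]
            integrable_continuous_real c)
      also have "norm \<dots> \<le> (K * dist \<phi> \<psi>) * (t - -\<epsilon>)"
      proof (rule integral_bound)
        fix s assume s: "s \<in> {-\<epsilon>..t}"
        have "norm (F s (\<phi> s) - F s (\<psi> s)) \<le> K * norm (\<phi> s - \<psi> s)"
          using s t \<epsilon> by (intro lip) auto
        also have "\<dots> \<le> K * dist \<phi> \<psi>"
          using dist_bounded[of \<phi> s \<psi>] K by (intro mult_left_mono) (auto simp: dist_norm)
        finally show "norm (F s (\<phi> s) - F s (\<psi> s)) \<le> K * dist \<phi> \<psi>" .
      qed (use t in \<open>auto intro!: continuous_on_diff c\<close>)
      also have "\<dots> \<le> K * dist \<phi> \<psi> * (2 * \<epsilon>)"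
        using t K by (intro mult_left_mono) auto
      finally show ?thesis .
    qed
    have "dist (T \<phi> t) (T \<psi> t) = norm ((g \<phi> (cl t) - g \<psi> (cl t)) - (g \<phi> 0 - g \<psi> 0))"
      unfolding T G_def dist_norm by (simp add: algebra_simps)
    also have "\<dots> \<le> K * dist \<phi> \<psi> * (2 * \<epsilon>) + K * dist \<phi> \<psi> * (2 * \<epsilon>)"
      by (rule order_trans[OF norm_triangle_ineq4 add_mono[OF bound[OF cl] bound]]) (use \<epsilon> in auto)
    also have "\<dots> = 4 * \<epsilon> * K * dist \<phi> \<psi>" by simp
    also have "\<dots> \<le> 1/2 * dist \<phi> \<psi>" using small by (intro mult_right_mono) auto
    finally show "dist (T \<phi> t) (T \<psi> t) \<le> 1/2 * dist \<phi> \<psi>" .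
  qed
  then have "\<exists>!\<phi>. T \<phi> = \<phi>"
    by (intro banach_fix_type[of "1/2"]) auto
  then obtain \<phi> where \<phi>: "T \<phi> = \<phi>" by blast
  have eq: "\<phi> t = p0 + (g \<phi> t - g \<phi> 0)" if "t \<in> {-\<epsilon>..\<epsilon>}" for t
    using fun_cong[OF T[of \<phi>], of t] cl_id[OF that] unfolding \<phi> G_def by simp
  have "(\<phi> has_vector_derivative F t (\<phi> t)) (at t)" if t: "t \<in> {-\<epsilon><..<\<epsilon>}" for t
  proof -
    have "(g \<phi> has_vector_derivative F t (\<phi> t)) (at t within {-\<epsilon>..\<epsilon>})"
      unfolding g_def using t by (intro integral_has_vector_derivative contF) auto
    moreover have "at t within {-\<epsilon>..\<epsilon>} = at t"
      using t by (intro at_within_interior) auto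
    ultimately have "((\<lambda>t. p0 + (g \<phi> t - g \<phi> 0)) has_vector_derivative F t (\<phi> t)) (at t)"
      by (auto intro!: derivative_eq_intros)
    then show ?thesis
      by (rule has_vector_derivative_transform_within_open[of _ _ _ "{-\<epsilon><..<\<epsilon>}"])
        (use t in \<open>auto simp: eq\<close>)
  qed
  moreover have "\<phi> 0 = p0" using eq[of 0] \<epsilon> by simp
  ultimately show ?thesis using \<epsilon> by blast
qed

text \<open>On the compact interval each \<open>B j\<close> is bounded. As a norm is at most the sum
  of the absolute values of the components, the sum of these bounds is a Lipschitz constant for the
  right-hand side.\<close>

lemma linear_ode_solution:
  fixes B :: "'n::finite \<Rightarrow> real \<Rightarrow> real^'n"
  assumes \<delta>: "\<delta> > 0" and B: "\<And>j. continuous_on {-\<delta>..\<delta>} (B j)"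
  shows "\<exists>\<epsilon>>0. \<epsilon> \<le> \<delta> \<and> (\<exists>p. p 0 = p0 \<and>
    (\<forall>t\<in>{-\<epsilon><..<\<epsilon>}. (p has_vector_derivative (\<chi> j. p t \<bullet> B j t)) (at t)))"
proof -
  have "\<exists>K. \<forall>t\<in>{-\<delta>..\<delta>}. norm (B j t) \<le> K" for j
    using compact_imp_bounded[OF compact_continuous_image[OF B compact_Icc]]
    unfolding bounded_iff by auto
  then obtain K where K: "\<And>j t. t \<in> {-\<delta>..\<delta>} \<Longrightarrow> norm (B j t) \<le> K j" by metis
  have K0: "K j \<ge> 0" for j using order_trans[OF norm_ge_zero K[of 0 j]] \<delta> by simp
  show ?thesis
  proof (rule picard_lipschitz[OF \<delta>, where K = "\<Sum>j\<in>UNIV. K j"])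
    show "continuous_on {-\<delta>..\<delta>} (\<lambda>t. \<chi> j. \<phi> t \<bullet> B j t)" if "continuous_on {-\<delta>..\<delta>} \<phi>" for \<phi>
      by (intro continuous_intros that B)
    show "norm ((\<chi> j. p \<bullet> B j t) - (\<chi> j. q \<bullet> B j t)) \<le> (\<Sum>j\<in>UNIV. K j) * norm (p - q)"
      if t: "t \<in> {-\<delta>..\<delta>}" for t p q
    proof -
      have "norm ((\<chi> j. p \<bullet> B j t) - (\<chi> j. q \<bullet> B j t)) \<le> (\<Sum>j\<in>UNIV. \<bar>(p - q) \<bullet> B j t\<bar>)"
        using norm_le_l1_cart[of "(\<chi> j. p \<bullet> B j t) - (\<chi> j. q \<bullet> B j t)"]
        by (simp add: inner_diff_left)
      also have "\<dots> \<le> (\<Sum>j\<in>UNIV. K j * norm (p - q))"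
      proof (rule sum_mono)
        fix j
        have "\<bar>(p - q) \<bullet> B j t\<bar> \<le> norm (p - q) * norm (B j t)" by (rule Cauchy_Schwarz_ineq2)
        also have "\<dots> \<le> norm (p - q) * K j" using K[OF t] by (intro mult_left_mono) auto
        finally show "\<bar>(p - q) \<bullet> B j t\<bar> \<le> K j * norm (p - q)" by (simp add: mult.commute)
      qed
      finally show ?thesis by (simp add: sum_distrib_right)
    qed
  qed (simp add: K0 sum_nonneg)
qed

text \<open>Bootstrapping: the equation expresses the derivative through \<open>p\<close> itself, so
  each order of smoothness of \<open>p\<close> passes to its derivative and yields the next
  order.\<close>

lemma linear_ode_smooth:
  fixes B :: "'n::finite \<Rightarrow> real \<Rightarrow> real^'n"
  assumes S: "open S" and B: "\<And>j. smooth_on S (B j)"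
    and p: "\<And>t. t \<in> S \<Longrightarrow> (p has_vector_derivative (\<chi> j. p t \<bullet> B j t)) (at t)"
  shows "smooth_on S p"
  unfolding smooth_on_def
proof
  fix k
  show "k_smooth_on k S p"
  proof (induction k)
    case 0
    then show ?case
      using p by (auto intro!: continuous_at_imp_continuous_on intro: has_vector_derivative_continuous)
  next
    case (Suc k)
    have "k_smooth_on k S (\<lambda>t. \<chi> j. p t \<bullet> B j t)"
      using B by (intro k_smooth_on_vecI S)
        (simp add: bounded_bilinear.k_smooth_on[OF bounded_bilinear_inner S Suc] smooth_on_def)
    then show ?case
      using p unfolding has_vector_derivative_def
      by (intro k_smooth_on_SucI[OF S, where D = "\<lambda>t h. h *\<^sub>R (\<chi> j. p t \<bullet> B j t)"]
          k_smooth_on_linear_compose[OF S bounded_linear_scaleR_right]) auto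
  qed
qed

section \<open>Connections in charts\<close>

context smooth_manifold
begin

section \<open>Smoothness checked in a single chart\<close>

lemma smooth_on_transition_compose:
  assumes c: "c \<in> A" and d: "d \<in> A" and W: "open W" "W \<subseteq> chart_dom c"
    and g: "smooth_on (chart_map c ` W) g"
  shows "smooth_on (chart_map d ` (chart_dom d \<inter> W)) (\<lambda>y. g (transition d c y))"
proof (rule smooth_on_compose[OF open_chart_image[OF d W(1)] _ g])
  show "transition d c ` chart_map d ` (chart_dom d \<inter> W) \<subseteq> chart_map c ` W"
    using W(2) by (auto simp: transition_chart_map[OF d])
  show "smooth_on (chart_map d ` (chart_dom d \<inter> W)) (transition d c)"
    using W(2) by (intro smooth_on_subset[OF smooth_on_transition[OF d c]]) auto
qed

lemma smooth_functionI:
  assumes c: "c \<in> A" and W: "open W" "W \<subseteq> chart_dom c"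
    and f: "smooth_on (chart_map c ` W) (f \<circ> chart_inv c)"
  shows "smooth_function A W f"
  unfolding smooth_function_def
proof
  fix d assume d: "d \<in> A"
  have "smooth_on (chart_map d ` (chart_dom d \<inter> W)) (f \<circ> chart_inv d) \<longleftrightarrow>
      smooth_on (chart_map d ` (chart_dom d \<inter> W)) (\<lambda>y. (f \<circ> chart_inv c) (transition d c y))"
    using W(2) by (intro smooth_on_cong open_chart_image d W(1))
      (auto simp: transition_chart_map[OF d] chart_inv_map[OF d] chart_inv_map[OF c])
  with smooth_on_transition_compose[OF c d W f]
  show "smooth_on (chart_map d ` (chart_dom d \<inter> W)) (f \<circ> chart_inv d)" by simp
qed

text \<open>In another chart the components are the Jacobian applied to those in \<open>c\<close>.
  The Jacobian is known to be smooth in fixed directions, hence the expansion along unit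
  vectors.\<close>

lemma smooth_vector_fieldI:
  assumes c: "c \<in> A" and W: "open W" "W \<subseteq> chart_dom c"
    and T: "\<And>q. q \<in> W \<Longrightarrow> X q \<in> tangent_space A q"
    and X: "smooth_on (chart_map c ` W) (\<lambda>x. X (chart_inv c x) c)"
  shows "smooth_vector_field A W X"
  unfolding smooth_vector_field_def
proof (intro conjI ballI T)
  fix d assume d: "d \<in> A"
  let ?U = "chart_map d ` (chart_dom d \<inter> W)"
  let ?V = "chart_map c ` (W \<inter> chart_dom d)"
  have U: "open ?U" by (rule open_chart_image[OF d W(1)])
  have J: "smooth_on ?U (\<lambda>y. frechet_derivative (transition c d) (at (transition d c y)) w)" for w
  proof -
    have "smooth_on ?V (\<lambda>x. frechet_derivative (transition c d) (at x) w)"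
      using W(2) by (intro smooth_on_subset[OF smooth_on_frechet_derivative[OF smooth_on_transition[OF c d]]]) auto
    then have "smooth_on (chart_map d ` (chart_dom d \<inter> (W \<inter> chart_dom d)))
        (\<lambda>y. frechet_derivative (transition c d) (at (transition d c y)) w)"
      using W(2) open_chart_dom[OF d] by (intro smooth_on_transition_compose[OF c d _ _ ]) (auto intro: W(1))
    moreover have "chart_dom d \<inter> (W \<inter> chart_dom d) = chart_dom d \<inter> W" by auto
    ultimately show ?thesis by (simp only:)
  qed
  have "smooth_on ?U (\<lambda>y. \<Sum>i\<in>UNIV. X (chart_inv c (transition d c y)) c $ i *\<^sub>R
      frechet_derivative (transition c d) (at (transition d c y)) (axis i 1))"
    by (intro smooth_on_sum[OF U] bounded_bilinear.smooth_on[OF bounded_bilinear_scaleR U] J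
        smooth_on_vec_nth[OF U] smooth_on_transition_compose[OF c d W X])
  moreover have "(\<Sum>i\<in>UNIV. X (chart_inv c (transition d c y)) c $ i *\<^sub>R
      frechet_derivative (transition c d) (at (transition d c y)) (axis i 1)) = X (chart_inv d y) d"
    if "y \<in> ?U" for y
  proof -
    obtain q where q: "q \<in> chart_dom d" "q \<in> W" "y = chart_map d q" using \<open>y \<in> ?U\<close> by auto
    have qc: "c \<in> charts_at A q" "d \<in> charts_at A q" using q W(2) c d by (auto intro: charts_atI)
    have "(\<Sum>i\<in>UNIV. X q c $ i *\<^sub>R jacobian c d q (axis i 1)) = jacobian c d q (\<Sum>i\<in>UNIV. X q c $ i *\<^sub>R axis i 1)"
      by (simp add: linear_sum[OF linear_jacobian[OF qc]] linear_scale[OF linear_jacobian[OF qc]])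
    also have "(\<Sum>i\<in>UNIV. X q c $ i *\<^sub>R axis i 1) = X q c"
      using basis_expansion[of "X q c"] by (simp only: scalar_mult_eq_scaleR)
    also have "jacobian c d q (X q c) = X q d"
      by (rule tangent_space_jacobian[OF T[OF q(2)] qc, symmetric])
    finally show ?thesis
      using q qc by (simp add: transition_chart_map[OF d] chart_inv_map[OF c] chart_inv_map[OF d]
          charts_atD jacobian_def)
  qed
  ultimately show "smooth_on ?U (\<lambda>y. X (chart_inv d y) d)"
    by (rule smooth_on_transform[OF _ U])
qed

lemma smooth_vector_field_tangent: "smooth_vector_field A W X \<Longrightarrow> q \<in> W \<Longrightarrow> X q \<in> tangent_space A q"
  by (simp add: smooth_vector_field_def)

lemma smooth_vector_field_component:
  "smooth_vector_field A W X \<Longrightarrow> c \<in> A \<Longrightarrow> W \<subseteq> chart_dom c \<Longrightarrow>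
    smooth_on (chart_map c ` W) (\<lambda>x. X (chart_inv c x) c)"
  unfolding smooth_vector_field_def by (metis inf_absorb2)

lemma smooth_vector_field_subset:
  assumes "smooth_vector_field A W X" "W' \<subseteq> W"
  shows "smooth_vector_field A W' X"
  unfolding smooth_vector_field_def
proof (intro conjI ballI)
  show "X q \<in> tangent_space A q" if "q \<in> W'" for q
    using assms that smooth_vector_field_tangent by blast
  fix c assume "c \<in> A"
  with assms(1) have "smooth_on (chart_map c ` (chart_dom c \<inter> W)) (\<lambda>x. X (chart_inv c x) c)"
    unfolding smooth_vector_field_def by blast
  then show "smooth_on (chart_map c ` (chart_dom c \<inter> W')) (\<lambda>x. X (chart_inv c x) c)"
    by (rule smooth_on_subset) (use assms(2) in blast)
qed

lemma smooth_vector_field_coord: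
  assumes c: "c \<in> A" and W: "open W" "W \<subseteq> chart_dom c"
    and g: "smooth_on (chart_map c ` W) (g \<circ> chart_inv c)"
  shows "smooth_vector_field A W (\<lambda>q. coord_tvec A c q (g q))"
proof (rule smooth_vector_fieldI[OF c W])
  show "coord_tvec A c q (g q) \<in> tangent_space A q" if "q \<in> W" for q
    using that W(2) c by (intro coord_tvec_tangent charts_atI) auto
  have U: "open (chart_map c ` W)"
    using open_chart_image[OF c W(1)] W(2) by (simp add: inf_absorb2)
  have "coord_tvec A c (chart_inv c x) (g (chart_inv c x)) c = (g \<circ> chart_inv c) x"
    if "x \<in> chart_map c ` W" for x
    using that W(2) chart_inv_dom[OF c] by (auto intro!: coord_tvec_component charts_atI c)
  then show "smooth_on (chart_map c ` W) (\<lambda>x. coord_tvec A c (chart_inv c x) (g (chart_inv c x)) c)"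
    by (intro smooth_on_transform[OF g U]) (rule sym)
qed

lemma smooth_vector_field_coord_const:
  "c \<in> A \<Longrightarrow> open W \<Longrightarrow> W \<subseteq> chart_dom c \<Longrightarrow> smooth_vector_field A W (\<lambda>q. coord_tvec A c q x)"
  using open_chart_image[of c W]
  by (intro smooth_vector_field_coord) (auto simp: o_def inf_absorb2 intro: smooth_on_const)

section \<open>Covariant derivatives in coordinates\<close>

context
  fixes D :: "('q, 'n) connection"
  assumes conn: "connection A D"
begin

lemma
  assumes "open W" "smooth_vector_field A W X" "q \<in> W" "v \<in> tangent_space A q"
  shows connection_tangent: "D q v X \<in> tangent_space A q"
    and connection_lincomb: "w \<in> tangent_space A q \<Longrightarrow>
      D q (a *\<^sub>R v + b *\<^sub>R w) X = a *\<^sub>R D q v X + b *\<^sub>R D q w X"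
    and connection_scale: "smooth_function A W f \<Longrightarrow>
      D q v (\<lambda>x. f x *\<^sub>R X x) = differential A f q v *\<^sub>R X q + f q *\<^sub>R D q v X"
    and connection_cong: "smooth_vector_field A W Y \<Longrightarrow> (\<And>x. x \<in> W \<Longrightarrow> X x = Y x) \<Longrightarrow> D q v X = D q v Y"
    and connection_add: "smooth_vector_field A W Y \<Longrightarrow> D q v (X + Y) = D q v X + D q v Y"
  using conn[unfolded connection_def, rule_format, of W X X]
    conn[unfolded connection_def, rule_format, of W X Y] assms by blast+

lemma connection_smooth:
  "open W \<Longrightarrow> smooth_vector_field A W X \<Longrightarrow> smooth_vector_field A W Y \<Longrightarrow>
    smooth_vector_field A W (\<lambda>q. D q (Y q) X)"
  using conn unfolding connection_def by blast

text \<open>A connection is additive for two fields and satisfies the Leibniz rule, so the expansion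
  along coordinate fields is an induction over the index set. All identities between fields hold on
  \<open>W\<close>, and \<open>connection_cong\<close> makes them usable under
  \<open>D\<close>.\<close>

lemma connection_coord_sum:
  assumes c: "c \<in> A" and W: "open W" "W \<subseteq> chart_dom c" and q: "q \<in> W"
    and v: "v \<in> tangent_space A q"
    and g: "smooth_on (chart_map c ` W) (g \<circ> chart_inv c)"
  shows "D q v (\<lambda>q. coord_tvec A c q (\<Sum>i\<in>I. g q $ i *\<^sub>R axis i 1)) =
    (\<Sum>i\<in>I. differential A (\<lambda>q. g q $ i) q v *\<^sub>R coord_tvec A c q (axis i 1) +
      g q $ i *\<^sub>R D q v (\<lambda>q. coord_tvec A c q (axis i 1)))"
    (is "D q v (?X I) = _")
proof -
  have U: "open (chart_map c ` W)"
    using open_chart_image[OF c W(1)] W(2) by (simp add: inf_absorb2)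
  have f: "smooth_on (chart_map c ` W) ((\<lambda>q. g q $ i) \<circ> chart_inv c)" for i
    using smooth_on_vec_nth[OF U g, of i] by (simp add: o_def)
  have smooth: "smooth_vector_field A W (?X I)" for I
  proof (rule smooth_vector_field_coord[OF c W])
    have "smooth_on (chart_map c ` W) (\<lambda>x. \<Sum>i\<in>I. ((\<lambda>q. g q $ i) \<circ> chart_inv c) x *\<^sub>R axis i 1 :: real^'n)"
      by (intro smooth_on_sum[OF U] bounded_bilinear.smooth_on[OF bounded_bilinear_scaleR U f]
          smooth_on_const[OF U])
    then show "smooth_on (chart_map c ` W) ((\<lambda>q. \<Sum>i\<in>I. g q $ i *\<^sub>R (axis i 1 :: real^'n)) \<circ> chart_inv c)"
      by (simp add: o_def)
  qed
  have cA: "c \<in> charts_at A q" if "q \<in> W" for q using c W(2) that by (auto intro: charts_atI)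
  have "finite I" by simp
  then show ?thesis
  proof induction
    case empty
    \<comment> \<open>The empty sum vanishes on \<open>W\<close>, while outside of the chart domain
      \<open>coord_tvec\<close> has unspecified values. By locality additivity becomes
      \<open>a = a + a\<close>, and hence the derivative is 0.\<close>
    have "D q v (?X {} + ?X {}) = D q v (?X {}) + D q v (?X {})"
      by (rule connection_add[OF W(1) smooth q v smooth])
    moreover have "D q v (?X {} + ?X {}) = D q v (?X {})"
    proof -
      have zz: "(?X {} + ?X {}) q = ?X {} q" if "q \<in> W" for q
        by (simp only: plus_fun_apply sum.empty linear_0[OF linear_coord_tvec[OF cA[OF that]]] add_0_left)
      have "smooth_vector_field A W (?X {} + ?X {})"
      proof (rule smooth_vector_fieldI[OF c W])
        show "(?X {} + ?X {}) q \<in> tangent_space A q" if "q \<in> W" for q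
          unfolding zz[OF that] by (rule smooth_vector_field_tangent[OF smooth that])
        have "chart_inv c x \<in> W" if "x \<in> chart_map c ` W" for x
          using that W(2) chart_inv_map[OF c] by auto
        then have "smooth_on (chart_map c ` W) (\<lambda>x. (?X {} + ?X {}) (chart_inv c x) c) \<longleftrightarrow>
            smooth_on (chart_map c ` W) (\<lambda>x. ?X {} (chart_inv c x) c)"
          by (intro smooth_on_cong[OF U]) (simp only: zz)
        then show "smooth_on (chart_map c ` W) (\<lambda>x. (?X {} + ?X {}) (chart_inv c x) c)"
          using smooth_vector_field_component[OF smooth c W(2)] by blast
      qed
      then show ?thesis by (rule connection_cong[OF W(1) _ q v smooth zz])
    qed
    ultimately show ?case by simp
  next
    case (insert i I)
    let ?Y = "\<lambda>q. g q $ i *\<^sub>R coord_tvec A c q (axis i 1)"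
    have U': "smooth_on (chart_map c ` W) ((\<lambda>q. g q $ i *\<^sub>R (axis i 1 :: real^'n)) \<circ> chart_inv c)"
      using bounded_bilinear.smooth_on[OF bounded_bilinear_scaleR U f smooth_on_const[OF U]]
      by (simp add: o_def)
    have Yeq: "coord_tvec A c q (g q $ i *\<^sub>R axis i 1) = ?Y q" if "q \<in> W" for q
      by (rule linear_scale[OF linear_coord_tvec[OF cA[OF that]]])
    have inW: "chart_inv c x \<in> W" if "x \<in> chart_map c ` W" for x
      using that W(2) chart_inv_map[OF c] by auto
    have Ysm: "smooth_vector_field A W ?Y"
    proof (rule smooth_vector_fieldI[OF c W])
      note S = smooth_vector_field_coord[OF c W U']
      show "?Y q \<in> tangent_space A q" if "q \<in> W" for q
        unfolding Yeq[OF that, symmetric] by (rule smooth_vector_field_tangent[OF S that])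
      have "smooth_on (chart_map c ` W) (\<lambda>x. ?Y (chart_inv c x) c) \<longleftrightarrow>
          smooth_on (chart_map c ` W) (\<lambda>x. coord_tvec A c (chart_inv c x) (g (chart_inv c x) $ i *\<^sub>R axis i 1) c)"
        by (intro smooth_on_cong[OF U]) (simp only: Yeq[OF inW])
      then show "smooth_on (chart_map c ` W) (\<lambda>x. ?Y (chart_inv c x) c)"
        using smooth_vector_field_component[OF S c W(2)] by blast
    qed
    have XY: "?X (insert i I) q = (?Y + ?X I) q" if "q \<in> W" for q
      by (subst plus_fun_apply) (simp only: sum.insert[OF insert.hyps]
          linear_add[OF linear_coord_tvec[OF cA[OF that]]] Yeq[OF that])
    have "smooth_vector_field A W (?Y + ?X I)"
    proof (rule smooth_vector_fieldI[OF c W])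
      show "(?Y + ?X I) q \<in> tangent_space A q" if "q \<in> W" for q
        unfolding XY[OF that, symmetric] by (rule smooth_vector_field_tangent[OF smooth that])
      have "smooth_on (chart_map c ` W) (\<lambda>x. ?X (insert i I) (chart_inv c x) c) \<longleftrightarrow>
          smooth_on (chart_map c ` W) (\<lambda>x. (?Y + ?X I) (chart_inv c x) c)"
        by (intro smooth_on_cong[OF U]) (simp only: XY[OF inW])
      then show "smooth_on (chart_map c ` W) (\<lambda>x. (?Y + ?X I) (chart_inv c x) c)"
        using smooth_vector_field_component[OF smooth c W(2)] by blast
    qed
    then have "D q v (?X (insert i I)) = D q v (?Y + ?X I)"
      by (rule connection_cong[OF W(1) smooth q v _ XY])
    also have "\<dots> = D q v ?Y + D q v (?X I)"
      by (rule connection_add[OF W(1) Ysm q v smooth])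
    also have "D q v ?Y = differential A (\<lambda>q. g q $ i) q v *\<^sub>R coord_tvec A c q (axis i 1) +
        g q $ i *\<^sub>R D q v (\<lambda>q. coord_tvec A c q (axis i 1))"
      by (rule connection_scale[OF W(1) smooth_vector_field_coord_const[OF c W] q v smooth_functionI[OF c W f]])
    finally show ?case by (simp only: sum.insert[OF insert.hyps] insert.IH)
  qed
qed

text \<open>The local formula of a connection, paired with a covector: the derivative of the
  components plus a Christoffel term. The numbers
  \<open>\<alpha> (D q v (\<lambda>q. coord_tvec A c q (axis i 1)))\<close> are the Christoffel
  symbols contracted with \<open>\<alpha>\<close> and \<open>v\<close>; they reappear as the
  right-hand side of the equation of parallel transport.\<close>

lemma covec_connection:
  assumes c: "c \<in> A" and W: "open W" "q \<in> W" "q \<in> chart_dom c"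
    and v: "v \<in> tangent_space A q" and X: "smooth_vector_field A W X"
    and \<alpha>: "\<alpha> \<in> cotangent_space A q"
  shows "\<alpha> (D q v X) =
    covec_components A c q \<alpha> \<bullet>
      frechet_derivative (\<lambda>x. X (chart_inv c x) c) (at (chart_map c q)) (v c) +
    (\<chi> i. \<alpha> (D q v (\<lambda>q. coord_tvec A c q (axis i 1)))) \<bullet> X q c"
proof -
  define W' where "W' = W \<inter> chart_dom c"
  have W': "open W'" "W' \<subseteq> chart_dom c" "q \<in> W'" using W open_chart_dom[OF c] by (auto simp: W'_def)
  have cq: "c \<in> charts_at A q" using c W(3) by (rule charts_atI)
  have X': "smooth_vector_field A W' X" using X by (rule smooth_vector_field_subset) (simp add: W'_def)
  define g where "g q = X q c" for q
  have U: "open (chart_map c ` W')"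
    using open_chart_image[OF c W'(1)] W'(2) by (simp add: inf_absorb2)
  have g: "smooth_on (chart_map c ` W') (g \<circ> chart_inv c)"
    using smooth_vector_field_component[OF X' c W'(2)] by (simp add: g_def o_def)
  have exp: "(\<Sum>i\<in>UNIV. g q $ i *\<^sub>R (axis i 1 :: real^'n)) = g q" for q
    using basis_expansion[of "g q"] by (simp only: scalar_mult_eq_scaleR)
  have "D q v X = D q v (\<lambda>q. coord_tvec A c q (g q))"
  proof (rule connection_cong[OF W'(1) X' W'(3) v smooth_vector_field_coord[OF c W'(1,2) g]])
    show "X q = coord_tvec A c q (g q)" if "q \<in> W'" for q
      using that c W'(2) unfolding g_def
      by (intro coord_tvec_collapse[symmetric] smooth_vector_field_tangent[OF X'] charts_atI) auto
  qed
  also have "\<dots> = (\<Sum>i\<in>UNIV. differential A (\<lambda>q. g q $ i) q v *\<^sub>R coord_tvec A c q (axis i 1) +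
      g q $ i *\<^sub>R D q v (\<lambda>q. coord_tvec A c q (axis i 1)))"
    using connection_coord_sum[OF c W'(1,2,3) v g, of UNIV] unfolding exp .
  finally have "\<alpha> (D q v X) = \<alpha> (\<Sum>i\<in>UNIV.
      differential A (\<lambda>q. g q $ i) q v *\<^sub>R coord_tvec A c q (axis i 1) +
      g q $ i *\<^sub>R D q v (\<lambda>q. coord_tvec A c q (axis i 1)))"
    by (rule arg_cong)
  also have "\<dots> = (\<Sum>i\<in>UNIV. differential A (\<lambda>q. g q $ i) q v * covec_components A c q \<alpha> $ i +
      g q $ i * \<alpha> (D q v (\<lambda>q. coord_tvec A c q (axis i 1))))"
  proof -
    note sm = smooth_vector_field_coord_const[OF c W'(1,2)]
    have t: "a *\<^sub>R coord_tvec A c q (axis i 1) + b *\<^sub>R D q v (\<lambda>q. coord_tvec A c q (axis i 1)) \<in> tangent_space A q" for a b i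
      by (rule tangent_space_lincomb[OF coord_tvec_tangent[OF cq] connection_tangent[OF W'(1) sm W'(3) v]])
    \<comment> \<open>A covector is additive only on tangent vectors, so every partial sum has to be
      tangent.\<close>
    have sum: "\<alpha> (\<Sum>i\<in>I. f i) = (\<Sum>i\<in>I. \<alpha> (f i))"
      if "finite I" "\<And>i. i \<in> I \<Longrightarrow> f i \<in> tangent_space A q" for I and f :: "'n \<Rightarrow> ('q, 'n) tvec"
      using that
    proof induction
      case empty
      show ?case using cotangent_scale[OF \<alpha> v, of 0]
        by (simp only: sum.empty scaleR_zero_left mult_zero_left)
    next
      case (insert i I)
      then have "(\<Sum>i\<in>I. f i) \<in> tangent_space A q"
        by (intro subspace_sum[OF subspace_tangent_space]) auto
      then show ?case using insert by (simp add: cotangent_add[OF \<alpha>] del: plus_fun_apply)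
    qed
    show ?thesis
      by (simp only: sum[OF finite t] cotangent_lincomb[OF \<alpha> coord_tvec_tangent[OF cq]
            connection_tangent[OF W'(1) sm W'(3) v]])
        (simp add: covec_components_def)
  qed
  finally have sum: "\<alpha> (D q v X) = (\<Sum>i\<in>UNIV.
      differential A (\<lambda>q. g q $ i) q v * covec_components A c q \<alpha> $ i +
      g q $ i * \<alpha> (D q v (\<lambda>q. coord_tvec A c q (axis i 1))))" .
  have "differential A (\<lambda>q. g q $ i) q v =
      frechet_derivative (\<lambda>x. X (chart_inv c x) c) (at (chart_map c q)) (v c) $ i" for i
  proof -
    have f: "smooth_on (chart_map c ` W') ((\<lambda>q. g q $ i) \<circ> chart_inv c)"
      using smooth_on_vec_nth[OF U g, of i] by (simp add: o_def)
    have "((\<lambda>x. X (chart_inv c x) c) has_derivative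
        frechet_derivative (\<lambda>x. X (chart_inv c x) c) (at (chart_map c q))) (at (chart_map c q))"
      using W'(3) by (intro smooth_on_has_derivative[OF smooth_vector_field_component[OF X' c W'(2)]]) auto
    from frechet_derivative_at[OF bounded_linear.has_derivative[OF bounded_linear_vec_nth this], of i]
    have "frechet_derivative ((\<lambda>q. g q $ i) \<circ> chart_inv c) (at (chart_map c q)) =
        (\<lambda>h. frechet_derivative (\<lambda>x. X (chart_inv c x) c) (at (chart_map c q)) h $ i)"
      unfolding g_def o_def by (rule sym)
    then show ?thesis
      unfolding differential_eq[OF smooth_functionI[OF c W'(1,2) f] W'(1,3) cq v] by (rule fun_cong)
  qed
  with sum show ?thesis
    by (simp add: inner_vec_def sum.distrib g_def mult.commute)
qed

end

end

section \<open>Horizontal curves and base derivatives\<close>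

context smooth_manifold
begin

section \<open>Christoffel symbols on fields with constant components\<close>

lemma frechet_derivative_coord_const:
  assumes c: "c \<in> charts_at A q"
  shows "frechet_derivative (\<lambda>x. coord_tvec A c (chart_inv c x) w c) (at (chart_map c q)) = (\<lambda>_. 0)"
proof -
  have "((\<lambda>x. coord_tvec A c (chart_inv c x) w c) has_derivative (\<lambda>_. 0)) (at (chart_map c q))"
  proof (rule has_derivative_transform_within_open[OF has_derivative_const[of w] open_chart_range[OF charts_atD(1)[OF c]]])
    show "chart_map c q \<in> chart_map c ` chart_dom c" using charts_atD[OF c] by simp
    show "w = coord_tvec A c (chart_inv c x) w c" if "x \<in> chart_map c ` chart_dom c" for x
      using coord_tvec_component[OF charts_atI[OF charts_atD(1)[OF c] chart_inv_dom[OF charts_atD(1)[OF c] that]]]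
      by simp
  qed
  from frechet_derivative_at[OF this] show ?thesis by (rule sym)
qed

context
  fixes D :: "('q, 'n) connection"
  assumes conn: "connection A D"
begin

text \<open>For a field with constant components the derivative part of
  \<open>covec_connection\<close> vanishes, and the Christoffel part is linear in these
  components.\<close>

lemma covec_connection_coord:
  assumes c: "c \<in> charts_at A q" and v: "v \<in> tangent_space A q" and \<alpha>: "\<alpha> \<in> cotangent_space A q"
  shows "\<alpha> (D q v (\<lambda>q. coord_tvec A c q w)) =
    (\<chi> i. \<alpha> (D q v (\<lambda>q. coord_tvec A c q (axis i 1)))) \<bullet> w"
  using covec_connection[OF conn charts_atD(1)[OF c] open_chart_dom[OF charts_atD(1)[OF c]]
      charts_atD(2)[OF c] charts_atD(2)[OF c] v
      smooth_vector_field_coord_const[OF charts_atD(1)[OF c] open_chart_dom[OF charts_atD(1)[OF c]] order_refl] \<alpha>, of w]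
  by (simp add: frechet_derivative_coord_const[OF c] coord_tvec_component[OF c])

text \<open>Fields with constant components in one chart commute, so vanishing torsion is the
  symmetry of the Christoffel symbols. Both sides are tangent vectors, so comparing them in
  \<open>c\<close> is enough.\<close>

lemma torsion_free_coord:
  assumes tf: "torsion_free A D" and c: "c \<in> charts_at A q"
  shows "D q (coord_tvec A c q w) (\<lambda>q. coord_tvec A c q w') = D q (coord_tvec A c q w') (\<lambda>q. coord_tvec A c q w)"
proof -
  note cA = charts_atD[OF c]
  note sm = smooth_vector_field_coord_const[OF cA(1) open_chart_dom[OF cA(1)] order_refl]
  have "D q (coord_tvec A c q w) (\<lambda>q. coord_tvec A c q w') - D q (coord_tvec A c q w') (\<lambda>q. coord_tvec A c q w) =
      lie_bracket A (\<lambda>q. coord_tvec A c q w) (\<lambda>q. coord_tvec A c q w') q"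
    using tf[unfolded torsion_free_def] open_chart_dom[OF cA(1)] sm[of w] sm[of w'] cA(2) by blast
  then have "(D q (coord_tvec A c q w) (\<lambda>q. coord_tvec A c q w') - D q (coord_tvec A c q w') (\<lambda>q. coord_tvec A c q w)) c =
      lie_bracket A (\<lambda>q. coord_tvec A c q w) (\<lambda>q. coord_tvec A c q w') q c"
    by (rule fun_cong)
  also have "\<dots> = 0"
    using c by (simp add: lie_bracket_def frechet_derivative_coord_const[OF c])
  finally have "D q (coord_tvec A c q w) (\<lambda>q. coord_tvec A c q w') c = D q (coord_tvec A c q w') (\<lambda>q. coord_tvec A c q w) c"
    by simp
  then show ?thesis
    by (intro tangent_space_eqI[OF _ _ c]
        connection_tangent[OF conn open_chart_dom[OF cA(1)] sm cA(2) coord_tvec_tangent[OF c]])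
qed

section \<open>Parallel transport and base derivatives\<close>

text \<open>Testing horizontality on the coordinate fields shows that the covector components have
  derivative \<open>\<Gamma>\<close>, the Christoffel term. The outcome depends on the curve only
  through its initial covector and velocity.\<close>

lemma has_derivative_kinetic_horizontal:
  assumes metric: "riemannian_metric A \<rho>" and \<epsilon>: "\<epsilon> > 0"
    and hor: "horizontal_curve A D {-\<epsilon><..<\<epsilon>} u" and u0: "u 0 = (q, \<alpha>)"
    and vel: "velocity A (fst \<circ> u) 0 = v"
    and v: "v \<in> tangent_space A q" and \<alpha>: "\<alpha> \<in> cotangent_space A q" and c: "c \<in> charts_at A q"
  defines "x \<equiv> chart_map c q" and "p \<equiv> covec_components A c q \<alpha>" and "M \<equiv> kinetic_matrix A \<rho> c"
  shows "deriv (\<lambda>s. kinetic A \<rho> (u s)) 0 =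
    base_part M x p (v c) + \<alpha> (D q v (\<lambda>q. coord_tvec A c q (M x *v p)))"
proof -
  note cA = charts_atD[OF c]
  let ?I = "{-\<epsilon><..<\<epsilon>}"
  define \<gamma> where "\<gamma> = fst \<circ> u"
  have curve: "smooth_cotangent_curve A ?I u"
    using hor unfolding horizontal_curve_def by blast
  have cont: "continuous_on ?I \<gamma>" and bdl: "u ` ?I \<subseteq> cotangent_bundle A"
    using curve unfolding smooth_cotangent_curve_def \<gamma>_def by blast+
  have par: "((\<lambda>t. snd (u t) (X (\<gamma> t))) has_real_derivative snd (u s) (D (\<gamma> s) (velocity A \<gamma> s) X)) (at s)"
    if "s \<in> ?I" "open W" "\<gamma> s \<in> W" "smooth_vector_field A W X" for s W X
    using hor that unfolding horizontal_curve_def Let_def \<gamma>_def[symmetric] o_apply by blast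
  have \<gamma>0: "\<gamma> 0 = q" by (simp add: \<gamma>_def u0)
  \<comment> \<open>The curve may leave the chart; \<open>J\<close> is an open neighbourhood of 0 on
    which the coordinate expressions hold.\<close>
  define J where "J = {s \<in> ?I. fst (u s) \<in> chart_dom c}"
  define X where "X s = chart_map c (fst (u s))" for s
  define P where "P s = covec_components A c (fst (u s)) (snd (u s))" for s
  have "J = ?I \<inter> \<gamma> -` chart_dom c" by (auto simp: J_def \<gamma>_def)
  then have J: "open J" "0 \<in> J"
    using continuous_open_preimage[OF cont _ open_chart_dom[OF cA(1)]] \<epsilon> cA(2) \<gamma>0 by auto
  have "smooth_on J X"
    using curve cA(1) unfolding smooth_cotangent_curve_def Let_def J_def X_def by blast
  then have "X differentiable (at 0)" using J(2) by (rule smooth_on_differentiable)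
  then have "(X has_vector_derivative vector_derivative X (at 0)) (at 0)"
    by (simp add: vector_derivative_works)
  moreover have "vector_derivative X (at 0) = v c"
    using fun_cong[OF vel, of c] c \<gamma>0
    by (simp add: velocity_def \<gamma>_def X_def[abs_def] o_def)
  ultimately have X': "(X has_derivative (\<lambda>h. h *\<^sub>R v c)) (at 0)"
    by (simp add: has_vector_derivative_def)
  define \<Gamma> where "\<Gamma> = (\<chi> j. \<alpha> (D q v (\<lambda>q. coord_tvec A c q (axis j 1))))"
  have "(P has_vector_derivative \<Gamma>) (at 0)"
  proof (rule has_vector_derivative_vecI)
    fix j
    have "((\<lambda>t. snd (u t) (coord_tvec A c (\<gamma> t) (axis j 1))) has_real_derivative
        snd (u 0) (D (\<gamma> 0) (velocity A \<gamma> 0) (\<lambda>q. coord_tvec A c q (axis j 1)))) (at 0)"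
      using \<gamma>0 \<epsilon> cA(2) by (intro par[OF _ open_chart_dom[OF cA(1)] _
            smooth_vector_field_coord_const[OF cA(1) open_chart_dom[OF cA(1)] order_refl]]) auto
    then show "((\<lambda>t. P t $ j) has_real_derivative \<Gamma> $ j) (at 0)"
      using vel by (simp add: P_def \<Gamma>_def covec_components_def \<gamma>_def u0)
  qed
  then have P': "(P has_derivative (\<lambda>h. h *\<^sub>R \<Gamma>)) (at 0)"
    by (simp add: has_vector_derivative_def)
  have X0: "X 0 = x" and P0: "P 0 = p" by (simp_all add: X_def P_def u0 x_def p_def)
  have M: "M differentiable at (X 0)" "transpose (M (X 0)) = M (X 0)"
    unfolding X0 unfolding M_def x_def
    using differentiable_kinetic_matrix[OF metric c] transpose_kinetic_matrix[OF metric c] by auto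
  have "((\<lambda>s. 1/2 * (P s \<bullet> (M (X s) *v P s))) has_derivative
      (\<lambda>h. base_part M (X 0) (P 0) (h *\<^sub>R v c) + (M (X 0) *v P 0) \<bullet> (h *\<^sub>R \<Gamma>))) (at 0)"
    by (rule has_derivative_quadratic_form[OF X' P' M])
  then have "((\<lambda>s. kinetic A \<rho> (u s)) has_derivative
      (\<lambda>h. base_part M (X 0) (P 0) (h *\<^sub>R v c) + (M (X 0) *v P 0) \<bullet> (h *\<^sub>R \<Gamma>))) (at 0)"
  proof (rule has_derivative_transform_within_open[OF _ J])
    fix s assume s: "s \<in> J"
    then have "c \<in> charts_at A (fst (u s))" "u s \<in> cotangent_bundle A"
      using cA(1) bdl by (auto simp: J_def intro: charts_atI)
    then show "1/2 * (P s \<bullet> (M (X s) *v P s)) = kinetic A \<rho> (u s)"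
      using kinetic_eq[OF metric, of c "fst (u s)" "snd (u s)"]
      by (auto simp: P_def X_def M_def cotangent_bundle_def mem_Times_iff)
  qed
  then have "((\<lambda>s. kinetic A \<rho> (u s)) has_real_derivative base_part M x p (v c) + (M x *v p) \<bullet> \<Gamma>) (at 0)"
    unfolding X0 P0
    using linear_scale[OF linear_base_part[OF M(1)[unfolded X0]]]
    by (simp add: has_field_derivative_def distrib_left[symmetric] mult_commute_abs)
  moreover have "\<alpha> (D q v (\<lambda>q. coord_tvec A c q (M x *v p))) = \<Gamma> \<bullet> (M x *v p)"
    unfolding \<Gamma>_def by (rule covec_connection_coord[OF c v \<alpha>])
  ultimately show ?thesis
    by (simp only: DERIV_imp_deriv inner_commute[of "M x *v p"])
qed

text \<open>The base curve is a straight line in a chart around \<^term>\<open>q\<close>; the components of the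
  covector solve a linear differential equation along it.\<close>

lemma horizontal_curve_exists:
  assumes v: "v \<in> tangent_space A q" and \<alpha>: "\<alpha> \<in> cotangent_space A q"
  shows "\<exists>\<epsilon>>0. \<exists>u. horizontal_curve A D {-\<epsilon><..<\<epsilon>} u \<and> u 0 = (q, \<alpha>) \<and> velocity A (fst \<circ> u) 0 = v"
proof -
  define c where "c = chart_at A q"
  have c: "c \<in> charts_at A q" by (simp add: c_def chart_at_charts_at)
  note cA = charts_atD[OF c]
  let ?R = "chart_map c ` chart_dom c"
  note dom = open_chart_dom[OF cA(1)] and range = open_chart_range[OF cA(1)]
  define w where "w = v c"
  define y where "y t = chart_map c q + t *\<^sub>R w" for t :: real
  have y_deriv: "(y has_derivative (\<lambda>h. h *\<^sub>R w)) (at t)" for t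
    unfolding y_def by (auto intro!: derivative_eq_intros)
  have y_smooth: "smooth_on S y" if "open S" for S
    unfolding y_def
    by (intro smooth_on_add[OF that] smooth_on_const[OF that] smooth_on_linear[OF that] bounded_linear_scaleR_left)
  have y_cont: "continuous_on UNIV y" unfolding y_def by (intro continuous_intros)
  have "open (y -` ?R)" by (rule open_vimage[OF range y_cont])
  moreover have "0 \<in> y -` ?R" using cA(2) by (simp add: y_def)
  ultimately obtain \<delta>0 where \<delta>0: "\<delta>0 > 0" "ball 0 \<delta>0 \<subseteq> y -` ?R"
    using openE by blast
  \<comment> \<open>Halving leaves room for a closed interval inside the ball, as
    \<open>linear_ode_solution\<close> asks for continuity up to the end points.\<close>
  define \<delta> where "\<delta> = \<delta>0 / 2"
  have \<delta>: "\<delta> > 0" "{-\<delta>..\<delta>} \<subseteq> ball 0 \<delta>0" using \<delta>0(1) by (auto simp: \<delta>_def)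
  let ?S = "ball (0::real) \<delta>0"
  have y_range: "y t \<in> ?R" if "t \<in> ?S" for t using \<delta>0(2) that by blast
  define \<gamma> where "\<gamma> t = chart_inv c (y t)" for t
  have \<gamma>_dom: "\<gamma> t \<in> chart_dom c" and \<gamma>_map: "chart_map c (\<gamma> t) = y t" if "t \<in> ?S" for t
    using chart_inv_dom[OF cA(1) y_range[OF that]] chart_map_inv[OF cA(1) y_range[OF that]]
    by (auto simp: \<gamma>_def)
  have c\<gamma>: "c \<in> charts_at A (\<gamma> t)" if "t \<in> ?S" for t
    using \<gamma>_dom[OF that] cA(1) by (rule charts_atI[rotated])
  define E where "E j q = coord_tvec A c q j" for j q
  have E_smooth: "smooth_vector_field A (chart_dom c) (E j)" for j
    unfolding E_def by (rule smooth_vector_field_coord_const[OF cA(1) dom order_refl])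
  \<comment> \<open>The components of the covariant derivative of the \<open>j\<close>-th coordinate
    field along the line. Parallelism tested on this field says that \<open>p t $ j\<close> has
    derivative \<open>p t \<bullet> B j t\<close>.\<close>
  define B where "B j t = D (\<gamma> t) (E w (\<gamma> t)) (E (axis j 1)) c" for j t
  have B_smooth: "smooth_on ?S (B j)" for j
  proof -
    have "smooth_on ?R (\<lambda>x. D (chart_inv c x) (E w (chart_inv c x)) (E (axis j 1)) c)"
      using smooth_vector_field_component[OF connection_smooth[OF conn dom E_smooth E_smooth] cA(1) order_refl] .
    moreover have "y ` ?S \<subseteq> ?R" using y_range by blast
    ultimately show ?thesis
      unfolding B_def[abs_def] \<gamma>_def by (intro smooth_on_compose[OF open_ball _ _ y_smooth[OF open_ball]])
  qed
  have "continuous_on {-\<delta>..\<delta>} (B j)" for j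
    using smooth_on_continuous_on[OF B_smooth] \<delta>(2) by (rule continuous_on_subset)
  from linear_ode_solution[of \<delta> B "covec_components A c q \<alpha>", OF \<delta>(1) this]
  obtain \<epsilon> p where \<epsilon>: "\<epsilon> > 0" "\<epsilon> \<le> \<delta>" and p0: "p 0 = covec_components A c q \<alpha>"
    and p: "\<And>t. t \<in> {-\<epsilon><..<\<epsilon>} \<Longrightarrow> (p has_vector_derivative (\<chi> j. p t \<bullet> B j t)) (at t)"
    by blast
  let ?I = "{-\<epsilon><..<\<epsilon>}"
  have IS: "?I \<subseteq> ?S" using \<epsilon>(2) \<delta>(2) by auto
  have p_smooth: "smooth_on ?I p"
    by (rule linear_ode_smooth[OF open_greaterThanLessThan smooth_on_subset[OF B_smooth IS] p])
  define u where "u t = (\<gamma> t, coord_covec A c (\<gamma> t) (p t))" for t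
  have fst_u: "fst \<circ> u = \<gamma>" and snd_u: "snd \<circ> u = (\<lambda>t. coord_covec A c (\<gamma> t) (p t))"
    by (auto simp: u_def)
  have \<gamma>_cont: "continuous_on ?I \<gamma>"
  proof -
    have "continuous_on ?R (chart_inv c)"
      using chart_homeomorphism[OF cA(1)] unfolding homeomorphism_def by blast
    moreover have "y ` ?I \<subseteq> ?R" using y_range IS by blast
    ultimately show ?thesis
      unfolding \<gamma>_def by (rule continuous_on_compose2[OF _ continuous_on_subset[OF y_cont subset_UNIV]])
  qed
  have map_\<gamma>: "chart_map d (\<gamma> t) = transition c d (y t)" for d t
    by (simp add: transition_def \<gamma>_def)
  \<comment> \<open>Horizontality is a condition at every time, so the velocity is identified along
    the whole line, as the coordinate field with constant components \<open>w\<close>.\<close>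
  have velocity: "velocity A \<gamma> t = E w (\<gamma> t)" if t: "t \<in> ?I" for t
  proof
    fix d
    show "velocity A \<gamma> t d = E w (\<gamma> t) d"
    proof (cases "d \<in> charts_at A (\<gamma> t)")
      case True
      have tS: "t \<in> ?S" using t IS by blast
      have "(transition c d has_derivative jacobian c d (\<gamma> t)) (at (y t))"
        using has_derivative_transition[OF c\<gamma>[OF tS] True] by (simp only: \<gamma>_map[OF tS])
      from has_derivative_compose[OF y_deriv this]
      have "((chart_map d \<circ> \<gamma>) has_vector_derivative jacobian c d (\<gamma> t) w) (at t)"
        by (simp add: has_vector_derivative_def o_def map_\<gamma> linear_scale[OF linear_jacobian[OF c\<gamma>[OF tS] True]])
      from vector_derivative_at[OF this] True show ?thesis
        by (simp add: velocity_def E_def coord_tvec_eq)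
    next
      case False
      then show ?thesis by (simp add: velocity_def E_def coord_tvec_eq)
    qed
  qed
  have curve: "smooth_cotangent_curve A ?I u"
    unfolding smooth_cotangent_curve_def Let_def
  proof (intro conjI ballI)
    show "u ` ?I \<subseteq> cotangent_bundle A"
      by (auto simp: u_def cotangent_bundle_def coord_covec_cotangent)
    show "continuous_on ?I (fst \<circ> u)" unfolding fst_u by (rule \<gamma>_cont)
    fix d assume d: "d \<in> A"
    let ?J = "{s \<in> ?I. fst (u s) \<in> chart_dom d}"
    have Jeq: "?J = ?I \<inter> \<gamma> -` chart_dom d" by (auto simp: u_def)
    have J: "open ?J"
      unfolding Jeq by (rule continuous_open_preimage[OF \<gamma>_cont open_greaterThanLessThan open_chart_dom[OF d]])
    have y_in: "y ` ?J \<subseteq> chart_map c ` (chart_dom c \<inter> chart_dom d)"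
    proof
      fix z assume "z \<in> y ` ?J"
      then obtain s where s: "s \<in> ?I" "\<gamma> s \<in> chart_dom d" "z = y s" by (auto simp: u_def)
      then have sS: "s \<in> ?S" using IS by blast
      from \<gamma>_map[OF sS] \<gamma>_dom[OF sS] s show "z \<in> chart_map c ` (chart_dom c \<inter> chart_dom d)"
        by (metis IntI imageI)
    qed
    have q_smooth: "smooth_on ?J (\<lambda>s. transition c d (y s))"
      by (rule smooth_on_compose[OF J y_in smooth_on_transition[OF cA(1) d] y_smooth[OF J]])
    then show "smooth_on ?J (\<lambda>s. chart_map d (fst (u s)))"
      by (simp add: u_def map_\<gamma>)
    have q_in: "(\<lambda>s. transition c d (y s)) ` ?J \<subseteq> chart_map d ` (chart_dom d \<inter> chart_dom c)"
    proof
      fix z assume "z \<in> (\<lambda>s. transition c d (y s)) ` ?J"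
      then obtain s where s: "s \<in> ?I" "\<gamma> s \<in> chart_dom d" "z = chart_map d (\<gamma> s)"
        by (auto simp: u_def map_\<gamma>)
      then have sS: "s \<in> ?S" using IS by blast
      from \<gamma>_dom[OF sS] s show "z \<in> chart_map d ` (chart_dom d \<inter> chart_dom c)" by blast
    qed
    \<comment> \<open>The components of the covector in \<open>d\<close> arise from \<open>p\<close>
      through the Jacobian from \<open>d\<close> to \<open>c\<close>, taken at the
      \<open>d\<close>-coordinates of the curve.\<close>
    have Jac: "smooth_on ?J (\<lambda>s. frechet_derivative (transition d c) (at (transition c d (y s))) e)" for e
      by (rule smooth_on_compose[OF J q_in smooth_on_frechet_derivative[OF smooth_on_transition[OF d cA(1)]] q_smooth])
    have "smooth_on ?J (\<lambda>s. \<chi> i. p s \<bullet> frechet_derivative (transition d c) (at (transition c d (y s))) (axis i 1))"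
    proof (rule smooth_on_vecI[OF J])
      fix i
      have "smooth_on ?J p" using p_smooth by (rule smooth_on_subset) auto
      from bounded_bilinear.smooth_on[OF bounded_bilinear_inner J this Jac]
      show "smooth_on ?J (\<lambda>s. (\<chi> i. p s \<bullet> frechet_derivative (transition d c) (at (transition c d (y s))) (axis i 1)) $ i)"
        by simp
    qed
    then show "smooth_on ?J (\<lambda>s. covec_components A d (fst (u s)) (snd (u s)))"
    proof (rule smooth_on_transform[OF _ J])
      fix s assume "s \<in> ?J"
      then have s: "s \<in> ?I" "\<gamma> s \<in> chart_dom d" by (auto simp: u_def)
      then have sS: "s \<in> ?S" using IS by blast
      have d': "d \<in> charts_at A (\<gamma> s)" using d s(2) by (rule charts_atI)
      show "(\<chi> i. p s \<bullet> frechet_derivative (transition d c) (at (transition c d (y s))) (axis i 1)) =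
          covec_components A d (fst (u s)) (snd (u s))"
        using covec_components_change[OF d' c\<gamma>[OF sS] coord_covec_cotangent[of c "\<gamma> s" "p s"]]
        by (simp add: u_def covec_components_coord_covec[OF c\<gamma>[OF sS]] jacobian_def map_\<gamma>)
    qed
  qed
  have parallel: "((\<lambda>t. coord_covec A c (\<gamma> t) (p t) (X (\<gamma> t))) has_real_derivative
      coord_covec A c (\<gamma> s) (p s) (D (\<gamma> s) (velocity A \<gamma> s) X)) (at s)"
    if s: "s \<in> ?I" and W: "open W" "\<gamma> s \<in> W" and X: "smooth_vector_field A W X" for s W X
  proof -
    have sS: "s \<in> ?S" using s IS by blast
    let ?\<alpha> = "coord_covec A c (\<gamma> s) (p s)" and ?v = "E w (\<gamma> s)"
    let ?Xc = "\<lambda>x. X (chart_inv c x) c"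
    let ?DX = "frechet_derivative ?Xc (at (y s))"
    have v': "?v \<in> tangent_space A (\<gamma> s)" unfolding E_def by (rule coord_tvec_tangent[OF c\<gamma>[OF sS]])
    note \<alpha>' = coord_covec_cotangent[of c "\<gamma> s" "p s"]
    have Bs: "?\<alpha> (D (\<gamma> s) ?v (\<lambda>q. coord_tvec A c q (axis j 1))) = p s \<bullet> B j s" for j
      using connection_tangent[OF conn dom E_smooth \<gamma>_dom[OF sS] v', of "axis j 1"]
      by (simp add: coord_covec_def B_def E_def[abs_def])
    have cov: "?\<alpha> (D (\<gamma> s) ?v X) = p s \<bullet> ?DX w + (\<chi> j. p s \<bullet> B j s) \<bullet> ?Xc (y s)"
      using covec_connection[OF conn cA(1) W \<gamma>_dom[OF sS] v' X \<alpha>']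
      unfolding Bs covec_components_coord_covec[OF c\<gamma>[OF sS]] \<gamma>_map[OF sS]
      unfolding E_def coord_tvec_component[OF c\<gamma>[OF sS]] by (simp only: \<gamma>_def)
    have "(?Xc has_derivative ?DX) (at (y s))"
    proof (rule smooth_on_has_derivative)
      show "smooth_on (chart_map c ` (chart_dom c \<inter> W)) ?Xc"
        using X cA(1) unfolding smooth_vector_field_def by blast
      show "y s \<in> chart_map c ` (chart_dom c \<inter> W)"
        using \<gamma>_map[OF sS] \<gamma>_dom[OF sS] W(2) by (metis IntI imageI)
    qed
    \<comment> \<open>The product rule yields the derivative of \<open>X\<close> along the line and,
      by the differential equation for \<open>p\<close>, the Christoffel term: the two parts found
      in \<open>cov\<close>.\<close>
    from has_derivative_inner[OF p[OF s, unfolded has_vector_derivative_def] has_derivative_compose[OF y_deriv this]]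
    have "((\<lambda>t. p t \<bullet> ?Xc (y t)) has_derivative
        (\<lambda>h. p s \<bullet> ?DX (h *\<^sub>R w) + (h *\<^sub>R (\<chi> j. p s \<bullet> B j s)) \<bullet> ?Xc (y s))) (at s)" .
    moreover have "?DX (h *\<^sub>R w) = h *\<^sub>R ?DX w" for h
      using linear_scale[OF has_derivative_linear[OF \<open>(?Xc has_derivative ?DX) (at (y s))\<close>]] .
    ultimately have "((\<lambda>t. p t \<bullet> ?Xc (y t)) has_real_derivative ?\<alpha> (D (\<gamma> s) ?v X)) (at s)"
      unfolding cov by (simp add: has_field_derivative_def distrib_left[symmetric] mult_commute_abs)
    then have "((\<lambda>t. coord_covec A c (\<gamma> t) (p t) (X (\<gamma> t))) has_real_derivative ?\<alpha> (D (\<gamma> s) ?v X)) (at s)"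
    proof (rule has_field_derivative_transform_within_open)
      show "open (?I \<inter> \<gamma> -` W)"
        by (rule continuous_open_preimage[OF \<gamma>_cont open_greaterThanLessThan W(1)])
      show "s \<in> ?I \<inter> \<gamma> -` W" using s W(2) by simp
      show "p t \<bullet> ?Xc (y t) = coord_covec A c (\<gamma> t) (p t) (X (\<gamma> t))" if "t \<in> ?I \<inter> \<gamma> -` W" for t
        using that smooth_vector_field_tangent[OF X, of "\<gamma> t"] by (simp add: coord_covec_def \<gamma>_def)
    qed
    then show ?thesis unfolding velocity[OF s] .
  qed
  have "horizontal_curve A D ?I u"
    unfolding horizontal_curve_def Let_def fst_u snd_u using curve parallel by blast
  moreover have \<gamma>0: "\<gamma> 0 = q" by (simp add: \<gamma>_def y_def chart_inv_map[OF cA])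
  then have "u 0 = (q, \<alpha>)"
    by (simp add: u_def p0 coord_covec_components[OF c \<alpha>])
  moreover have "velocity A (fst \<circ> u) 0 = v"
    unfolding fst_u using velocity[of 0] \<epsilon>(1) by (simp add: \<gamma>0 E_def w_def coord_tvec_collapse[OF c v])
  ultimately show ?thesis using \<epsilon>(1) by blast
qed

text \<open>All horizontal curves in the direction \<open>v\<close> give the same value, and this
  value is linear in \<open>v\<close>; hence a covector as described exists. It is unique because
  \<open>horizontal_curve_exists\<close> provides a curve in each direction.\<close>

lemma base_derivative_kinetic:
  assumes metric: "riemannian_metric A \<rho>" and \<alpha>: "\<alpha> \<in> cotangent_space A q"
    and c: "c \<in> charts_at A q" and v: "v \<in> tangent_space A q"
  shows "base_derivative A D (kinetic A \<rho>) (q, \<alpha>) v =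
    base_part (kinetic_matrix A \<rho> c) (chart_map c q) (covec_components A c q \<alpha>) (v c) +
    \<alpha> (D q v (\<lambda>r. coord_tvec A c r (kinetic_matrix A \<rho> c (chart_map c q) *v covec_components A c q \<alpha>)))"
proof -
  note cA = charts_atD[OF c]
  define F where "F v = base_part (kinetic_matrix A \<rho> c) (chart_map c q) (covec_components A c q \<alpha>) (v c) +
    \<alpha> (D q v (\<lambda>r. coord_tvec A c r (kinetic_matrix A \<rho> c (chart_map c q) *v covec_components A c q \<alpha>)))" for v
  \<comment> \<open>By convention covectors vanish outside of the tangent space, which the formula
    \<open>F\<close> does not ensure.\<close>
  define \<beta> where "\<beta> v = (if v \<in> tangent_space A q then F v else 0)" for v
  define isb where "isb \<beta> \<longleftrightarrow> \<beta> \<in> cotangent_space A q \<and>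
    (\<forall>v\<in>tangent_space A q. \<forall>\<epsilon>>0. \<forall>u.
       horizontal_curve A D {-\<epsilon><..<\<epsilon>} u \<and> u 0 = (q, \<alpha>) \<and> velocity A (fst \<circ> u) 0 = v \<longrightarrow>
       \<beta> v = deriv (\<lambda>s. kinetic A \<rho> (u s)) 0)" for \<beta>
  note sm = smooth_vector_field_coord_const[OF cA(1) open_chart_dom[OF cA(1)] order_refl]
  have F_lin: "F (a *\<^sub>R v + b *\<^sub>R w) = a * F v + b * F w"
    if v: "v \<in> tangent_space A q" and w: "w \<in> tangent_space A q" for v w a b
  proof -
    note L = linear_base_part[OF differentiable_kinetic_matrix[OF metric c]]
    note T = connection_tangent[OF conn open_chart_dom[OF cA(1)] sm cA(2)]
    have D: "D q (a *\<^sub>R v + b *\<^sub>R w) (\<lambda>q. coord_tvec A c q z) =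
        a *\<^sub>R D q v (\<lambda>q. coord_tvec A c q z) + b *\<^sub>R D q w (\<lambda>q. coord_tvec A c q z)" for z
      by (rule connection_lincomb[OF conn open_chart_dom[OF cA(1)] sm cA(2) v w])
    have \<alpha>D: "\<alpha> (D q (a *\<^sub>R v + b *\<^sub>R w) (\<lambda>q. coord_tvec A c q z)) =
        a * \<alpha> (D q v (\<lambda>q. coord_tvec A c q z)) + b * \<alpha> (D q w (\<lambda>q. coord_tvec A c q z))" for z
      unfolding D by (rule cotangent_lincomb[OF \<alpha> T[OF v] T[OF w]])
    have base: "base_part (kinetic_matrix A \<rho> c) (chart_map c q) p ((a *\<^sub>R v + b *\<^sub>R w) c) =
        a * base_part (kinetic_matrix A \<rho> c) (chart_map c q) p (v c) +
        b * base_part (kinetic_matrix A \<rho> c) (chart_map c q) p (w c)" for p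
      by (simp add: scaleR_fun_apply linear_add[OF L] linear_scale[OF L])
    show ?thesis
      by (simp only: F_def \<alpha>D base) (simp only: distrib_left add_ac)
  qed
  have \<beta>: "isb \<beta>"
    unfolding isb_def
  proof (intro conjI ballI allI impI)
    show "\<beta> \<in> cotangent_space A q"
      unfolding cotangent_space_def
      by (auto simp: \<beta>_def F_lin tangent_space_lincomb simp del: plus_fun_apply)
    fix v \<epsilon> u
    assume v: "v \<in> tangent_space A q" and \<epsilon>: "0 < (\<epsilon>::real)"
      and u: "horizontal_curve A D {-\<epsilon><..<\<epsilon>} u \<and> u 0 = (q, \<alpha>) \<and> velocity A (fst \<circ> u) 0 = v"
    show "\<beta> v = deriv (\<lambda>s. kinetic A \<rho> (u s)) 0"
      using has_derivative_kinetic_horizontal[OF metric \<epsilon> _ _ _ v \<alpha> c] u v by (simp add: \<beta>_def F_def)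
  qed
  have "isb \<beta>' \<Longrightarrow> \<beta>' = \<beta>" for \<beta>'
  proof
    fix v assume b: "isb \<beta>'"
    show "\<beta>' v = \<beta> v"
    proof (cases "v \<in> tangent_space A q")
      case True
      from horizontal_curve_exists[OF True \<alpha>] obtain \<epsilon> u where
        u: "\<epsilon> > 0" "horizontal_curve A D {-\<epsilon><..<\<epsilon>} u \<and> u 0 = (q, \<alpha>) \<and> velocity A (fst \<circ> u) 0 = v" by blast
      have "\<beta>' v = deriv (\<lambda>s. kinetic A \<rho> (u s)) 0" "\<beta> v = deriv (\<lambda>s. kinetic A \<rho> (u s)) 0"
        using b \<beta> True u unfolding isb_def by blast+
      then show ?thesis by simp
    next
      case False
      then show ?thesis using b \<beta> cotangent_outside unfolding isb_def by metis
    qed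
  qed
  with \<beta> have "(THE \<beta>. isb \<beta>) = \<beta>" by (rule the_equality)
  then have "base_derivative A D (kinetic A \<rho>) (q, \<alpha>) = \<beta>"
    unfolding base_derivative_def prod.case isb_def .
  with v show ?thesis by (simp add: \<beta>_def F_def)
qed

text \<open>The Christoffel terms cancel because the connection is torsion-free.\<close>

lemma base_derivative_bracket:
  assumes tf: "torsion_free A D" and m: "riemannian_metric A \<rho>" "riemannian_metric A \<rho>'"
    and \<alpha>: "\<alpha> \<in> cotangent_space A q" and c: "c \<in> charts_at A q"
  shows "base_derivative A D (kinetic A \<rho>') (q, \<alpha>) (fiber_derivative A (kinetic A \<rho>) (q, \<alpha>)) -
    base_derivative A D (kinetic A \<rho>) (q, \<alpha>) (fiber_derivative A (kinetic A \<rho>') (q, \<alpha>)) =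
    cubic_bracket \<rho>' \<rho> c (chart_map c q) (covec_components A c q \<alpha>)"
  unfolding fiber_derivative_kinetic[OF m(1) \<alpha>] fiber_derivative_kinetic[OF m(2) \<alpha>]
  unfolding base_derivative_kinetic[OF m(1) \<alpha> c sharp_tangent[OF m(2) \<alpha>]]
    base_derivative_kinetic[OF m(2) \<alpha> c sharp_tangent[OF m(1) \<alpha>]]
  unfolding sharp_kinetic_matrix[OF m(1) c \<alpha>] sharp_kinetic_matrix[OF m(2) c \<alpha>]
    coord_tvec_component[OF c] cubic_bracket_def
  by (subst torsion_free_coord[OF tf c]) simp

end

section \<open>Separation of the homogeneous parts\<close>

lemma poisson_eq:
  assumes m: "riemannian_metric A \<rho>" "riemannian_metric A \<rho>'"
    and h: "smooth_function A UNIV h" "smooth_function A UNIV h'"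
    and c: "c \<in> charts_at A q" and \<alpha>: "\<alpha> \<in> cotangent_space A q"
  shows "poisson A (simple_hamiltonian A \<rho>' h') (simple_hamiltonian A \<rho> h) (q, \<alpha>) =
    cubic_bracket \<rho>' \<rho> c (chart_map c q) (covec_components A c q \<alpha>) + linear_bracket \<rho>' h' \<rho> h q \<alpha>"
  using poisson_simple_hamiltonian[OF m h \<alpha>] cubic_bracket_chart_change[OF m c _ \<alpha>] by auto

text \<open>One scaling factor other than 1 and -1 separates degree three from degree one: with C
  and L for the two parts, C + L = 0 and 8 * C + 2 * L = 0 force C = L = 0.\<close>

lemma poisson_double:
  assumes m: "riemannian_metric A \<rho>" "riemannian_metric A \<rho>'"
    and h: "smooth_function A UNIV h" "smooth_function A UNIV h'"
    and c: "c \<in> charts_at A q" and \<alpha>: "\<alpha> \<in> cotangent_space A q"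
  shows "poisson A (simple_hamiltonian A \<rho>' h') (simple_hamiltonian A \<rho> h) (q, 2 *\<^sub>R \<alpha>) =
    8 * cubic_bracket \<rho>' \<rho> c (chart_map c q) (covec_components A c q \<alpha>) + 2 * linear_bracket \<rho>' h' \<rho> h q \<alpha>"
proof -
  have \<alpha>2: "2 *\<^sub>R \<alpha> \<in> cotangent_space A q"
    using \<alpha> by (rule subspace_scale[OF subspace_cotangent_space])
  have p2: "covec_components A c q (2 *\<^sub>R \<alpha>) = 2 *\<^sub>R covec_components A c q \<alpha>"
    using covec_components_lincomb[of c q 2 \<alpha> 0 \<alpha>] by (simp only: scaleR_zero_left add_0_right)
  have base: "base_part (kinetic_matrix A \<rho> c) (chart_map c q) (2 *\<^sub>R p) (N *v (2 *\<^sub>R p)) =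
      8 * base_part (kinetic_matrix A \<rho> c) (chart_map c q) p (N *v p)"
    if "riemannian_metric A \<rho>" for \<rho> p and N :: "real^'n^'n"
    by (simp add: matrix_vector_mult_scaleR linear_scale[OF linear_base_part[OF differentiable_kinetic_matrix[OF that c]]])
      (simp add: base_part_def matrix_vector_mult_scaleR)
  have lin: "linear (frechet_derivative (h \<circ> chart_inv c) (at (chart_map c q)))"
    if "smooth_function A UNIV h" for h
    by (rule has_derivative_linear[OF smooth_function_has_derivative[OF that open_UNIV UNIV_I c]])
  have "linear_bracket \<rho>' h' \<rho> h q (2 *\<^sub>R \<alpha>) = 2 * linear_bracket \<rho>' h' \<rho> h q \<alpha>"
    unfolding linear_bracket_eq[OF m h c \<alpha>] linear_bracket_eq[OF m h c \<alpha>2] p2 matrix_vector_mult_scaleR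
      linear_scale[OF lin[OF h(1)]] linear_scale[OF lin[OF h(2)]] by simp
  then show ?thesis
    unfolding poisson_eq[OF m h c \<alpha>2] p2 by (simp add: cubic_bracket_def base[OF m(1)] base[OF m(2)])
qed

lemma poisson_vanishes_iff:
  assumes m: "riemannian_metric A \<rho>" "riemannian_metric A \<rho>'"
    and h: "smooth_function A UNIV h" "smooth_function A UNIV h'"
    and V: "linear_subbundle A V"
    and c: "\<And>q. c q \<in> charts_at A q"
  shows "(\<forall>\<sigma>\<in>V. poisson A (simple_hamiltonian A \<rho>' h') (simple_hamiltonian A \<rho> h) \<sigma> = 0) \<longleftrightarrow>
    (\<forall>q \<alpha>. (q, \<alpha>) \<in> V \<longrightarrow>
      cubic_bracket \<rho>' \<rho> (c q) (chart_map (c q) q) (covec_components A (c q) q \<alpha>) = 0 \<and>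
      linear_bracket \<rho>' h' \<rho> h q \<alpha> = 0)"
    (is "?L \<longleftrightarrow> ?R")
proof -
  have \<alpha>: "\<alpha> \<in> cotangent_space A q" if "(q, \<alpha>) \<in> V" for q \<alpha>
    using V that unfolding linear_subbundle_def cotangent_bundle_def by blast
  have V2: "(q, 2 *\<^sub>R \<alpha>) \<in> V" if "(q, \<alpha>) \<in> V" for q \<alpha>
  proof -
    have "subspace {\<alpha>. (q, \<alpha>) \<in> V}" using V by (simp add: linear_subbundle_def)
    from subspace_scale[OF this, of \<alpha> 2] that show ?thesis by simp
  qed
  show ?thesis
  proof
    assume L: ?L
    show ?R
    proof (intro allI impI)
      fix q \<alpha> assume v: "(q, \<alpha>) \<in> V"
      note 1 = bspec[OF L v, unfolded poisson_eq[OF m h c \<alpha>[OF v]]]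
      note 2 = bspec[OF L V2[OF v], unfolded poisson_double[OF m h c \<alpha>[OF v]]]
      from 1 2 show "cubic_bracket \<rho>' \<rho> (c q) (chart_map (c q) q) (covec_components A (c q) q \<alpha>) = 0 \<and>
          linear_bracket \<rho>' h' \<rho> h q \<alpha> = 0" by linarith
    qed
  next
    assume R: ?R
    show ?L
    proof
      fix \<sigma> assume "\<sigma> \<in> V"
      then obtain q \<alpha> where \<sigma>: "\<sigma> = (q, \<alpha>)" and v: "(q, \<alpha>) \<in> V" by (cases \<sigma>) auto
      then show "poisson A (simple_hamiltonian A \<rho>' h') (simple_hamiltonian A \<rho> h) \<sigma> = 0"
        using R poisson_eq[OF m h c \<alpha>[OF v]] by simp
    qed
  qed
qed

end

section \<open>The equivalences\<close>

theorem lemma37: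
  fixes A :: "('q::{t2_space,second_countable_topology}, 'n::finite) chart set"
    and \<rho> \<rho>' :: "('q, 'n) metric"
    and h h' :: "'q \<Rightarrow> real"
    and H H' :: "'q \<times> ('q, 'n) covec \<Rightarrow> real"
    and V :: "('q \<times> ('q, 'n) covec) set"
  assumes Q: "smooth_structure A"
    and metrics: "riemannian_metric A \<rho>" "riemannian_metric A \<rho>'"
    and potentials: "smooth_function A UNIV h" "smooth_function A UNIV h'"
    and H: "H = simple_hamiltonian A \<rho> h"
    and H': "H' = simple_hamiltonian A \<rho>' h'"
    and V: "linear_subbundle A V"
  shows "(\<forall>D. connection A D \<and> torsion_free A D \<longrightarrow>
      ((\<forall>\<sigma>\<in>V. poisson A H' H \<sigma> = 0) \<longleftrightarrow>
       (\<forall>q \<alpha>. (q, \<alpha>) \<in> V \<longrightarrow>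
          base_derivative A D (kinetic A \<rho>') (q, \<alpha>) (fiber_derivative A (kinetic A \<rho>) (q, \<alpha>)) -
          base_derivative A D (kinetic A \<rho>) (q, \<alpha>) (fiber_derivative A (kinetic A \<rho>') (q, \<alpha>)) = 0 \<and>
          differential A h' q (fiber_derivative A (kinetic A \<rho>) (q, \<alpha>)) -
          differential A h q (fiber_derivative A (kinetic A \<rho>') (q, \<alpha>)) = 0)))
    \<and> ((\<forall>\<sigma>\<in>V. poisson A H' H \<sigma> = 0) \<longleftrightarrow>
       (\<forall>c\<in>A. \<forall>q\<in>chart_dom c. \<forall>\<alpha>. (q, \<alpha>) \<in> V \<longrightarrow>
          (let x = chart_map c q;
               p = covec_components A c q \<alpha>;
               M = kinetic_matrix A \<rho> c;
               M' = kinetic_matrix A \<rho>' c;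
               f = h \<circ> chart_inv c;
               f' = h' \<circ> chart_inv c
           in (\<Sum>i\<in>UNIV. \<Sum>j\<in>UNIV. \<Sum>k\<in>UNIV. \<Sum>l\<in>UNIV.
                 (partial k (\<lambda>y. M' y $ i $ j) x * M x $ k $ l -
                  partial k (\<lambda>y. M y $ i $ j) x * M' x $ k $ l) * p $ i * p $ j * p $ l) = 0 \<and>
              (\<Sum>k\<in>UNIV. \<Sum>l\<in>UNIV.
                 (partial k f' x * M x $ k $ l - partial k f x * M' x $ k $ l) * p $ l) = 0)))"
proof -
  interpret smooth_manifold A by (rule smooth_manifold.intro[OF Q])
  have cot: "\<alpha> \<in> cotangent_space A q" if "(q, \<alpha>) \<in> V" for q \<alpha>
    using V that unfolding linear_subbundle_def cotangent_bundle_def by blast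
  \<comment> \<open>Items 2 and 3 are both compared with one middle condition: the cubic and the
    linear part vanish on the subbundle, computed in the chart selected at each point.\<close>
  note iff = poisson_vanishes_iff[OF metrics potentials V, where c = "chart_at A", OF chart_at_charts_at,
      folded H H']
  show ?thesis
  proof (intro conjI allI impI)
    fix D assume D: "connection A D \<and> torsion_free A D"
    show "(\<forall>\<sigma>\<in>V. poisson A H' H \<sigma> = 0) \<longleftrightarrow>
       (\<forall>q \<alpha>. (q, \<alpha>) \<in> V \<longrightarrow>
          base_derivative A D (kinetic A \<rho>') (q, \<alpha>) (fiber_derivative A (kinetic A \<rho>) (q, \<alpha>)) -
          base_derivative A D (kinetic A \<rho>) (q, \<alpha>) (fiber_derivative A (kinetic A \<rho>') (q, \<alpha>)) = 0 \<and>
          differential A h' q (fiber_derivative A (kinetic A \<rho>) (q, \<alpha>)) -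
          differential A h q (fiber_derivative A (kinetic A \<rho>') (q, \<alpha>)) = 0)"
      unfolding iff
    proof (intro iff_allI imp_cong refl)
      fix q \<alpha> assume "(q, \<alpha>) \<in> V"
      note \<alpha> = cot[OF this]
      show "cubic_bracket \<rho>' \<rho> (chart_at A q) (chart_map (chart_at A q) q)
            (covec_components A (chart_at A q) q \<alpha>) = 0 \<and> linear_bracket \<rho>' h' \<rho> h q \<alpha> = 0 \<longleftrightarrow>
          base_derivative A D (kinetic A \<rho>') (q, \<alpha>) (fiber_derivative A (kinetic A \<rho>) (q, \<alpha>)) -
          base_derivative A D (kinetic A \<rho>) (q, \<alpha>) (fiber_derivative A (kinetic A \<rho>') (q, \<alpha>)) = 0 \<and>
          differential A h' q (fiber_derivative A (kinetic A \<rho>) (q, \<alpha>)) -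
          differential A h q (fiber_derivative A (kinetic A \<rho>') (q, \<alpha>)) = 0"
        unfolding base_derivative_bracket[OF conjunct1[OF D] conjunct2[OF D] metrics \<alpha> chart_at_charts_at]
        unfolding fiber_derivative_kinetic[OF metrics(1) \<alpha>] fiber_derivative_kinetic[OF metrics(2) \<alpha>]
          linear_bracket_def ..
    qed
  next
    show "(\<forall>\<sigma>\<in>V. poisson A H' H \<sigma> = 0) \<longleftrightarrow>
       (\<forall>c\<in>A. \<forall>q\<in>chart_dom c. \<forall>\<alpha>. (q, \<alpha>) \<in> V \<longrightarrow>
          (let x = chart_map c q;
               p = covec_components A c q \<alpha>;
               M = kinetic_matrix A \<rho> c;
               M' = kinetic_matrix A \<rho>' c;
               f = h \<circ> chart_inv c;
               f' = h' \<circ> chart_inv c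
           in (\<Sum>i\<in>UNIV. \<Sum>j\<in>UNIV. \<Sum>k\<in>UNIV. \<Sum>l\<in>UNIV.
                 (partial k (\<lambda>y. M' y $ i $ j) x * M x $ k $ l -
                  partial k (\<lambda>y. M y $ i $ j) x * M' x $ k $ l) * p $ i * p $ j * p $ l) = 0 \<and>
              (\<Sum>k\<in>UNIV. \<Sum>l\<in>UNIV.
                 (partial k f' x * M x $ k $ l - partial k f x * M' x $ k $ l) * p $ l) = 0))"
      (is "_ \<longleftrightarrow> (\<forall>c\<in>A. \<forall>q\<in>chart_dom c. \<forall>\<alpha>. (q, \<alpha>) \<in> V \<longrightarrow> ?P c q \<alpha>)")
    proof -
      have P: "?P c q \<alpha> \<longleftrightarrow> cubic_bracket \<rho>' \<rho> (chart_at A q) (chart_map (chart_at A q) q)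
          (covec_components A (chart_at A q) q \<alpha>) = 0 \<and> linear_bracket \<rho>' h' \<rho> h q \<alpha> = 0"
        if "c \<in> A" "q \<in> chart_dom c" "(q, \<alpha>) \<in> V" for c q \<alpha>
      proof -
        note c = charts_atI[OF that(1,2)]
        show ?thesis
          unfolding Let_def cubic_bracket_sum[OF metrics c refl]
            linear_bracket_sum[OF metrics potentials c cot[OF that(3)]]
            cubic_bracket_chart_change[OF metrics c chart_at_charts_at cot[OF that(3)]] by simp
      qed
      \<comment> \<open>For the way back from item 3 each point is examined in its own chart
        \<open>chart_at A q\<close>, which belongs to the atlas and contains the point.\<close>
      show ?thesis
        unfolding iff using P charts_atD[OF chart_at_charts_at] by blast
    qed
  qed
qed

end
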